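(* Let irreducible representations $W_1,\dots,W_n$ of $\mathbf g$ and distinct points $\zeta_1,\dots,\zeta_n\in\mathbb P$ be given. There is a field on $\mathbb P$, defined for $z$ distinct from each $\zeta_k$ and each meromorphic map $\nu:\mathbb P\to\mathbf g$ regular at $z$, $$j^{\nu(z)}(z):\mathcal W^z\to\mathcal W\otimes K_z,$$ which for every choice of a point $P\notin\{\zeta_1,\dots,\zeta_n,z\}$ restricts on $\mathcal W_P^z$ to $\epsilon^{\nu(z)}(z)+\iota^{\nu(z)}(z)$ (defined using $P$). For $v_1,v_2\in\mathbf g$ it satisfies, as $z_2\to z_1$, $$\begin{aligned} j^{v_2}(z_2)j^{v_1}(z_1)&-\frac{(v_1,v_2)\,du_{z_1}du_{z_2}}{(u(z_1)-u(z_2))^2}-\frac{1}{u(z_2)-u(z_1)}\,du_{z_2}\,j^{[v_2,v_1]}(z_1)\\ &\longrightarrow\ \iota^{v_2}(z_1)\iota^{v_1}(z_1)+\epsilon^{v_2}(z_1)\epsilon^{v_1}(z_1)+\epsilon^{v_2}(z_1)\iota^{v_1}(z_1)+\epsilon^{v_1}(z_1)\iota^{v_2}(z_1)+\frac{d\hat\iota^{[v_2,v_1]}}{du}(z_1)\,du_{z_1}^2 ,\end{aligned}$$ where the limit can be calculated with any $P\notin\{\zeta_1,\dots,\zeta_n,z_1\}$ and coordinate $u$ with pole at $P$, and is independent of the choice of $P$.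
   Context: $\mathbb P$ is a complex projective line with canonical bundle $K$; a coordinate is a meromorphic function with exactly one pole, which is simple. $\mathbf g$ is a complex Lie algebra with a nondegenerate invariant symmetric bilinear form $(\cdot,\cdot)$. $\mathfrak g$ is the Lie algebra of all meromorphic maps $\mathbb P\to\mathbf g$, $\mathfrak g^z$ the subalgebra of maps regular at $z$; $\mathbf g\subset\mathfrak g$ as constant maps. $\mathcal W=U\mathfrak g\otimes_{U\mathbf g}(W_1\otimes\cdots\otimes W_n)$, $\mathcal W^z=U\mathfrak g^z\otimes_{U\mathbf g}(W_1\otimes\cdots\otimes W_n)$. For $P\notin\{\zeta_k\}$, $\mathfrak g_-$ is the Lie algebra of meromorphic maps to $\mathbf g$ regular and vanishing at $P$, $\mathfrak g_-^z=\mathfrak g_-\cap\mathfrak g^z$, $\mathcal W_P=U\mathfrak g_-\otimes(W_1\otimes\cdots\otimes W_n)\subset\mathcal W$, $\mathcal W_P^z=U\mathfrak g_-^z\otimes(W_1\otimes\cdots\otimes W_n)\subset\mathcal W^z$ (inclusions by PBW; $\otimes$ over $\mathbb C$). With $u$ a coordinate with pole at $P$, $a\in\mathbf g$, $z\ne P$: $\epsilon^a(z):\mathcal W_P\to\mathcal W_P\otimes K_z$ is left multiplication by $\frac{a}{u-u(z)}\otimes du_z$; for $z$ also distinct from the $\zeta_k$, $\iota^a(z):\mathcal W_P^z\to\mathcal W_P^z\otimes K_z$ is defined (simultaneously for all $a$) by $$\iota^a(z)(w_1\otimes\cdots\otimes w_n)=\sum_k w_1\otimes\cdots\otimes\frac{a(w_k)\,du_z}{u(z)-u(\zeta_k)}\otimes\cdots\otimes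 w_n$$ and, for $\alpha\in\mathfrak g_-^z$ acting by left multiplication, $$\iota^a(z)\circ\alpha-\alpha\circ\iota^a(z)=-(a,d\alpha(z))+\iota^{[a,\alpha(z)]}(z)-[\epsilon^a(z),\alpha-\alpha(z)].$$ One writes $\iota^a(z)=\hat\iota^a(z)du_z$; $j^v$ is $j^\nu$ for the constant map $\nu=v$. The factors $du_{z_1},du_{z_2}$ commute without signs. Limits: the expression is applied to a vector of $\mathcal W_P^{z_1}$ and is defined for $z_2\ne z_1$ near $z_1$; it is the image in $\mathcal W_P$ of a finite sum of $\mathbf g^{\otimes m}\otimes W_1\otimes\cdots\otimes W_n$-valued rational functions of $m$ auxiliary points and of $u(z_2)$; the limit statement means such a representative can be chosen without pole along $z_2=z_1$, its value at $z_2=z_1$ giving the right side.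
   Formalization: Independence of P is stated for the left side with u fixed: its limit may be computed with any other point and coordinate. If u varies with P, the limit changes by a multiple of j^{[v2,v1]}(z1), so literal independence fails unless [v1,v2]=0. *)

theory Defs
  imports
    "HOL-Complex_Analysis.Complex_Analysis"
    "HOL-Computational_Algebra.Polynomial"
    "HOL-Library.Poly_Mapping"
    "HOL-Library.FuncSet"
begin

section \<open>Complex vector spaces and Lie algebras\<close>

class complex_vector = ab_group_add +
  fixes scaleC :: "complex \<Rightarrow> 'a \<Rightarrow> 'a"  (infixr "*\<^sub>C" 75)
  assumes scaleC_add_right: "c *\<^sub>C (x + y) = c *\<^sub>C x + c *\<^sub>C y"
    and scaleC_add_left: "(c + d) *\<^sub>C x = c *\<^sub>C x + d *\<^sub>C x"
    and scaleC_scaleC: "c *\<^sub>C d *\<^sub>C x = (c * d) *\<^sub>C x"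
    and scaleC_one: "1 *\<^sub>C x = x"

global_interpretation complex_vector: vector_space "scaleC :: complex \<Rightarrow> 'a \<Rightarrow> 'a::complex_vector"
  defines cdependent = complex_vector.dependent
    and csubspace = complex_vector.subspace
    and cspan = complex_vector.span
  by unfold_locales (simp_all add: scaleC_add_right scaleC_add_left scaleC_scaleC scaleC_one)

instantiation complex :: complex_vector
begin

definition scaleC_complex :: "complex \<Rightarrow> complex \<Rightarrow> complex"
  where "scaleC_complex = (*)"

instance
  by standard (simp_all add: scaleC_complex_def algebra_simps)

end

instantiation poly_mapping :: (type, complex_vector) complex_vector
begin

definition scaleC_poly_mapping :: "complex \<Rightarrow> ('a \<Rightarrow>\<^sub>0 'b) \<Rightarrow> 'a \<Rightarrow>\<^sub>0 'b"
  where "scaleC_poly_mapping c = Poly_Mapping.map (scaleC c)"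

lemma lookup_scaleC: "Poly_Mapping.lookup (c *\<^sub>C f) k = c *\<^sub>C Poly_Mapping.lookup f k"
  unfolding scaleC_poly_mapping_def
  by (simp add: Poly_Mapping.map.rep_eq when_def)

instance
  by standard (rule poly_mapping_eqI, simp add: lookup_scaleC lookup_add
      scaleC_add_right scaleC_add_left scaleC_scaleC scaleC_one)+

end

class complex_lie_algebra = complex_vector +
  fixes lie :: "'a \<Rightarrow> 'a \<Rightarrow> 'a"
  assumes lie_add_left: "lie (a + b) c = lie a c + lie b c"
    and lie_add_right: "lie a (b + c) = lie a b + lie a c"
    and lie_scale_left: "lie (s *\<^sub>C a) b = s *\<^sub>C lie a b"
    and lie_scale_right: "lie a (s *\<^sub>C b) = s *\<^sub>C lie a b"
    and lie_self: "lie a a = 0"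
    and lie_jacobi: "lie a (lie b c) + lie b (lie c a) + lie c (lie a b) = 0"

class quadratic_lie_algebra = complex_lie_algebra +
  fixes form :: "'a \<Rightarrow> 'a \<Rightarrow> complex"
  assumes form_add: "form (a + b) c = form a c + form b c"
    and form_scale: "form (s *\<^sub>C a) b = s * form a b"
    and form_sym: "form a b = form b a"
    and form_invariant: "form (lie a b) c = form a (lie b c)"
    and form_nondegenerate: "(\<forall>b. form a b = 0) \<Longrightarrow> a = 0"

text \<open>All representations live on subspaces of one ambient space, so that a family of them can be
  indexed by numbers.\<close>

definition is_rep ::
  "'w::complex_vector set \<Rightarrow> ('g::complex_lie_algebra \<Rightarrow> 'w \<Rightarrow> 'w) \<Rightarrow> bool"
  where "is_rep V r \<longleftrightarrow> csubspace V \<and>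
    (\<forall>a. \<forall>x\<in>V. r a x \<in> V) \<and>
    (\<forall>a c. \<forall>x\<in>V. \<forall>y\<in>V. r a (c *\<^sub>C x + y) = c *\<^sub>C r a x + r a y) \<and>
    (\<forall>a b c. \<forall>x\<in>V. r (c *\<^sub>C a + b) x = c *\<^sub>C r a x + r b x) \<and>
    (\<forall>a b. \<forall>x\<in>V. r (lie a b) x = r a (r b x) - r b (r a x))"

definition irreducible_rep ::
  "'w::complex_vector set \<Rightarrow> ('g::complex_lie_algebra \<Rightarrow> 'w \<Rightarrow> 'w) \<Rightarrow> bool"
  where "irreducible_rep V r \<longleftrightarrow> is_rep V r \<and> V \<noteq> {0} \<and>
    (\<forall>S. csubspace S \<longrightarrow> S \<subseteq> V \<longrightarrow> (\<forall>a. \<forall>x\<in>S. r a x \<in> S) \<longrightarrow> S = {0} \<or> S = V)"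


section \<open>The projective line\<close>

datatype proj = Pt complex | Infty

text \<open>\<open>chart p\<close> is a holomorphic parametrization of a neighbourhood of \<open>p\<close>, sending \<open>0\<close> to \<open>p\<close>.\<close>

fun chart :: "proj \<Rightarrow> complex \<Rightarrow> proj"
  where
    "chart (Pt a) h = Pt (a + h)"
  | "chart Infty h = (if h = 0 then Infty else Pt (1 / h))"

text \<open>Scalar meromorphic functions are total functions taking the value \<open>0\<close> at their poles
  (the convention of \<open>nicely_meromorphic_on\<close>).\<close>

definition mero_fun :: "(proj \<Rightarrow> complex) \<Rightarrow> bool"
  where "mero_fun f \<longleftrightarrow> (\<forall>p. (\<lambda>h. f (chart p h)) nicely_meromorphic_on {0})"

definition has_pole :: "(proj \<Rightarrow> complex) \<Rightarrow> proj \<Rightarrow> bool"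
  where "has_pole f p \<longleftrightarrow> is_pole (\<lambda>h. f (chart p h)) 0"

definition coordinate :: "(proj \<Rightarrow> complex) \<Rightarrow> proj \<Rightarrow> bool"
  where "coordinate u P \<longleftrightarrow> mero_fun u \<and> (\<forall>p. has_pole u p \<longleftrightarrow> p = P) \<and>
    zorder (\<lambda>h. u (chart P h)) 0 = -1"

text \<open>The fibre \<open>K\<^sub>z\<close> of the canonical bundle is identified with \<open>\<complex>\<close> by taking the differential at
  \<open>z\<close> of the inverse of \<open>chart z\<close> as its basis vector. Hence \<open>V \<otimes> K\<^sub>z\<close> is \<open>V\<close>, and the covector
  \<open>du\<^sub>z\<close> is the following number.\<close>

definition diff_at :: "(proj \<Rightarrow> complex) \<Rightarrow> proj \<Rightarrow> complex"
  where "diff_at u z = deriv (\<lambda>h. u (chart z h)) 0"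


section \<open>Meromorphic maps into the Lie algebra\<close>

text \<open>A meromorphic map to a vector space is a partial map, undefined exactly at its poles, whose
  components with respect to some finite linearly independent set are meromorphic functions.\<close>

type_synonym 'g mmap = "proj \<Rightarrow> 'g option"

definition mero_map :: "'g::complex_vector mmap \<Rightarrow> bool"
  where "mero_map \<nu> \<longleftrightarrow> (\<exists>A f. finite A \<and> \<not> cdependent A \<and> (\<forall>a\<in>A. mero_fun (f a)) \<and>
    \<nu> = (\<lambda>p. if \<exists>a\<in>A. has_pole (f a) p then None else Some (\<Sum>a\<in>A. f a p *\<^sub>C a)))"

abbreviation val :: "'g mmap \<Rightarrow> proj \<Rightarrow> 'g"
  where "val \<nu> z \<equiv> the (\<nu> z)"

text \<open>\<open>mext \<phi>\<close> is the meromorphic map that agrees with \<open>\<phi>\<close> off a finite set. It is used to perform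
  pointwise operations regardless of poles and removable singularities.\<close>

definition mext :: "(proj \<Rightarrow> 'g::complex_vector) \<Rightarrow> 'g mmap"
  where "mext \<phi> = (THE \<nu>. mero_map \<nu> \<and> finite {p. \<nu> p \<noteq> Some (\<phi> p)})"

definition mconst :: "'g \<Rightarrow> 'g mmap"
  where "mconst c = (\<lambda>p. Some c)"

definition mlin :: "complex \<Rightarrow> 'g::complex_vector mmap \<Rightarrow> 'g mmap \<Rightarrow> 'g mmap"
  where "mlin c \<alpha> \<beta> = mext (\<lambda>p. c *\<^sub>C val \<alpha> p + val \<beta> p)"

definition mdiff :: "'g::complex_vector mmap \<Rightarrow> 'g mmap \<Rightarrow> 'g mmap"
  where "mdiff \<alpha> \<beta> = mext (\<lambda>p. val \<alpha> p - val \<beta> p)"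

definition mlie :: "'g::complex_lie_algebra mmap \<Rightarrow> 'g mmap \<Rightarrow> 'g mmap"
  where "mlie \<alpha> \<beta> = mext (\<lambda>p. lie (val \<alpha> p) (val \<beta> p))"

text \<open>The map \<open>a / (u - u(z))\<close>.\<close>

definition mfrac :: "(proj \<Rightarrow> complex) \<Rightarrow> proj \<Rightarrow> 'g::complex_vector \<Rightarrow> 'g mmap"
  where "mfrac u z a = mext (\<lambda>p. (1 / (u p - u z)) *\<^sub>C a)"

definition all_maps :: "'g::complex_vector mmap set"
  where "all_maps = {\<nu>. mero_map \<nu>}"

definition regular_at :: "proj \<Rightarrow> 'g::complex_vector mmap set"
  where "regular_at z = {\<nu>. mero_map \<nu> \<and> \<nu> z \<noteq> None}"

definition vanishing_at :: "proj \<Rightarrow> 'g::complex_vector mmap set"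
  where "vanishing_at P = {\<nu>. mero_map \<nu> \<and> \<nu> P = Some 0}"


section \<open>The modules\<close>

text \<open>For a Lie algebra \<open>L\<close> of meromorphic maps, with subalgebra \<open>L\<^sub>0\<close> of constant maps, the space
  \<open>U L \<otimes>\<^bsub>U L\<^sub>0\<^esub> (W\<^sub>0 \<otimes> \<dots> \<otimes> W\<^bsub>n-1\<^esub>)\<close> is the quotient of the free vector space on pairs (word in \<open>L\<close>,
  tuple of vectors) by the relations spelled out below: linearity in every letter and
  \<open>\<alpha>\<beta> - \<beta>\<alpha> = [\<alpha>,\<beta>]\<close> (defining \<open>U L\<close> as a quotient of the tensor algebra), linearity in every vector
  (defining the tensor product of the \<open>W\<^sub>k\<close>), and the passage of constants through the tensor sign,
  a constant acting diagonally on the tensor product.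

  If \<open>L\<close> contains all constants this is the tensor product over \<open>U\<close> of the given Lie algebra; if \<open>L\<close>
  consists of maps vanishing at some point then \<open>L\<^sub>0 = 0\<close> and it is the tensor product over \<open>\<complex>\<close>.

  Elements of the quotient are handled through representatives, \<open>equiv_mod\<close> being equality in the
  quotient. For \<open>L \<subseteq> L'\<close> the canonical map between the quotients (injective by the
  Poincare-Birkhoff-Witt theorem) is thus the identity on representatives.\<close>

type_synonym ('g, 'w) ivec = "('g mmap list \<times> (nat \<Rightarrow> 'w)) \<Rightarrow>\<^sub>0 complex"

definition bas :: "'g mmap list \<Rightarrow> (nat \<Rightarrow> 'w) \<Rightarrow> ('g, 'w) ivec"
  where "bas \<alpha>s w = Poly_Mapping.single (\<alpha>s, w) 1"

definition tuples :: "nat \<Rightarrow> (nat \<Rightarrow> 'w set) \<Rightarrow> (nat \<Rightarrow> 'w) set"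
  where "tuples n W = PiE {..<n} W"

definition vecs :: "nat \<Rightarrow> (nat \<Rightarrow> 'w set) \<Rightarrow> 'g mmap set \<Rightarrow> ('g, 'w) ivec set"
  where "vecs n W L = {x. Poly_Mapping.keys x \<subseteq> lists L \<times> tuples n W}"

definition relators ::
  "nat \<Rightarrow> (nat \<Rightarrow> 'w::complex_vector set) \<Rightarrow> (nat \<Rightarrow> 'g::complex_lie_algebra \<Rightarrow> 'w \<Rightarrow> 'w) \<Rightarrow>
    'g mmap set \<Rightarrow> ('g, 'w) ivec set"
  where "relators n W \<rho> L =
    {bas (xs @ [mlin c \<alpha> \<beta>] @ ys) w - c *\<^sub>C bas (xs @ [\<alpha>] @ ys) w - bas (xs @ [\<beta>] @ ys) w
      | c \<alpha> \<beta> xs ys w. \<alpha> \<in> L \<and> \<beta> \<in> L \<and> xs \<in> lists L \<and> ys \<in> lists L \<and> w \<in> tuples n W} \<union>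
    {bas (xs @ [\<alpha>, \<beta>] @ ys) w - bas (xs @ [\<beta>, \<alpha>] @ ys) w - bas (xs @ [mlie \<alpha> \<beta>] @ ys) w
      | \<alpha> \<beta> xs ys w. \<alpha> \<in> L \<and> \<beta> \<in> L \<and> xs \<in> lists L \<and> ys \<in> lists L \<and> w \<in> tuples n W} \<union>
    {bas xs (w(k := c *\<^sub>C a + b)) - c *\<^sub>C bas xs (w(k := a)) - bas xs (w(k := b))
      | c a b k xs w. k < n \<and> a \<in> W k \<and> b \<in> W k \<and> xs \<in> lists L \<and> w \<in> tuples n W} \<union>
    {bas (xs @ [mconst c]) w - (\<Sum>k<n. bas xs (w(k := \<rho> k c (w k))))
      | c xs w. mconst c \<in> L \<and> xs \<in> lists L \<and> w \<in> tuples n W}"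

definition equiv_mod ::
  "nat \<Rightarrow> (nat \<Rightarrow> 'w::complex_vector set) \<Rightarrow> (nat \<Rightarrow> 'g::complex_lie_algebra \<Rightarrow> 'w \<Rightarrow> 'w) \<Rightarrow>
    'g mmap set \<Rightarrow> ('g, 'w) ivec \<Rightarrow> ('g, 'w) ivec \<Rightarrow> bool"
  where "equiv_mod n W \<rho> L x y \<longleftrightarrow> x - y \<in> cspan (relators n W \<rho> L)"

text \<open>\<open>T\<close> induces a linear map from the quotient attached to \<open>L\<close> to the one attached to \<open>L'\<close>.\<close>

definition induces_linear ::
  "nat \<Rightarrow> (nat \<Rightarrow> 'w::complex_vector set) \<Rightarrow> (nat \<Rightarrow> 'g::complex_lie_algebra \<Rightarrow> 'w \<Rightarrow> 'w) \<Rightarrow>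
    'g mmap set \<Rightarrow> 'g mmap set \<Rightarrow> (('g, 'w) ivec \<Rightarrow> ('g, 'w) ivec) \<Rightarrow> bool"
  where "induces_linear n W \<rho> L L' T \<longleftrightarrow>
    (\<forall>x\<in>vecs n W L. T x \<in> vecs n W L') \<and>
    (\<forall>x\<in>vecs n W L. \<forall>y\<in>vecs n W L. equiv_mod n W \<rho> L x y \<longrightarrow> equiv_mod n W \<rho> L' (T x) (T y)) \<and>
    (\<forall>c. \<forall>x\<in>vecs n W L. \<forall>y\<in>vecs n W L. equiv_mod n W \<rho> L' (T (c *\<^sub>C x + y)) (c *\<^sub>C T x + T y))"

definition lin_ext ::
  "('g mmap list \<Rightarrow> (nat \<Rightarrow> 'w) \<Rightarrow> ('g, 'w) ivec) \<Rightarrow> ('g, 'w) ivec \<Rightarrow> ('g, 'w) ivec"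
  where "lin_ext \<phi> x =
    (\<Sum>k\<in>Poly_Mapping.keys x. Poly_Mapping.lookup x k *\<^sub>C \<phi> (fst k) (snd k))"

definition lmult :: "'g mmap \<Rightarrow> ('g, 'w) ivec \<Rightarrow> ('g, 'w) ivec"
  where "lmult \<alpha> = lin_ext (\<lambda>\<alpha>s w. bas (\<alpha> # \<alpha>s) w)"


section \<open>The operators\<close>

definition eps ::
  "(proj \<Rightarrow> complex) \<Rightarrow> proj \<Rightarrow> 'g::complex_vector \<Rightarrow> ('g, 'w) ivec \<Rightarrow> ('g, 'w) ivec"
  where "eps u z a x = diff_at u z *\<^sub>C lmult (mfrac u z a) x"

text \<open>The commutation rule of \<open>\<iota>\<close> with left multiplications is read as a recursion on the length of
  a word, simultaneously for all \<open>a\<close>. There \<open>(a, d\<alpha>(z))\<close> is the differential at \<open>z\<close> of the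
  function \<open>(a, \<alpha>)\<close>, and the commutator of \<open>\<epsilon>\<close> with \<open>\<alpha> - \<alpha>(z)\<close> is left multiplication by a bracket
  of meromorphic maps, which is again regular at \<open>z\<close> and vanishes at the pole of \<open>u\<close>.\<close>

fun iota_word ::
  "nat \<Rightarrow> (nat \<Rightarrow> 'g::quadratic_lie_algebra \<Rightarrow> 'w \<Rightarrow> 'w) \<Rightarrow> (nat \<Rightarrow> proj) \<Rightarrow>
    (proj \<Rightarrow> complex) \<Rightarrow> proj \<Rightarrow> 'g \<Rightarrow> 'g mmap list \<Rightarrow> (nat \<Rightarrow> 'w) \<Rightarrow> ('g, 'w) ivec"
  where
    "iota_word n \<rho> \<zeta> u z a [] w =
      (\<Sum>k<n. (diff_at u z / (u z - u (\<zeta> k))) *\<^sub>C bas [] (w(k := \<rho> k a (w k))))"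
  | "iota_word n \<rho> \<zeta> u z a (\<alpha> # \<alpha>s) w =
      lmult \<alpha> (iota_word n \<rho> \<zeta> u z a \<alpha>s w)
      - diff_at (\<lambda>p. form a (val \<alpha> p)) z *\<^sub>C bas \<alpha>s w
      + iota_word n \<rho> \<zeta> u z (lie a (val \<alpha> z)) \<alpha>s w
      - diff_at u z *\<^sub>C bas (mlie (mfrac u z a) (mdiff \<alpha> (mconst (val \<alpha> z))) # \<alpha>s) w"

definition iota ::
  "nat \<Rightarrow> (nat \<Rightarrow> 'g::quadratic_lie_algebra \<Rightarrow> 'w \<Rightarrow> 'w) \<Rightarrow> (nat \<Rightarrow> proj) \<Rightarrow>
    (proj \<Rightarrow> complex) \<Rightarrow> proj \<Rightarrow> 'g \<Rightarrow> ('g, 'w) ivec \<Rightarrow> ('g, 'w) ivec"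
  where "iota n \<rho> \<zeta> u z a = lin_ext (iota_word n \<rho> \<zeta> u z a)"

definition iota_hat ::
  "nat \<Rightarrow> (nat \<Rightarrow> 'g::quadratic_lie_algebra \<Rightarrow> 'w \<Rightarrow> 'w) \<Rightarrow> (nat \<Rightarrow> proj) \<Rightarrow>
    (proj \<Rightarrow> complex) \<Rightarrow> proj \<Rightarrow> 'g \<Rightarrow> ('g, 'w) ivec \<Rightarrow> ('g, 'w) ivec"
  where "iota_hat n \<rho> \<zeta> u z a x = (1 / diff_at u z) *\<^sub>C iota n \<rho> \<zeta> u z a x"


section \<open>Limits\<close>

definition bipoly :: "complex poly poly \<Rightarrow> complex \<Rightarrow> complex \<Rightarrow> complex"
  where "bipoly N x t = poly (poly N [:x:]) t"

text \<open>A rational function of one auxiliary point \<open>p\<close> and of \<open>u(z)\<close> with values in the Lie algebra,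
  without pole along \<open>z = z1\<close>, and regular and vanishing at \<open>p = P\<close>. It is viewed as a family of
  meromorphic maps in \<open>p\<close>, depending on \<open>z\<close>.\<close>

definition regular_family ::
  "proj \<Rightarrow> (proj \<Rightarrow> complex) \<Rightarrow> proj \<Rightarrow> (proj \<Rightarrow> 'g::complex_vector mmap) \<Rightarrow> bool"
  where "regular_family P u z1 \<Lambda> \<longleftrightarrow>
    (\<exists>A N q. finite A \<and> (\<exists>x. bipoly q x (u z1) \<noteq> 0) \<and>
      (\<forall>z. \<Lambda> z = mext (\<lambda>p. \<Sum>a\<in>A. (bipoly (N a) (u p) (u z) / bipoly q (u p) (u z)) *\<^sub>C a))) \<and>
    (\<forall>\<^sub>F h in nhds 0. \<Lambda> (chart z1 h) \<in> vanishing_at P)"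

definition regular_coeff :: "(proj \<Rightarrow> complex) \<Rightarrow> proj \<Rightarrow> (proj \<Rightarrow> complex) \<Rightarrow> bool"
  where "regular_coeff u z1 r \<longleftrightarrow>
    (\<exists>a b. poly b (u z1) \<noteq> 0 \<and> (\<forall>z. r z = poly a (u z) / poly b (u z)))"

text \<open>A rational function of \<open>m\<close> auxiliary points and of \<open>u(z)\<close> that has an image in the module
  attached to the maps vanishing at \<open>P\<close> is a finite sum of products of functions of \<open>u(z)\<close> and one
  auxiliary point each; if it has no pole along \<open>z = z1\<close> the factors can be chosen without such a
  pole. The family \<open>c\<close> tends to \<open>y\<close> if it has such a representative, with value \<open>y\<close> at \<open>z1\<close>.\<close>

definition tends ::
  "nat \<Rightarrow> (nat \<Rightarrow> 'w::complex_vector set) \<Rightarrow> (nat \<Rightarrow> 'g::complex_lie_algebra \<Rightarrow> 'w \<Rightarrow> 'w) \<Rightarrow>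
    proj \<Rightarrow> (proj \<Rightarrow> complex) \<Rightarrow> proj \<Rightarrow> (proj \<Rightarrow> ('g, 'w) ivec) \<Rightarrow> ('g, 'w) ivec \<Rightarrow> bool"
  where "tends n W \<rho> P u z1 c y \<longleftrightarrow>
    (\<exists>(N::nat) r \<Lambda> w.
      (\<forall>i<N. regular_coeff u z1 (r i) \<and> (\<forall>\<psi>\<in>set (\<Lambda> i). regular_family P u z1 \<psi>) \<and>
        w i \<in> tuples n W) \<and>
      (let R = (\<lambda>z. \<Sum>i<N. r i z *\<^sub>C bas (map (\<lambda>\<psi>. \<psi> z) (\<Lambda> i)) (w i))
       in (\<forall>\<^sub>F h in at 0. equiv_mod n W \<rho> all_maps (c (chart z1 h)) (R (chart z1 h))) \<and>
          equiv_mod n W \<rho> all_maps y (R z1)))"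

end

theory Submission
  imports Defs
begin

text \<open>
  Adjoin a vacuum vector at \<open>z\<close> to the tensor product. The Laurent expansion at \<open>z\<close> of a meromorphic map
  \<open>f\<close> then acts on the module by an operator \<open>mode z f\<close>, determined by the principal part of \<open>f\<close> on
  the tensor product and by the commutators \<open>[mode z f, \<alpha>] = mode z [f, \<alpha>] - Res\<^sub>z (f, d\<alpha>)\<close>; it vanishes on
  words regular at \<open>z\<close> if \<open>f\<close> is regular there. These operators respect all relations of the module, by the
  Jacobi identity and the cocycle property of the residue, so no choice of \<open>P\<close> and no
  Poincare-Birkhoff-Witt theorem enters. The field is \<open>mode z (v / h)\<close> with \<open>h\<close> the local parameter at \<open>z\<close>.
  Given a coordinate \<open>u\<close>, replacing \<open>du\<^sub>z / (u - u(z))\<close> for \<open>1 / h\<close> changes it only by a regular map,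
  whence \<open>\<epsilon> + \<iota>\<close> on words regular at \<open>z\<close> and vanishing at \<open>P\<close>.

  For the product at two points, commuting \<open>\<iota>(z\<^sub>2)\<close> past the letter \<open>v\<^sub>1 / (u - u(z\<^sub>1))\<close> produces exactly the
  subtracted singular terms, a difference quotient of \<open>\<iota>\<close>, and terms without pole. The value of the limit
  at \<open>z\<^sub>1\<close> is the product \<open>mode z\<^sub>1 (v\<^sub>2 / (u - u(z\<^sub>1))) mode z\<^sub>1 (v\<^sub>1 / (u - u(z\<^sub>1)))\<close>. In another coordinate \<open>t\<close> one
  has \<open>du\<^sub>z / (u - u(z)) = dt\<^sub>z / (t - t(z)) + \<kappa>\<close> with \<open>\<kappa>\<close> constant, which changes this product and the
  subtracted terms by the same multiple of the field attached to \<open>[v\<^sub>2, v\<^sub>1]\<close>.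
\<close>

section \<open>Meromorphic functions on the projective line\<close>

text \<open>The recursion for \<iota> is not visibly compatible with the relations. The field is
  therefore built first, and \<iota> is read off as a mode minus left multiplication by
  \<open>a / (u - u(z))\<close>; the two recursions agree because
  \<open>(\<alpha> - \<alpha>(z)) / (u - u(z))\<close> is regular at \<open>z\<close>. The only
  arbitrary choice, a constant in a global principal part, is harmless: a constant map acts on the
  tensor product as the sum of its actions at the nodes.

  The Lie algebra carries no topology and may have infinite dimension, so meromorphic maps, their
  limits and the form (\<phi>, d\<psi>) are reduced to finitely many scalar coefficients, and
  identities are proved off a finite set.

  The obstacle in the limit is that it asks for representatives rational in \<open>u(z2)\<close>, on
  whole words. The derivative of \<open>a / (u - u(z))\<close> with respect to \<open>u(z)\<close>
  is \<open>a / (u - u(z))^2\<close>; the mode of that map supplies the derivative of \<iota>, and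
  difference quotients of \<iota> pass through words by second divided differences. The singular
  terms are written in \<open>u\<close>, the representatives possibly in another coordinate
  \<open>t\<close>; the conversion factor is a polynomial in \<open>t(z2)\<close> and creates no
  pole.\<close>

definition punctured :: "proj \<Rightarrow> proj filter"
  where "punctured z = filtermap (chart z) (at 0)"

lemma eventually_punctured: "eventually P (punctured z) \<longleftrightarrow> (\<forall>\<^sub>F h in at 0. P (chart z h))"
  by (simp add: punctured_def eventually_filtermap)

lemma tendsto_punctured: "(f \<longlongrightarrow> l) (punctured z) \<longleftrightarrow> ((\<lambda>h. f (chart z h)) \<longlongrightarrow> l) (at 0)"
  by (simp add: punctured_def filterlim_filtermap)

lemma punctured_neq_bot [simp]: "punctured z \<noteq> bot"
  by (simp add: punctured_def filtermap_bot_iff)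

lemma eventually_neq_punctured: "eventually (\<lambda>q. q \<noteq> p) (punctured z)"
proof -
  have *: "\<forall>\<^sub>F h in at (0::complex). h \<noteq> c" for c
    using eventually_neq_at_within by blast
  show ?thesis
  proof (cases z)
    case (Pt a)
    show ?thesis
    proof (cases p)
      case p: (Pt b)
      show ?thesis unfolding eventually_punctured
        by (rule eventually_mono[OF *[of "b - a"]]) (auto simp: Pt p)
    qed (auto simp: Pt eventually_punctured)
  next
    case Infty
    show ?thesis
    proof (cases p)
      case p: (Pt b)
      show ?thesis unfolding eventually_punctured
        by (rule eventually_mono[OF *[of "1 / b"]]) (auto simp: Infty p)
    next
      case p: Infty
      show ?thesis unfolding eventually_punctured
        by (rule eventually_mono[OF *[of 0]]) (auto simp: Infty p)
    qed
  qed
qed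

lemma punctured_le_cofinite: "punctured z \<le> cofinite"
proof (rule filter_leI)
  fix P :: "proj \<Rightarrow> bool" assume "eventually P cofinite"
  then have fin: "finite {p. \<not> P p}" by (simp add: eventually_cofinite)
  have "eventually (\<lambda>q. \<forall>p\<in>{p. \<not> P p}. q \<noteq> p) (punctured z)"
    using eventually_neq_punctured by (subst eventually_ball_finite_distrib[OF fin]) blast
  then show "eventually P (punctured z)"
    by (rule eventually_mono) blast
qed

lemma cofinite_imp_punctured: "eventually P cofinite \<Longrightarrow> eventually P (punctured z)"
  using punctured_le_cofinite by (rule filter_leD)

text \<open>Compactness of the sphere: the chart at \<open>Infty\<close> bounds the exceptional set,
  and an infinite bounded set would accumulate at some \<open>Pt c\<close>, against the hypothesis
  there.\<close>

lemma eventually_cofinite_proj: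
  assumes "\<And>z. eventually P (punctured z)"
  shows "eventually P cofinite"
proof -
  define A where "A = {x. \<not> P (Pt x)}"
  have "eventually P (punctured Infty)" by (rule assms)
  then obtain d where d: "d > 0" "\<And>h. h \<noteq> 0 \<Longrightarrow> norm h < d \<Longrightarrow> P (Pt (1 / h))"
    unfolding eventually_punctured eventually_at by (auto simp: dist_norm)
  have "norm x \<le> 1 / d" if "x \<in> A" for x
  proof (rule ccontr)
    assume *: "\<not> norm x \<le> 1 / d"
    then have "0 < norm x" using d(1) by (smt (verit) divide_pos_pos)
    then have "norm (1 / x) < d" using * d(1) by (simp add: norm_divide field_simps)
    with d(2)[of "1 / x"] \<open>0 < norm x\<close> that show False by (auto simp: A_def)
  qed
  then have bdd: "bounded A" by (auto simp: bounded_iff)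
  have "finite A"
  proof (rule ccontr)
    assume "infinite A"
    with bdd obtain c where "c islimpt A" using bounded_infinite_imp_islimpt by blast
    moreover have "\<forall>\<^sub>F y in at c. y \<notin> A"
      using assms[of "Pt c"] unfolding eventually_punctured at_to_0[of c] eventually_filtermap
      by (simp add: A_def add.commute)
    ultimately show False by (simp add: islimpt_iff_eventually)
  qed
  moreover have "{p. \<not> P p} \<subseteq> insert Infty (Pt ` A)"
    by (auto simp: A_def image_iff) (metis proj.exhaust)
  ultimately show ?thesis by (auto simp: eventually_cofinite intro: finite_subset)
qed

text \<open>\<open>mero_fun\<close> prescribes the values at poles and removable singularities,
  which pointwise operations do not respect. Dropping that prescription gives a class closed under
  them; \<open>nice\<close> restores it.\<close>

definition amero :: "(proj \<Rightarrow> complex) \<Rightarrow> bool"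
  where "amero f \<longleftrightarrow> (\<forall>z. (\<lambda>h. f (chart z h)) meromorphic_on {0})"

lemma amero_cong: "(\<forall>\<^sub>F p in cofinite. f p = g p) \<Longrightarrow> amero f \<longleftrightarrow> amero g"
  unfolding amero_def
  by (intro iff_allI meromorphic_on_cong) (auto dest: cofinite_imp_punctured simp: eventually_punctured)

lemma amero_const [simp]: "amero (\<lambda>_. c)"
  and amero_add: "amero f \<Longrightarrow> amero g \<Longrightarrow> amero (\<lambda>p. f p + g p)"
  and amero_diff: "amero f \<Longrightarrow> amero g \<Longrightarrow> amero (\<lambda>p. f p - g p)"
  and amero_mult: "amero f \<Longrightarrow> amero g \<Longrightarrow> amero (\<lambda>p. f p * g p)"
  and amero_divide: "amero f \<Longrightarrow> amero g \<Longrightarrow> amero (\<lambda>p. f p / g p)"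
  and amero_power: "amero f \<Longrightarrow> amero (\<lambda>p. f p ^ n)"
  by (auto simp: amero_def intro!: meromorphic_intros)

lemma amero_sum: "(\<And>i. i \<in> I \<Longrightarrow> amero (f i)) \<Longrightarrow> amero (\<lambda>p. \<Sum>i\<in>I. f i p)"
  by (auto simp: amero_def intro!: meromorphic_intros)

lemma amero_poly: "amero f \<Longrightarrow> amero (\<lambda>p. poly q (f p))"
  by (induction q) (auto intro!: amero_add amero_mult)

lemma is_pole_punctured: "has_pole f z \<longleftrightarrow> filterlim f at_infinity (punctured z)"
  by (simp add: has_pole_def is_pole_def punctured_def filterlim_filtermap)

lemma has_pole_cong: "(\<forall>\<^sub>F p in cofinite. f p = g p) \<Longrightarrow> has_pole f z \<longleftrightarrow> has_pole g z"
  unfolding is_pole_punctured by (intro filterlim_cong refl) (auto dest: cofinite_imp_punctured)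

lemma tendsto_punctured_cong:
  "(\<forall>\<^sub>F p in cofinite. f p = g p) \<Longrightarrow> (f \<longlongrightarrow> l) (punctured z) \<longleftrightarrow> (g \<longlongrightarrow> l) (punctured z)"
  by (intro filterlim_cong refl) (auto dest: cofinite_imp_punctured)

lemma not_pole_tendsto: "(f \<longlongrightarrow> l) (punctured z) \<Longrightarrow> \<not> has_pole f z"
  unfolding is_pole_punctured using not_tendsto_and_filterlim_at_infinity[OF punctured_neq_bot] by blast

lemma amero_cases:
  assumes "amero f" obtains "has_pole f z" | l where "(f \<longlongrightarrow> l) (punctured z)"
proof -
  have "not_essential (\<lambda>h. f (chart z h)) 0"
    using assms by (auto simp: amero_def meromorphic_at_iff)
  then show thesis using that unfolding not_essential_def has_pole_def tendsto_punctured by blast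
qed

definition nice :: "(proj \<Rightarrow> complex) \<Rightarrow> proj \<Rightarrow> complex"
  where "nice f z = remove_sings (\<lambda>h. f (chart z h)) 0"

lemma nice_eqI: "(f \<longlongrightarrow> l) (punctured z) \<Longrightarrow> nice f z = l"
  unfolding nice_def tendsto_punctured by (rule remove_sings_eqI)

lemma nice_pole: "has_pole f z \<Longrightarrow> nice f z = 0"
  unfolding nice_def has_pole_def by simp

lemma eventually_analytic_amero:
  assumes "amero f"
  shows "\<forall>\<^sub>F h in at 0. (\<lambda>h. f (chart z h)) analytic_on {h}"
proof -
  have "isolated_singularity_at (\<lambda>h. f (chart z h)) 0"
    using assms by (auto simp: amero_def meromorphic_at_iff)
  then show ?thesis using isolated_singularity_at_altdef by blast
qed

lemma amero_tendsto_ae: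
  assumes "amero f" shows "\<forall>\<^sub>F p in cofinite. (f \<longlongrightarrow> f p) (punctured p)"
proof (rule eventually_cofinite_proj)
  fix z
  have "(f \<longlongrightarrow> f (chart z h)) (punctured (chart z h))"
    if h: "(\<lambda>h. f (chart z h)) analytic_on {h}" "h \<noteq> 0" for h
  proof -
    have cont: "isCont (\<lambda>h. f (chart z h)) h" using h(1) by (rule analytic_at_imp_isCont)
    show ?thesis
    proof (cases z)
      case (Pt a)
      have "((\<lambda>k. f (chart z (h + k))) \<longlongrightarrow> f (chart z h)) (at 0)"
        using cont unfolding isCont_def by (rule LIM_offset_zero)
      then show ?thesis by (simp add: tendsto_punctured Pt add.assoc)
    next
      case Infty
      \<comment> \<open>In the chart at \<open>Pt (1 / h)\<close> the point with parameter
        \<open>k\<close> is \<open>Pt (1 / h + k)\<close>, whose parameter in the chart at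
        \<open>Infty\<close> is \<open>1 / (1 / h + k)\<close>.\<close>
      have 1: "((\<lambda>k. 1 / (1 / h + k)) \<longlongrightarrow> 1 / (1 / h + 0)) (at 0)"
        using h(2) by (intro tendsto_intros) auto
      have "((\<lambda>k. f (chart z (1 / (1 / h + k)))) \<longlongrightarrow> f (chart z h)) (at 0)"
        by (rule isCont_tendsto_compose[OF cont]) (use 1 in simp)
      moreover have "\<forall>\<^sub>F k in at 0. f (chart z (1 / (1 / h + k))) = f (chart (chart z h) k)"
      proof -
        have "\<forall>\<^sub>F k in at 0. 1 / (1 / h + k) \<in> - {0}"
          using 1 h(2) by (intro topological_tendstoD[of _ "1 / (1 / h + 0)"]) auto
        then show ?thesis by (rule eventually_mono) (use h(2) in \<open>simp add: Infty\<close>)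
      qed
      ultimately show ?thesis by (simp add: tendsto_punctured tendsto_cong)
    qed
  qed
  moreover have "\<forall>\<^sub>F h in at (0::complex). h \<noteq> 0" by (simp add: eventually_at_filter)
  ultimately show "\<forall>\<^sub>F p in punctured z. (f \<longlongrightarrow> f p) (punctured p)"
    unfolding eventually_punctured
    using eventually_analytic_amero[OF assms, of z] by (auto elim: eventually_elim2)
qed

lemma nice_ae: "amero f \<Longrightarrow> \<forall>\<^sub>F p in cofinite. nice f p = f p"
  by (rule eventually_mono[OF amero_tendsto_ae]) (auto intro: nice_eqI)

lemma not_has_pole_ae: "amero f \<Longrightarrow> \<forall>\<^sub>F p in cofinite. \<not> has_pole f p"
  by (rule eventually_mono[OF amero_tendsto_ae]) (auto dest: not_pole_tendsto)

lemma chart_0 [simp]: "chart z 0 = z"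
  by (cases z) auto

lemma mero_fun_altdef:
  "mero_fun f \<longleftrightarrow> amero f \<and> (\<forall>z. has_pole f z \<and> f z = 0 \<or> (f \<longlongrightarrow> f z) (punctured z))"
  by (auto simp: mero_fun_def amero_def nicely_meromorphic_on_def has_pole_def tendsto_punctured)

lemma mero_fun_amero: "mero_fun f \<Longrightarrow> amero f"
  by (simp add: mero_fun_altdef)

lemma mero_fun_tendsto: "mero_fun f \<Longrightarrow> \<not> has_pole f z \<Longrightarrow> (f \<longlongrightarrow> f z) (punctured z)"
  unfolding mero_fun_altdef by blast

lemma mero_fun_nice: assumes "amero f" shows "mero_fun (nice f)"
  unfolding mero_fun_altdef
proof (intro conjI allI)
  show "amero (nice f)" using amero_cong[OF nice_ae[OF assms]] assms by simp
  fix z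
  show "has_pole (nice f) z \<and> nice f z = 0 \<or> (nice f \<longlongrightarrow> nice f z) (punctured z)"
    using assms
  proof (cases rule: amero_cases[of f z])
    case 1
    then show ?thesis using has_pole_cong[OF nice_ae[OF assms]] by (simp add: nice_pole)
  next
    case (2 l)
    then show ?thesis using tendsto_punctured_cong[OF nice_ae[OF assms]] nice_eqI by metis
  qed
qed

text \<open>Without a pole at \<open>Infty\<close> the function stays near \<open>f Infty\<close>
  outside a disc, and continuity bounds it on the disc. The entire function \<open>f (Pt x)\<close>
  is then constant, and \<open>f Infty\<close> is its limit.\<close>

lemma Liouville_proj:
  assumes "mero_fun f" "\<And>z. \<not> has_pole f z"
  shows "f p = f q"
proof -
  have lim: "(f \<longlongrightarrow> f z) (punctured z)" for z using assms by (rule mero_fun_tendsto)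
  have "(\<lambda>x. f (Pt x)) analytic_on {c}" for c
  proof (rule meromorphic_at_isCont_imp_analytic)
    have "((\<lambda>h. f (chart (Pt c) h)) meromorphic_on {0})"
      using assms(1) unfolding mero_fun_def nicely_meromorphic_on_def by blast
    then show "(\<lambda>x. f (Pt x)) meromorphic_on {c}"
      by (simp add: meromorphic_on_def)
    show "isCont (\<lambda>x. f (Pt x)) c"
      using lim[of "Pt c"] unfolding isCont_def tendsto_punctured
      by (simp add: LIM_offset_zero_cancel)
  qed
  then have hol: "(\<lambda>x. f (Pt x)) holomorphic_on UNIV"
    using analytic_imp_holomorphic analytic_on_analytic_at by blast
  have "\<forall>\<^sub>F h in at 0. dist (f (chart Infty h)) (f Infty) < 1"
    using lim[of Infty] unfolding tendsto_punctured by (rule tendstoD) simp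
  then obtain d where d: "d > 0" "\<And>h. h \<noteq> 0 \<Longrightarrow> norm h < d \<Longrightarrow> dist (f (Pt (1 / h))) (f Infty) < 1"
    unfolding eventually_at by (auto simp: dist_norm)
  have "bounded ((\<lambda>x. f (Pt x)) ` cball 0 (1 / d))"
    using hol by (intro compact_imp_bounded compact_continuous_image holomorphic_on_imp_continuous_on)
      (auto intro: holomorphic_on_subset)
  moreover have "f (Pt x) \<in> ball (f Infty) 1" if "x \<notin> cball 0 (1 / d)" for x
  proof -
    have "1 / d < norm x" using that by simp
    then have "norm x > 0" using d(1) by (smt (verit) divide_pos_pos)
    with \<open>1 / d < norm x\<close> have "norm (1 / x) < d" using d(1) by (simp add: norm_divide field_simps)
    with d(2)[of "1 / x"] \<open>norm x > 0\<close> show ?thesis by (auto simp: dist_commute)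
  qed
  then have "range (\<lambda>x. f (Pt x)) \<subseteq> (\<lambda>x. f (Pt x)) ` cball 0 (1 / d) \<union> ball (f Infty) 1" by blast
  ultimately have "bounded (range (\<lambda>x. f (Pt x)))"
    by (meson bounded_Un bounded_ball bounded_subset)
  then obtain c where c: "f (Pt x) = c" for x
    using Liouville_theorem[OF hol] by (auto simp: constant_on_def)
  have "\<forall>\<^sub>F p in punctured Infty. f p = c"
    unfolding eventually_punctured eventually_at_filter by (simp add: c)
  then have "(f \<longlongrightarrow> c) (punctured Infty)" by (simp add: tendsto_eventually)
  with lim have "f Infty = c" using tendsto_unique[OF punctured_neq_bot] by blast
  with c have "f r = c" for r by (cases r) auto
  then show ?thesis by simp
qed

section \<open>Vector-valued meromorphic functions\<close>

definition clin :: "('v::complex_vector \<Rightarrow> 'u::complex_vector) \<Rightarrow> bool"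
  where "clin T \<longleftrightarrow> (\<forall>c x y. T (c *\<^sub>C x + y) = c *\<^sub>C T x + T y)"

lemma clin_add: "clin T \<Longrightarrow> T (x + y) = T x + T y"
  unfolding clin_def by (metis scaleC_one)

lemma clin_zero: "clin T \<Longrightarrow> T 0 = 0"
  using clin_add[of T 0 0] by simp

lemma clin_scale: "clin T \<Longrightarrow> T (c *\<^sub>C x) = c *\<^sub>C T x"
  unfolding clin_def by (metis add.right_neutral clin_def clin_zero)

lemma clin_sum: "clin T \<Longrightarrow> T (\<Sum>i\<in>I. f i) = (\<Sum>i\<in>I. T (f i))"
  by (induction I rule: infinite_finite_induct) (auto simp: clin_zero clin_add)

lemma clin_uminus: "clin T \<Longrightarrow> T (- x) = - T x"
  by (metis add_eq_0_iff clin_add clin_zero)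

lemma clin_diff: "clin T \<Longrightarrow> T (x - y) = T x - T y"
  using clin_add[of T x "- y"] by (simp add: clin_uminus)

lemma clin_imp_linear: "clin T \<longleftrightarrow> Vector_Spaces.linear scaleC scaleC T"
proof
  assume "clin T"
  then show "Vector_Spaces.linear scaleC scaleC T"
    by unfold_locales (simp_all add: clin_add clin_scale)
next
  assume "Vector_Spaces.linear scaleC scaleC T"
  then interpret Vector_Spaces.linear scaleC scaleC T .
  show "clin T" by (simp add: clin_def add scale)
qed

global_interpretation complex_pair: vector_space_pair
  "scaleC :: complex \<Rightarrow> 'a \<Rightarrow> 'a::complex_vector" "scaleC :: complex \<Rightarrow> 'b \<Rightarrow> 'b::complex_vector"
  by unfold_locales

lemma functional_extend:
  fixes A :: "'v::complex_vector set"
  assumes "\<not> cdependent A"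
  obtains T :: "'v \<Rightarrow> complex" where "clin T" "\<And>a. a \<in> A \<Longrightarrow> T a = f a"
proof -
  have "\<not> complex_vector.dependent A" using assms by (simp add: cdependent_def)
  then obtain T :: "'v \<Rightarrow> complex" where "Vector_Spaces.linear scaleC scaleC T" "\<forall>a\<in>A. T a = f a"
    using complex_pair.linear_independent_extend by blast
  then show thesis using that by (auto simp: clin_imp_linear)
qed

text \<open>Functionals stand in for a topology: uniqueness of vector-valued limits is tested on
  them.\<close>

lemma functional_separates:
  fixes v w :: "'v::complex_vector"
  assumes "\<And>T :: 'v \<Rightarrow> complex. clin T \<Longrightarrow> T v = T w"
  shows "v = w"
proof (rule ccontr)
  assume "v \<noteq> w"
  then have "\<not> cdependent {v - w}"
    by (simp add: complex_vector.dependent_single)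
  then obtain T :: "'v \<Rightarrow> complex" where T: "clin T" "\<And>a. a \<in> {v - w} \<Longrightarrow> T a = 1"
    using functional_extend[of "{v - w}" "\<lambda>_. 1"] by metis
  have "T (v - w) = T v - T w" using T(1) by (rule clin_diff)
  with T assms[OF T(1)] show False by simp
qed

text \<open>The target may be infinite-dimensional, so a map is a finite combination of fixed
  vectors with meromorphic coefficients. The vectors may be dependent, which makes sums and brackets
  immediate; the last rule forgets finitely many values.\<close>

inductive vmero :: "(proj \<Rightarrow> 'v::complex_vector) \<Rightarrow> bool"
  where
    vmero_zero: "vmero (\<lambda>_. 0)"
  | vmero_term: "amero f \<Longrightarrow> vmero \<phi> \<Longrightarrow> vmero (\<lambda>p. f p *\<^sub>C a + \<phi> p)"
  | vmero_cong: "vmero \<phi> \<Longrightarrow> \<forall>\<^sub>F p in cofinite. \<phi> p = \<psi> p \<Longrightarrow> vmero \<psi>"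

text \<open>Convergence at \<open>z\<close> without a topology on the target: some finite expansion
  has convergent coefficients throughout.\<close>

inductive vlim :: "proj \<Rightarrow> (proj \<Rightarrow> 'v::complex_vector) \<Rightarrow> 'v \<Rightarrow> bool" for z
  where
    vlim_zero: "vlim z (\<lambda>_. 0) 0"
  | vlim_term: "amero f \<Longrightarrow> (f \<longlongrightarrow> l) (punctured z) \<Longrightarrow> vlim z \<phi> v \<Longrightarrow>
      vlim z (\<lambda>p. f p *\<^sub>C a + \<phi> p) (l *\<^sub>C a + v)"
  | vlim_cong: "vlim z \<phi> v \<Longrightarrow> \<forall>\<^sub>F p in cofinite. \<phi> p = \<psi> p \<Longrightarrow> vlim z \<psi> v"

lemma vlim_cong_iff: "\<forall>\<^sub>F p in cofinite. \<phi> p = \<psi> p \<Longrightarrow> vlim z \<phi> v \<longleftrightarrow> vlim z \<psi> v"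
  using vlim_cong[of z \<phi> v \<psi>] vlim_cong[of z \<psi> v \<phi>] by (auto simp: eq_commute)

lemma vlim_vmero: "vlim z \<phi> v \<Longrightarrow> vmero \<phi>"
  by (induction rule: vlim.induct) (auto intro: vmero.intros)

lemma scaleC_complex [simp]: "c *\<^sub>C x = c * (x::complex)"
  by (simp add: scaleC_complex_def)

lemma vmero_scale_const: "amero f \<Longrightarrow> vmero (\<lambda>p. f p *\<^sub>C a)"
  using vmero_term[of f "\<lambda>_. 0" a] vmero_zero by simp

lemma vlim_scale_const: "amero f \<Longrightarrow> (f \<longlongrightarrow> l) (punctured z) \<Longrightarrow> vlim z (\<lambda>p. f p *\<^sub>C a) (l *\<^sub>C a)"
  using vlim_term[OF _ _ vlim_zero, of f l z a] by simp

lemma vmero_const: "vmero (\<lambda>_. c)"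
  using vmero_scale_const[of "\<lambda>_. 1" c] by simp

lemma vlim_const: "vlim z (\<lambda>_. c) c"
  using vlim_scale_const[of "\<lambda>_. 1" 1 z c] by simp

lemma vmero_add: "vmero \<phi> \<Longrightarrow> vmero \<psi> \<Longrightarrow> vmero (\<lambda>p. \<phi> p + \<psi> p)"
proof (induction rule: vmero.induct)
  case (vmero_term f \<phi> a)
  then show ?case by (simp add: add.assoc vmero.vmero_term)
next
  case (vmero_cong \<phi> \<phi>')
  then have "vmero (\<lambda>p. \<phi> p + \<psi> p)" by simp
  then show ?case
    by (rule vmero.vmero_cong) (use vmero_cong.hyps in \<open>auto elim: eventually_mono\<close>)
qed auto

lemma vlim_add: "vlim z \<phi> v \<Longrightarrow> vlim z \<psi> w \<Longrightarrow> vlim z (\<lambda>p. \<phi> p + \<psi> p) (v + w)"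
proof (induction rule: vlim.induct)
  case (vlim_term f l \<phi> v a)
  then show ?case by (simp add: add.assoc vlim.vlim_term)
next
  case (vlim_cong \<phi> v \<phi>')
  then have "vlim z (\<lambda>p. \<phi> p + \<psi> p) (v + w)" by simp
  then show ?case
    by (rule vlim.vlim_cong) (use vlim_cong.hyps in \<open>auto elim: eventually_mono\<close>)
qed auto

lemma vmero_clin:
  assumes "clin T" "vmero \<phi>" shows "vmero (\<lambda>p. T (\<phi> p))"
  using assms(2,1)
proof (induction rule: vmero.induct)
  case (vmero_term f \<phi> a)
  then show ?case by (simp add: clin_add clin_scale vmero.vmero_term)
next
  case (vmero_cong \<phi> \<phi>')
  then have "vmero (\<lambda>p. T (\<phi> p))" by simp
  then show ?case
    by (rule vmero.vmero_cong) (use vmero_cong.hyps in \<open>auto elim: eventually_mono\<close>)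
qed (auto simp: clin_zero intro: vmero_zero)

lemma vlim_clin:
  assumes "clin T" "vlim z \<phi> v" shows "vlim z (\<lambda>p. T (\<phi> p)) (T v)"
  using assms(2,1)
proof (induction rule: vlim.induct)
  case (vlim_term f l \<phi> v a)
  then show ?case by (simp add: clin_add clin_scale vlim.vlim_term)
next
  case (vlim_cong \<phi> v \<phi>')
  then have "vlim z (\<lambda>p. T (\<phi> p)) (T v)" by simp
  then show ?case
    by (rule vlim.vlim_cong) (use vlim_cong.hyps in \<open>auto elim: eventually_mono\<close>)
qed (auto simp: clin_zero intro: vlim_zero)

lemma vmero_scale:
  assumes "vmero \<phi>" "amero g" shows "vmero (\<lambda>p. g p *\<^sub>C \<phi> p)"
  using assms(1)
proof (induction rule: vmero.induct)
  case (vmero_term f \<phi> a)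
  then show ?case
    using assms(2) by (simp add: scaleC_add_right scaleC_scaleC amero_mult vmero.vmero_term)
next
  case (vmero_cong \<phi> \<phi>')
  show ?case
    by (rule vmero.vmero_cong[OF vmero_cong.IH]) (use vmero_cong.hyps in \<open>auto elim: eventually_mono\<close>)
qed (auto intro: vmero_zero)

lemma vlim_scale:
  assumes "vlim z \<phi> v" "amero g" "(g \<longlongrightarrow> c) (punctured z)"
  shows "vlim z (\<lambda>p. g p *\<^sub>C \<phi> p) (c *\<^sub>C v)"
  using assms(1)
proof (induction rule: vlim.induct)
  case (vlim_term f l \<phi> v a)
  then show ?case
    using assms(2,3)
    by (simp add: scaleC_add_right scaleC_scaleC amero_mult tendsto_mult vlim.vlim_term)
next
  case (vlim_cong \<phi> v \<phi>')
  show ?case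
    by (rule vlim.vlim_cong[OF vlim_cong.IH]) (use vlim_cong.hyps in \<open>auto elim: eventually_mono\<close>)
qed (auto intro: vlim_zero)

lemma vmero_bilinear:
  assumes "vmero \<phi>" "vmero \<psi>" "\<And>a. clin (B a)" "\<And>b. clin (\<lambda>a. B a b)"
  shows "vmero (\<lambda>p. B (\<phi> p) (\<psi> p))"
  using assms(1)
proof (induction rule: vmero.induct)
  case vmero_zero
  then show ?case using clin_zero[OF assms(4)] vmero.vmero_zero by simp
next
  case (vmero_term f \<phi> a)
  have "vmero (\<lambda>p. f p *\<^sub>C B a (\<psi> p) + B (\<phi> p) (\<psi> p))"
    using vmero_scale[OF vmero_clin[OF assms(3) assms(2)] vmero_term(1)] vmero_term(3)
    by (rule vmero_add)
  then show ?case by (simp add: clin_add[OF assms(4)] clin_scale[OF assms(4)])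
next
  case (vmero_cong \<phi> \<phi>')
  show ?case
    by (rule vmero.vmero_cong[OF vmero_cong.IH]) (use vmero_cong.hyps in \<open>auto elim: eventually_mono\<close>)
qed

lemma vlim_bilinear:
  assumes "vlim z \<phi> v" "vlim z \<psi> w" "\<And>a. clin (B a)" "\<And>b. clin (\<lambda>a. B a b)"
  shows "vlim z (\<lambda>p. B (\<phi> p) (\<psi> p)) (B v w)"
  using assms(1)
proof (induction rule: vlim.induct)
  case vlim_zero
  then show ?case using clin_zero[OF assms(4)] vlim.vlim_zero by simp
next
  case (vlim_term f l \<phi> v a)
  have "vlim z (\<lambda>p. f p *\<^sub>C B a (\<psi> p) + B (\<phi> p) (\<psi> p)) (l *\<^sub>C B a w + B v w)"
    using vlim_scale[OF vlim_clin[OF assms(3) assms(2)] vlim_term(1,2)] vlim_term(4)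
    by (rule vlim_add)
  then show ?case by (simp add: clin_add[OF assms(4)] clin_scale[OF assms(4)])
next
  case (vlim_cong \<phi> v \<phi>')
  show ?case
    by (rule vlim.vlim_cong[OF vlim_cong.IH]) (use vlim_cong.hyps in \<open>auto elim: eventually_mono\<close>)
qed

lemma vmero_sum: "(\<And>i. i \<in> I \<Longrightarrow> vmero (\<phi> i)) \<Longrightarrow> vmero (\<lambda>p. \<Sum>i\<in>I. \<phi> i p)"
  by (induction I rule: infinite_finite_induct) (auto intro: vmero_zero vmero_add)

lemma vlim_sum: "(\<And>i. i \<in> I \<Longrightarrow> vlim z (\<phi> i) (v i)) \<Longrightarrow> vlim z (\<lambda>p. \<Sum>i\<in>I. \<phi> i p) (\<Sum>i\<in>I. v i)"
  by (induction I rule: infinite_finite_induct) (auto intro: vlim_zero vlim_add)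

lemma clin_uminus_map: "clin (\<lambda>x::'v::complex_vector. - x)"
  by (simp add: clin_def complex_vector.scale_minus_right)

lemma vmero_diff: "vmero \<phi> \<Longrightarrow> vmero \<psi> \<Longrightarrow> vmero (\<lambda>p. \<phi> p - \<psi> p)"
  using vmero_add[of \<phi> "\<lambda>p. - \<psi> p"] vmero_clin[OF clin_uminus_map, of \<psi>] by simp

lemma vlim_diff: "vlim z \<phi> v \<Longrightarrow> vlim z \<psi> w \<Longrightarrow> vlim z (\<lambda>p. \<phi> p - \<psi> p) (v - w)"
  using vlim_add[of z \<phi> v "\<lambda>p. - \<psi> p" "- w"] vlim_clin[OF clin_uminus_map, of z \<psi> w] by simp

lemma vlim_functional:
  fixes T :: "'v::complex_vector \<Rightarrow> complex"
  assumes "vlim z \<phi> v" "clin T" shows "((\<lambda>p. T (\<phi> p)) \<longlongrightarrow> T v) (punctured z)"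
  using assms(1)
proof (induction rule: vlim.induct)
  case (vlim_term f l \<phi> v a)
  then show ?case
    by (simp add: clin_add[OF assms(2)] clin_scale[OF assms(2)] tendsto_intros)
next
  case (vlim_cong \<phi> v \<psi>)
  have "\<forall>\<^sub>F p in cofinite. T (\<phi> p) = T (\<psi> p)"
    using vlim_cong.hyps(2) by (auto elim: eventually_mono)
  from tendsto_punctured_cong[OF this] vlim_cong.IH show ?case by simp
qed (simp add: clin_zero assms(2))

lemma vmero_functional:
  fixes T :: "'v::complex_vector \<Rightarrow> complex"
  assumes "vmero \<phi>" "clin T" shows "amero (\<lambda>p. T (\<phi> p))"
  using assms(1)
proof (induction rule: vmero.induct)
  case (vmero_term f \<phi> a)
  then show ?case
    by (simp add: clin_add[OF assms(2)] clin_scale[OF assms(2)] amero_add amero_mult)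
next
  case (vmero_cong \<phi> \<psi>)
  have "\<forall>\<^sub>F p in cofinite. T (\<phi> p) = T (\<psi> p)"
    using vmero_cong.hyps(2) by (auto elim: eventually_mono)
  from amero_cong[OF this] vmero_cong.IH show ?case by simp
qed (simp add: clin_zero assms(2))

lemma vlim_unique: "vlim z \<phi> v \<Longrightarrow> vlim z \<phi> w \<Longrightarrow> v = w"
  by (rule functional_separates, rule tendsto_unique[OF punctured_neq_bot]) (erule (1) vlim_functional)+

lemma amero_if: "amero (\<lambda>p. if b then f p else g p) \<longleftrightarrow> (if b then amero f else amero g)"
  by simp

text \<open>Independence is gained one vector at a time: a new vector in the span of the old ones is
  redistributed over them, otherwise it joins them.\<close>

lemma vmero_normal_form:
  assumes "vmero \<phi>"
  obtains A f where "finite A" "\<not> cdependent A" "\<And>a. amero (f a)"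
    "\<forall>\<^sub>F p in cofinite. \<phi> p = (\<Sum>a\<in>A. f a p *\<^sub>C a)"
proof -
  have "\<exists>A f. finite A \<and> \<not> cdependent A \<and> (\<forall>a. amero (f a)) \<and>
    (\<forall>\<^sub>F p in cofinite. \<phi> p = (\<Sum>a\<in>A. f a p *\<^sub>C a))"
    using assms
  proof (induction rule: vmero.induct)
    case vmero_zero
    show ?case
      by (rule exI[of _ "{}"], rule exI[of _ "\<lambda>_ _. 0"])
        (simp add: complex_vector.independent_empty)
  next
    case (vmero_term g \<phi> b)
    then obtain A f where A: "finite A" "\<not> cdependent A" "\<forall>a. amero (f a)"
      "\<forall>\<^sub>F p in cofinite. \<phi> p = (\<Sum>a\<in>A. f a p *\<^sub>C a)" by blast
    show ?case
    proof (cases "b \<in> cspan A")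
      case True
      then obtain c where c: "b = (\<Sum>a\<in>A. c a *\<^sub>C a)"
        using complex_vector.span_finite[OF A(1)] by auto
      have "\<forall>\<^sub>F p in cofinite. g p *\<^sub>C b + \<phi> p = (\<Sum>a\<in>A. (g p * c a + f a p) *\<^sub>C a)"
        using A(4) by (rule eventually_mono)
          (simp add: c complex_vector.scale_sum_right scaleC_add_left scaleC_scaleC sum.distrib)
      then show ?thesis
        using A vmero_term(1)
        by (intro exI[of _ A] exI[of _ "\<lambda>a p. g p * c a + f a p"]) (auto intro!: amero_add amero_mult)
    next
      case False
      then have b: "b \<notin> A" by (auto simp: complex_vector.span_base)
      have "\<not> cdependent (insert b A)"
        using False A(2) by (rule complex_vector.independent_insertI)
      moreover have "\<forall>\<^sub>F p in cofinite. g p *\<^sub>C b + \<phi> p = (\<Sum>a\<in>insert b A. (if a = b then g p else f a p) *\<^sub>C a)"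
        using A(4)
      proof (rule eventually_mono)
        fix p assume p: "\<phi> p = (\<Sum>a\<in>A. f a p *\<^sub>C a)"
        have "(\<Sum>a\<in>A. f a p *\<^sub>C a) = (\<Sum>a\<in>A. (if a = b then g p else f a p) *\<^sub>C a)"
          using b by (intro sum.cong) auto
        with p A(1) b show "g p *\<^sub>C b + \<phi> p = (\<Sum>a\<in>insert b A. (if a = b then g p else f a p) *\<^sub>C a)"
          by simp
      qed
      ultimately show ?thesis
        using A vmero_term(1)
        by (intro exI[of _ "insert b A"] exI[of _ "\<lambda>a p. if a = b then g p else f a p"])
          (simp add: amero_if)
    qed
  next
    case (vmero_cong \<phi> \<psi>)
    then obtain A f where A: "finite A" "\<not> cdependent A" "\<forall>a. amero (f a)"
      "\<forall>\<^sub>F p in cofinite. \<phi> p = (\<Sum>a\<in>A. f a p *\<^sub>C a)" by blast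
    have "\<forall>\<^sub>F p in cofinite. \<psi> p = (\<Sum>a\<in>A. f a p *\<^sub>C a)"
      using A(4) vmero_cong.hyps(2) by eventually_elim simp
    with A show ?case by blast
  qed
  then show thesis using that by blast
qed

section \<open>Meromorphic maps and their values off finite sets\<close>

lemma mero_map_cases:
  assumes "mero_map \<nu>"
  obtains A f where "finite A" "\<not> cdependent A" "\<And>a. a \<in> A \<Longrightarrow> mero_fun (f a)"
    "\<nu> = (\<lambda>p. if \<exists>a\<in>A. has_pole (f a) p then None else Some (\<Sum>a\<in>A. f a p *\<^sub>C a))"
    "\<forall>\<^sub>F p in cofinite. \<nu> p = Some (\<Sum>a\<in>A. f a p *\<^sub>C a)"
    "\<forall>\<^sub>F p in cofinite. (\<Sum>a\<in>A. f a p *\<^sub>C a) = val \<nu> p"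
proof -
  obtain A f where A: "finite A" "\<not> cdependent A" "\<And>a. a \<in> A \<Longrightarrow> mero_fun (f a)"
    and \<nu>: "\<nu> = (\<lambda>p. if \<exists>a\<in>A. has_pole (f a) p then None else Some (\<Sum>a\<in>A. f a p *\<^sub>C a))"
    using assms unfolding mero_map_def by blast
  have "\<forall>\<^sub>F p in cofinite. \<not> has_pole (f a) p" if "a \<in> A" for a
    using A(3)[OF that] by (intro not_has_pole_ae mero_fun_amero)
  then have ev: "\<forall>\<^sub>F p in cofinite. \<forall>a\<in>A. \<not> has_pole (f a) p"
    using A(1) by (subst eventually_ball_finite_distrib) auto
  show thesis
    by (rule that[OF A \<nu>]) (use ev in \<open>auto elim: eventually_mono simp: \<nu>\<close>)
qed

lemma vmero_val [intro]:
  assumes "mero_map \<nu>" shows "vmero (val \<nu>)"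
  using assms
proof (rule mero_map_cases)
  fix A f
  assume A: "\<And>a. a \<in> A \<Longrightarrow> mero_fun (f a)"
    and ae: "\<forall>\<^sub>F p in cofinite. (\<Sum>a\<in>A. f a p *\<^sub>C a) = val \<nu> p"
  have "vmero (\<lambda>p. \<Sum>a\<in>A. f a p *\<^sub>C a)"
    by (intro vmero_sum vmero_scale_const mero_fun_amero A)
  then show ?thesis using ae by (rule vmero_cong)
qed

text \<open>Poles of different components cannot cancel, since the components belong to independent
  vectors. Definedness and value at \<open>z\<close> are thereby expressed through the values off a
  finite set, which is all that \<open>mext\<close> gives access to.\<close>

lemma mero_map_vlim:
  assumes "mero_map \<nu>" shows "\<nu> z = Some v \<longleftrightarrow> vlim z (val \<nu>) v"
proof -
  obtain A f where A: "finite A" "\<not> cdependent A" "\<And>a. a \<in> A \<Longrightarrow> mero_fun (f a)"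
    and \<nu>: "\<nu> = (\<lambda>p. if \<exists>a\<in>A. has_pole (f a) p then None else Some (\<Sum>a\<in>A. f a p *\<^sub>C a))"
    and ae: "\<forall>\<^sub>F p in cofinite. (\<Sum>a\<in>A. f a p *\<^sub>C a) = val \<nu> p"
    using assms by (rule mero_map_cases) blast
  have 1: "vlim z (val \<nu>) v" if "\<nu> z = Some v" for v
  proof -
    have np: "\<not> has_pole (f a) z" if "a \<in> A" for a
      using \<open>\<nu> z = Some v\<close> that by (auto simp: \<nu> split: if_splits)
    have v: "v = (\<Sum>a\<in>A. f a z *\<^sub>C a)" using that by (simp add: \<nu> split: if_splits)
    show ?thesis unfolding v
      by (rule vlim_cong[OF _ ae], rule vlim_sum, rule vlim_scale_const)
        (simp_all add: A(3) mero_fun_amero mero_fun_tendsto np)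
  qed
  have "\<nu> z = Some v" if v: "vlim z (val \<nu>) v"
  proof -
    have "\<not> has_pole (f a) z" if a: "a \<in> A" for a
    proof -
      \<comment> \<open>This functional reads off the coefficient of \<open>a\<close>, which
        therefore converges with the whole map.\<close>
      obtain T :: "'a \<Rightarrow> complex" where T: "clin T" "\<And>b. b \<in> A \<Longrightarrow> T b = (if b = a then 1 else 0)"
        using functional_extend[OF A(2), of "\<lambda>b. if b = a then 1 else 0"] by metis
      have "T (\<Sum>b\<in>A. f b p *\<^sub>C b) = (\<Sum>b\<in>A. if b = a then f b p else 0)" for p
        unfolding clin_sum[OF T(1)] by (intro sum.cong) (auto simp: clin_scale[OF T(1)] T(2))
      then have *: "T (\<Sum>b\<in>A. f b p *\<^sub>C b) = f a p" for p
        using a A(1) by simp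
      have "\<forall>\<^sub>F p in cofinite. f a p = T (val \<nu> p)"
        using ae by (rule eventually_mono) (metis *)
      moreover have "((\<lambda>p. T (val \<nu> p)) \<longlongrightarrow> T v) (punctured z)"
        using v T(1) by (rule vlim_functional)
      ultimately show ?thesis by (metis not_pole_tendsto tendsto_punctured_cong)
    qed
    then have "\<nu> z = Some (\<Sum>a\<in>A. f a z *\<^sub>C a)" by (auto simp: \<nu>)
    with 1[OF this] v vlim_unique show ?thesis by metis
  qed
  with 1 show ?thesis by blast
qed

lemma mero_map_eqI:
  assumes "mero_map \<mu>" "mero_map \<nu>" "\<forall>\<^sub>F p in cofinite. val \<mu> p = val \<nu> p"
  shows "\<mu> = \<nu>"
proof
  fix z
  have "\<mu> z = Some v \<longleftrightarrow> \<nu> z = Some v" for v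
    unfolding mero_map_vlim[OF assms(1)] mero_map_vlim[OF assms(2)]
    using assms(3) by (rule vlim_cong_iff)
  then show "\<mu> z = \<nu> z" by (metis not_None_eq)
qed

text \<open>The definite description in \<open>mext\<close> is met: existence comes from the normal
  form, uniqueness from \<open>mero_map_eqI\<close>.\<close>

lemma mext_works:
  assumes "vmero \<phi>"
  shows "mero_map (mext \<phi>) \<and> finite {p. mext \<phi> p \<noteq> Some (\<phi> p)}"
proof -
  obtain A f where A: "finite A" "\<not> cdependent A" "\<And>a. amero (f a)"
    and ae: "\<forall>\<^sub>F p in cofinite. \<phi> p = (\<Sum>a\<in>A. f a p *\<^sub>C a)"
    using assms by (rule vmero_normal_form) blast
  define \<nu> where "\<nu> = (\<lambda>p. if \<exists>a\<in>A. has_pole (nice (f a)) p then None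
    else Some (\<Sum>a\<in>A. nice (f a) p *\<^sub>C a))"
  have \<nu>: "mero_map \<nu>"
    unfolding mero_map_def \<nu>_def
    by (rule exI[of _ A], rule exI[of _ "\<lambda>a. nice (f a)"]) (auto simp: A mero_fun_nice)
  have "\<forall>\<^sub>F p in cofinite. \<forall>a\<in>A. nice (f a) p = f a p \<and> \<not> has_pole (nice (f a)) p"
    using A(1,3) nice_ae not_has_pole_ae mero_fun_amero mero_fun_nice
    by (subst eventually_ball_finite_distrib) (auto simp: eventually_conj_iff)
  then have "\<forall>\<^sub>F p in cofinite. \<nu> p = Some (\<phi> p)"
    using ae by eventually_elim (simp add: \<nu>_def)
  then have fin: "finite {p. \<nu> p \<noteq> Some (\<phi> p)}" by (simp add: eventually_cofinite)
  have "mext \<phi> = \<nu>"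
    unfolding mext_def
  proof (rule the_equality)
    fix \<mu> assume \<mu>: "mero_map \<mu> \<and> finite {p. \<mu> p \<noteq> Some (\<phi> p)}"
    then have "\<forall>\<^sub>F p in cofinite. \<mu> p = Some (\<phi> p)" by (simp add: eventually_cofinite)
    with \<open>\<forall>\<^sub>F p in cofinite. \<nu> p = Some (\<phi> p)\<close>
    have "\<forall>\<^sub>F p in cofinite. val \<mu> p = val \<nu> p" by eventually_elim simp
    with \<mu> \<nu> show "\<mu> = \<nu>" by (intro mero_map_eqI) auto
  qed (use \<nu> fin in auto)
  with \<nu> fin show ?thesis by simp
qed

lemma mero_map_mext [intro]: "vmero \<phi> \<Longrightarrow> mero_map (mext \<phi>)"
  using mext_works by blast

lemma mext_ae: "vmero \<phi> \<Longrightarrow> \<forall>\<^sub>F p in cofinite. val (mext \<phi>) p = \<phi> p"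
  using mext_works[of \<phi>] unfolding eventually_cofinite[symmetric] not_not
  by (auto elim: eventually_mono)

lemma mext_vlim:
  assumes "vmero \<phi>" shows "mext \<phi> z = Some v \<longleftrightarrow> vlim z \<phi> v"
  unfolding mero_map_vlim[OF mero_map_mext[OF assms]] by (rule vlim_cong_iff[OF mext_ae[OF assms]])

lemma mext_eqI:
  assumes "vmero \<phi>" "mero_map \<nu>" "\<forall>\<^sub>F p in cofinite. \<phi> p = val \<nu> p"
  shows "mext \<phi> = \<nu>"
  by (rule mero_map_eqI) (use assms mext_ae[OF assms(1)] in \<open>auto elim: eventually_elim2\<close>)

lemma mext_cong:
  assumes "vmero \<phi>" "\<forall>\<^sub>F p in cofinite. \<phi> p = \<psi> p" shows "mext \<phi> = mext \<psi>"
proof (rule mext_eqI)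
  show \<psi>: "mero_map (mext \<psi>)" using assms by (intro mero_map_mext) (rule vmero_cong)
  show "\<forall>\<^sub>F p in cofinite. \<phi> p = val (mext \<psi>) p"
    using assms(2) mext_ae[OF vmero_cong[OF assms]] by eventually_elim simp
qed fact

lemma mero_map_mconst [intro, simp]: "mero_map (mconst c)"
proof -
  have "mext (\<lambda>_. c) z = Some c" for z using mext_vlim[OF vmero_const] vlim_const by blast
  then have "mconst c = mext (\<lambda>_. c)" by (auto simp: mconst_def)
  then show ?thesis using mero_map_mext[OF vmero_const] by simp
qed

text \<open>Liouville in each component. It makes principal parts unique up to a constant
  map.\<close>

lemma regular_imp_mconst:
  assumes "mero_map \<nu>" "\<And>z. \<nu> z \<noteq> None" shows "\<exists>c. \<nu> = mconst c"
proof -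
  obtain A f where A: "finite A" "\<And>a. a \<in> A \<Longrightarrow> mero_fun (f a)"
    and \<nu>: "\<nu> = (\<lambda>p. if \<exists>a\<in>A. has_pole (f a) p then None else Some (\<Sum>a\<in>A. f a p *\<^sub>C a))"
    using assms(1) by (rule mero_map_cases) blast
  have np: "\<not> has_pole (f a) z" if "a \<in> A" for a z
    using assms(2)[of z] that by (auto simp: \<nu> split: if_splits)
  then have const: "f a p = f a Infty" if "a \<in> A" for a p
    using that A(2) by (intro Liouville_proj)
  have "(\<Sum>a\<in>A. f a p *\<^sub>C a) = (\<Sum>a\<in>A. f a Infty *\<^sub>C a)" for p
    by (intro sum.cong refl) (simp add: const[of _ p])
  then have "\<nu> = mconst (\<Sum>a\<in>A. f a Infty *\<^sub>C a)"
    using np by (auto simp: \<nu> mconst_def fun_eq_iff)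
  then show ?thesis by blast
qed

section \<open>Residues\<close>

lemma meromorphic_at_0: "f meromorphic_on {0} \<longleftrightarrow> (\<exists>F. f has_laurent_expansion F)"
  by (simp add: meromorphic_on_def)

lemma Laurent_tendsto_iff:
  assumes "f has_laurent_expansion F"
  shows "(f \<longlongrightarrow> l) (at 0) \<longleftrightarrow> fls_subdegree F \<ge> 0 \<and> fls_nth F 0 = l"
proof (cases "fls_subdegree F \<ge> 0")
  case True
  then have "(f \<longlongrightarrow> fls_nth F 0) (at 0)"
    using assms by (intro has_laurent_expansion_imp_tendsto_0)
  then show ?thesis using True LIM_unique by blast
next
  case False
  then have "filterlim f at_infinity (at 0)"
    using assms by (intro has_laurent_expansion_imp_filterlim_infinity_0) auto
  then show ?thesis
    using False not_tendsto_and_filterlim_at_infinity[of "at (0::complex)"] by auto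
qed

lemma residue_lin_meromorphic:
  assumes "f meromorphic_on {0}" "g meromorphic_on {0}"
  shows "residue (\<lambda>h. c * f h + g h) 0 = c * residue f 0 + residue g 0"
proof -
  obtain F G where FG: "f has_laurent_expansion F" "g has_laurent_expansion G"
    using assms by (auto simp: meromorphic_at_0)
  have "(\<lambda>h. c * f h + g h) has_laurent_expansion fls_const c * F + G"
    by (intro laurent_expansion_intros FG)
  from has_laurent_expansion_residue_0[OF this] show ?thesis
    by (simp add: has_laurent_expansion_residue_0[OF FG(1)] has_laurent_expansion_residue_0[OF FG(2)])
qed

lemma residue_deriv:
  assumes "f meromorphic_on {0}" shows "residue (deriv f) 0 = 0"
proof -
  obtain F where F: "f has_laurent_expansion F"
    using assms by (auto simp: meromorphic_at_0)
  show ?thesis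
    using has_laurent_expansion_residue_0[OF has_laurent_expansion_deriv[OF F]]
    by (simp only: fls_residue_deriv)
qed

lemma residue_tendsto:
  assumes "f meromorphic_on {0}" "((\<lambda>h. f h * h) \<longlongrightarrow> c) (at 0)"
  shows "residue f 0 = c"
proof -
  obtain F where F: "f has_laurent_expansion F"
    using assms by (auto simp: meromorphic_at_0)
  have "(\<lambda>h. f h * h) has_laurent_expansion F * fls_X"
    by (intro laurent_expansion_intros F)
  from Laurent_tendsto_iff[OF this] assms(2) have "fls_nth (F * fls_X) 0 = c" by simp
  then show ?thesis using has_laurent_expansion_residue_0[OF F] by (simp add: fls_X_times_conv_shift)
qed

lemma residue_tendsto_0:
  assumes "f meromorphic_on {0}" "(f \<longlongrightarrow> c) (at 0)" shows "residue f 0 = 0"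
proof -
  have "((\<lambda>h. f h * h) \<longlongrightarrow> c * 0) (at 0)" using assms(2) by (intro tendsto_intros)
  with assms(1) show ?thesis by (intro residue_tendsto) auto
qed

lemma deriv_tendsto_meromorphic:
  assumes "f meromorphic_on {0}" "(f \<longlongrightarrow> c) (at 0)"
  obtains l where "(deriv f \<longlongrightarrow> l) (at 0)"
proof -
  obtain F where F: "f has_laurent_expansion F"
    using assms by (auto simp: meromorphic_at_0)
  with assms(2) have "fls_subdegree F \<ge> 0" by (simp add: Laurent_tendsto_iff)
  then have "fls_subdegree (fls_deriv F) \<ge> 0"
  proof (cases "fls_deriv F = 0")
    case False
    have "fls_nth (fls_deriv F) k = 0" if "k < 0" for k
    proof (cases "k = -1")
      case False
      then have "fls_nth F (k + 1) = 0"
        using that \<open>fls_subdegree F \<ge> 0\<close> by (intro fls_eq0_below_subdegree) auto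
      then show ?thesis by simp
    qed simp
    with False show ?thesis by (intro fls_subdegree_geI)
  qed simp
  then show thesis
    using that Laurent_tendsto_iff[OF has_laurent_expansion_deriv[OF F]] by blast
qed

text \<open>A derivative at \<open>h\<close> sees a whole neighbourhood of \<open>h\<close>. In this
  form, identities valid off a finite set can be differentiated at points near the
  singularity.\<close>

lemma eventually_at_eventually_nhds:
  assumes "\<forall>\<^sub>F h in at (a::complex). P h" shows "\<forall>\<^sub>F h in at a. \<forall>\<^sub>F k in nhds h. P k"
proof -
  obtain S where S: "open S" "a \<in> S" "\<And>h. h \<in> S \<Longrightarrow> h \<noteq> a \<Longrightarrow> P h"
    using assms unfolding eventually_at_topological by auto
  have "\<forall>\<^sub>F h in at a. h \<in> S - {a}" using S by (intro eventually_at_in_open) auto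
  then show ?thesis
  proof (rule eventually_mono)
    fix h assume "h \<in> S - {a}"
    then have "\<forall>\<^sub>F k in nhds h. k \<in> S - {a}" using S(1) by (intro eventually_nhds_in_open) auto
    then show "\<forall>\<^sub>F k in nhds h. P k" by (rule eventually_mono) (use S(3) in auto)
  qed
qed

lemma eventually_differentiable_meromorphic:
  assumes "f meromorphic_on {0}" shows "\<forall>\<^sub>F h in at 0. f field_differentiable at h"
proof -
  have "isolated_singularity_at f 0" using assms by (auto simp: meromorphic_at_iff)
  then have "\<forall>\<^sub>F h in at 0. f analytic_on {h}" using isolated_singularity_at_altdef by blast
  then show ?thesis
    by (rule eventually_mono) (auto dest: analytic_on_imp_differentiable_at)
qed

lemma amero_meromorphic: "amero f \<Longrightarrow> (\<lambda>h. f (chart z h)) meromorphic_on {0}"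
  by (simp add: amero_def)

section \<open>The form, the bracket and the residue cocycle\<close>

lemma clin_form_left: "clin (\<lambda>a::'g::quadratic_lie_algebra. form a b)"
  by (simp add: clin_def form_add form_scale)

lemma clin_form_right: "clin (form (a::'g::quadratic_lie_algebra))"
  using clin_form_left[of a] by (simp add: clin_def form_sym)

lemmas form_linear [simp] = clin_add[OF clin_form_left] clin_add[OF clin_form_right]
  clin_scale[OF clin_form_left, simplified] clin_scale[OF clin_form_right, simplified]
  clin_zero[OF clin_form_left] clin_zero[OF clin_form_right]
  clin_diff[OF clin_form_left] clin_diff[OF clin_form_right]
  clin_uminus[OF clin_form_left] clin_uminus[OF clin_form_right]

lemma clin_lie_left: "clin (\<lambda>a::'g::complex_lie_algebra. lie a b)"
  by (simp add: clin_def lie_add_left lie_scale_left)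

lemma clin_lie_right: "clin (lie (a::'g::complex_lie_algebra))"
  by (simp add: clin_def lie_add_right lie_scale_right)

lemmas lie_linear [simp] = clin_add[OF clin_lie_left] clin_add[OF clin_lie_right]
  clin_scale[OF clin_lie_left] clin_scale[OF clin_lie_right]
  clin_zero[OF clin_lie_left] clin_zero[OF clin_lie_right]
  clin_diff[OF clin_lie_left] clin_diff[OF clin_lie_right]
  clin_uminus[OF clin_lie_left] clin_uminus[OF clin_lie_right]

lemma lie_anti: "lie a b = - lie b (a::'g::complex_lie_algebra)"
proof -
  have "lie a (a + b) + lie b (a + b) = 0" using lie_self[of "a + b"] by (simp only: lie_add_left)
  then have "lie b a + lie a b = 0" by (simp add: lie_self add.commute)
  then show ?thesis by (metis add_eq_0_iff)
qed

text \<open>The form \<open>(\<phi>, d\<psi>)\<close>: since there is no topology on the Lie algebra, \<open>\<phi>\<close> is frozen at a point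
  before \<open>\<psi>\<close> is differentiated.\<close>

definition pair_deriv ::
  "proj \<Rightarrow> (proj \<Rightarrow> 'g::quadratic_lie_algebra) \<Rightarrow> (proj \<Rightarrow> 'g) \<Rightarrow> complex \<Rightarrow> complex"
  where "pair_deriv z \<phi> \<psi> h = deriv (\<lambda>k. form (\<phi> (chart z h)) (\<psi> (chart z k))) h"

text \<open>The 2-cocycle of the affine central extension, for the loop around
  \<open>z\<close>.\<close>

definition res :: "proj \<Rightarrow> (proj \<Rightarrow> 'g::quadratic_lie_algebra) \<Rightarrow> (proj \<Rightarrow> 'g) \<Rightarrow> complex"
  where "res z \<phi> \<psi> = residue (pair_deriv z \<phi> \<psi>) 0"

lemma form_meromorphic:
  assumes "vmero \<psi>" shows "(\<lambda>k. form a (\<psi> (chart z k))) meromorphic_on {0}"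
  by (rule amero_meromorphic[of "\<lambda>p. form a (\<psi> p)"], rule vmero_functional[OF assms])
    (rule clin_form_right)

text \<open>The quantifier over \<open>v\<close> stands inside the filter because \<open>v\<close>
  will be the value of another map at the same \<open>h\<close>. Differentiability of the finitely
  many coefficients serves all \<open>v\<close> at once.\<close>

lemma form_differentiable:
  fixes \<psi> :: "proj \<Rightarrow> 'g::quadratic_lie_algebra"
  assumes "vmero \<psi>"
  shows "\<forall>\<^sub>F h in at 0. \<forall>v. (\<lambda>k. form v (\<psi> (chart z k))) field_differentiable at h"
  using assms
proof (induction rule: vmero.induct)
  case (vmero_term f \<phi> a)
  have "\<forall>\<^sub>F h in at 0. (\<lambda>k. f (chart z k)) field_differentiable at h"
    using vmero_term(1) by (intro eventually_differentiable_meromorphic amero_meromorphic)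
  then show ?case using vmero_term.IH
  proof eventually_elim
    case (elim h)
    then show ?case
      by (auto intro!: field_differentiable_add field_differentiable_mult)
  qed
next
  case (vmero_cong \<phi> \<psi>)
  have "\<forall>\<^sub>F h in at 0. \<forall>\<^sub>F k in nhds h. \<phi> (chart z k) = \<psi> (chart z k)"
    using cofinite_imp_punctured[OF vmero_cong.hyps(2)]
    by (intro eventually_at_eventually_nhds) (simp add: eventually_punctured)
  then show ?case using vmero_cong.IH
  proof eventually_elim
    case (elim h)
    show ?case
    proof
      fix v
      have "\<forall>\<^sub>F k in nhds h. form v (\<psi> (chart z k)) = form v (\<phi> (chart z k))"
        using elim(1) by (rule eventually_mono) simp
      from DERIV_cong_ev[OF refl this refl] elim(2)
      show "(\<lambda>k. form v (\<psi> (chart z k))) field_differentiable at h"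
        unfolding field_differentiable_def by blast
    qed
  qed
qed (auto intro: always_eventually)

lemma pair_deriv_cong:
  assumes "\<forall>\<^sub>F p in cofinite. \<phi> p = \<phi>' p" "\<forall>\<^sub>F p in cofinite. \<psi> p = \<psi>' p"
  shows "\<forall>\<^sub>F h in at 0. pair_deriv z \<phi> \<psi> h = pair_deriv z \<phi>' \<psi>' h"
proof -
  have "\<forall>\<^sub>F h in at 0. \<forall>\<^sub>F k in nhds h. \<psi> (chart z k) = \<psi>' (chart z k)"
    using cofinite_imp_punctured[OF assms(2)]
    by (intro eventually_at_eventually_nhds) (simp add: eventually_punctured)
  moreover have "\<forall>\<^sub>F h in at 0. \<phi> (chart z h) = \<phi>' (chart z h)"
    using cofinite_imp_punctured[OF assms(1)] by (simp add: eventually_punctured)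
  ultimately show ?thesis
    by eventually_elim (auto simp: pair_deriv_def intro!: deriv_cong_ev elim: eventually_mono)
qed

lemma res_cong:
  assumes "\<forall>\<^sub>F p in cofinite. \<phi> p = \<phi>' p" "\<forall>\<^sub>F p in cofinite. \<psi> p = \<psi>' p"
  shows "res z \<phi> \<psi> = res z \<phi>' \<psi>'"
  unfolding res_def by (rule residue_cong[OF pair_deriv_cong[OF assms] refl])

lemma pair_deriv_lin_left:
  assumes "vmero \<psi>"
  shows "\<forall>\<^sub>F h in at 0. pair_deriv z (\<lambda>p. f p *\<^sub>C \<phi> p + \<phi>' p) \<psi> h =
    f (chart z h) * pair_deriv z \<phi> \<psi> h + pair_deriv z \<phi>' \<psi> h"
  using form_differentiable[OF assms, of z]
  by (rule eventually_mono) (simp add: pair_deriv_def field_differentiable_mult deriv_cmult)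

lemma pair_deriv_lin_right:
  assumes "vmero \<psi>" "vmero \<psi>'"
  shows "\<forall>\<^sub>F h in at 0. pair_deriv z \<phi> (\<lambda>p. c *\<^sub>C \<psi> p + \<psi>' p) h =
    c * pair_deriv z \<phi> \<psi> h + pair_deriv z \<phi> \<psi>' h"
  using form_differentiable[OF assms(1), of z] form_differentiable[OF assms(2), of z]
  by eventually_elim (simp add: pair_deriv_def field_differentiable_mult deriv_cmult)

lemma pair_deriv_meromorphic:
  assumes "vmero \<phi>" "vmero \<psi>" shows "pair_deriv z \<phi> \<psi> meromorphic_on {0}"
  using assms(1)
proof (induction rule: vmero.induct)
  case vmero_zero
  have "pair_deriv z (\<lambda>_. 0) \<psi> = (\<lambda>_. 0)" by (simp add: pair_deriv_def fun_eq_iff)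
  then show ?case by (simp add: meromorphic_on_const)
next
  case (vmero_term f \<phi> a)
  have "deriv (\<lambda>k. form a (\<psi> (chart z k))) meromorphic_on {0}"
    using form_meromorphic[OF assms(2)] by (rule meromorphic_on_deriv)
  moreover have "pair_deriv z (\<lambda>_. a) \<psi> = deriv (\<lambda>k. form a (\<psi> (chart z k)))"
    by (simp add: pair_deriv_def fun_eq_iff)
  ultimately have "(\<lambda>h. f (chart z h) * pair_deriv z (\<lambda>_. a) \<psi> h + pair_deriv z \<phi> \<psi> h) meromorphic_on {0}"
    using vmero_term by (intro meromorphic_on_add meromorphic_on_mult amero_meromorphic) simp_all
  then show ?case
    by (subst meromorphic_on_cong[OF _ refl]) (auto intro!: pair_deriv_lin_left assms)
next
  case (vmero_cong \<phi> \<phi>')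
  have "\<forall>\<^sub>F h in at 0. pair_deriv z \<phi> \<psi> h = pair_deriv z \<phi>' \<psi> h"
    using vmero_cong.hyps(2) by (intro pair_deriv_cong) auto
  then have "pair_deriv z \<phi> \<psi> meromorphic_on {0} \<longleftrightarrow> pair_deriv z \<phi>' \<psi> meromorphic_on {0}"
    by (intro meromorphic_on_cong) auto
  then show ?case using vmero_cong.IH by simp
qed

lemma res_lin_left:
  assumes "vmero \<phi>" "vmero \<phi>'" "vmero \<psi>"
  shows "res z (\<lambda>p. c *\<^sub>C \<phi> p + \<phi>' p) \<psi> = c * res z \<phi> \<psi> + res z \<phi>' \<psi>"
proof -
  have "res z (\<lambda>p. c *\<^sub>C \<phi> p + \<phi>' p) \<psi> = residue (\<lambda>h. c * pair_deriv z \<phi> \<psi> h + pair_deriv z \<phi>' \<psi> h) 0"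
    unfolding res_def by (rule residue_cong[OF _ refl], rule pair_deriv_lin_left) fact
  then show ?thesis
    using assms by (simp add: res_def pair_deriv_meromorphic residue_lin_meromorphic)
qed

lemma res_lin_right:
  assumes "vmero \<phi>" "vmero \<psi>" "vmero \<psi>'"
  shows "res z \<phi> (\<lambda>p. c *\<^sub>C \<psi> p + \<psi>' p) = c * res z \<phi> \<psi> + res z \<phi> \<psi>'"
proof -
  have "res z \<phi> (\<lambda>p. c *\<^sub>C \<psi> p + \<psi>' p) = residue (\<lambda>h. c * pair_deriv z \<phi> \<psi> h + pair_deriv z \<phi> \<psi>' h) 0"
    unfolding res_def by (rule residue_cong[OF _ refl], rule pair_deriv_lin_right) fact+
  then show ?thesis
    using assms by (simp add: res_def pair_deriv_meromorphic residue_lin_meromorphic)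
qed

lemma res_const_right [simp]: "res z \<phi> (\<lambda>_. c) = 0"
proof -
  have "pair_deriv z \<phi> (\<lambda>_. c) = (\<lambda>_. 0)" by (simp add: pair_deriv_def fun_eq_iff)
  then show ?thesis by (simp add: res_def residue_const)
qed

text \<open>Only \<open>\<psi>\<close> is expanded: a summand \<open>f a\<close> contributes the
  scalar product of \<open>f\<close> and (v, [a, \<theta>]), so the ordinary product rule yields the
  Leibniz rule for the bracket.\<close>

lemma deriv_lie_product:
  assumes "vmero \<psi>" "vmero \<theta>"
  shows "\<forall>\<^sub>F h in at 0. \<forall>v. deriv (\<lambda>k. form v (lie (\<psi> (chart z k)) (\<theta> (chart z k)))) h =
    deriv (\<lambda>k. form v (lie (\<psi> (chart z k)) (\<theta> (chart z h)))) h +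
    deriv (\<lambda>k. form v (lie (\<psi> (chart z h)) (\<theta> (chart z k)))) h"
  using assms(1)
proof (induction rule: vmero.induct)
  case vmero_zero
  then show ?case by simp
next
  case (vmero_term f \<phi> a)
  let ?f = "\<lambda>h. f (chart z h)" and ?\<phi> = "\<lambda>h. \<phi> (chart z h)" and ?\<theta> = "\<lambda>h. \<theta> (chart z h)"
  have "vmero (\<lambda>p. lie (\<phi> p) (\<theta> p))"
    using vmero_term(2) assms(2) by (rule vmero_bilinear) (rule clin_lie_left clin_lie_right)+
  from form_differentiable[OF this, of z] form_differentiable[OF vmero_term(2), of z]
    form_differentiable[OF assms(2), of z] vmero_term.IH
    eventually_differentiable_meromorphic[OF amero_meromorphic[OF vmero_term(1)], of z]
  show ?case
  proof eventually_elim
    case (elim h)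
    show ?case
    proof
      fix v
      have d1: "(\<lambda>k. form v (lie a (?\<theta> k))) field_differentiable at h"
        using elim(3) by (simp add: form_invariant[symmetric])
      have d2: "(\<lambda>k. form v (lie (?\<phi> h) (?\<theta> k))) field_differentiable at h"
        using elim(3) by (simp add: form_invariant[symmetric])
      have *: "form v (lie (?\<phi> k) w) = - form (lie v w) (?\<phi> k)" for k w
        by (subst lie_anti) (simp add: form_invariant[symmetric])
      have d3: "(\<lambda>k. form v (lie (?\<phi> k) (?\<theta> h))) field_differentiable at h"
        unfolding * using elim(2) by (auto intro: field_differentiable_minus)
      show "deriv (\<lambda>k. form v (lie (?f k *\<^sub>C a + ?\<phi> k) (?\<theta> k))) h =
          deriv (\<lambda>k. form v (lie (?f k *\<^sub>C a + ?\<phi> k) (?\<theta> h))) h +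
          deriv (\<lambda>k. form v (lie (?f h *\<^sub>C a + ?\<phi> h) (?\<theta> k))) h"
        using elim d1 d2 d3
        by (simp add: field_differentiable_mult deriv_mult)
    qed
  qed
next
  case (vmero_cong \<phi> \<phi>')
  have "\<forall>\<^sub>F h in at 0. \<phi> (chart z h) = \<phi>' (chart z h)"
    using cofinite_imp_punctured[OF vmero_cong.hyps(2)] by (simp add: eventually_punctured)
  from vmero_cong.IH this eventually_at_eventually_nhds[OF this] show ?case
  proof eventually_elim
    case (elim h)
    show ?case
    proof
      fix v
      have eq: "deriv (\<lambda>k. form v (lie (\<phi> (chart z k)) (g k))) h =
        deriv (\<lambda>k. form v (lie (\<phi>' (chart z k)) (g k))) h" for g
        using elim(3) by (auto intro!: deriv_cong_ev elim: eventually_mono)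
      show "deriv (\<lambda>k. form v (lie (\<phi>' (chart z k)) (\<theta> (chart z k)))) h =
        deriv (\<lambda>k. form v (lie (\<phi>' (chart z k)) (\<theta> (chart z h)))) h +
        deriv (\<lambda>k. form v (lie (\<phi>' (chart z h)) (\<theta> (chart z k)))) h"
        using elim(1) eq[of "\<lambda>k. \<theta> (chart z k)"] eq[of "\<lambda>k. \<theta> (chart z h)"]
        by (simp add: elim(2))
    qed
  qed
qed

text \<open>By the Leibniz rule (\<phi>, d[\<psi>, \<theta>]) = (\<phi>, [d\<psi>, \<theta>]) +
  (\<phi>, [\<psi>, d\<theta>]); invariance of the form turns this into ([\<phi>, \<psi>],
  d\<theta>) - ([\<phi>, \<theta>], d\<psi>).\<close>

lemma res_cocycle:
  assumes "vmero \<phi>" "vmero \<psi>" "vmero \<theta>"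
  shows "res z \<phi> (\<lambda>p. lie (\<psi> p) (\<theta> p)) =
    res z (\<lambda>p. lie (\<phi> p) (\<psi> p)) \<theta> - res z (\<lambda>p. lie (\<phi> p) (\<theta> p)) \<psi>"
proof -
  have vm: "vmero (\<lambda>p. lie (\<phi> p) (\<psi> p))" if "vmero \<psi>" for \<psi>
    using assms(1) that by (rule vmero_bilinear) (rule clin_lie_left clin_lie_right)+
  have "\<forall>\<^sub>F h in at 0. pair_deriv z \<phi> (\<lambda>p. lie (\<psi> p) (\<theta> p)) h =
    -1 * pair_deriv z (\<lambda>p. lie (\<phi> p) (\<theta> p)) \<psi> h + pair_deriv z (\<lambda>p. lie (\<phi> p) (\<psi> p)) \<theta> h"
    using deriv_lie_product[OF assms(2,3), of z] form_differentiable[OF assms(2), of z]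
  proof eventually_elim
    case (elim h)
    let ?v = "\<phi> (chart z h)"
    have *: "form ?v (lie (\<psi> (chart z k)) w) = -1 * form (lie ?v w) (\<psi> (chart z k))" for k w
      by (subst lie_anti) (simp add: form_invariant[symmetric])
    have "deriv (\<lambda>k. form ?v (lie (\<psi> (chart z k)) (\<theta> (chart z h)))) h =
      -1 * deriv (\<lambda>k. form (lie ?v (\<theta> (chart z h))) (\<psi> (chart z k))) h"
      unfolding * using elim(2) by (intro deriv_cmult) simp
    with elim(1) show ?case
      by (simp add: pair_deriv_def form_invariant[symmetric])
  qed
  then have "res z \<phi> (\<lambda>p. lie (\<psi> p) (\<theta> p)) = residue (\<lambda>h. -1 * pair_deriv z (\<lambda>p. lie (\<phi> p) (\<theta> p)) \<psi> h
      + pair_deriv z (\<lambda>p. lie (\<phi> p) (\<psi> p)) \<theta> h) 0"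
    unfolding res_def by (intro residue_cong) auto
  also have "\<dots> = -1 * res z (\<lambda>p. lie (\<phi> p) (\<theta> p)) \<psi> + res z (\<lambda>p. lie (\<phi> p) (\<psi> p)) \<theta>"
    unfolding res_def using assms vm
    by (intro residue_lin_meromorphic pair_deriv_meromorphic)
  finally show ?thesis by simp
qed

lemma res_scalar_left:
  assumes "vmero \<psi>"
  shows "res z (\<lambda>p. f p *\<^sub>C a) \<psi> =
    residue (\<lambda>h. f (chart z h) * deriv (\<lambda>k. form a (\<psi> (chart z k))) h) 0"
  unfolding res_def
proof (rule residue_cong[OF _ refl])
  show "\<forall>\<^sub>F h in at 0. pair_deriv z (\<lambda>p. f p *\<^sub>C a) \<psi> h =
    f (chart z h) * deriv (\<lambda>k. form a (\<psi> (chart z k))) h"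
    using form_differentiable[OF assms, of z]
    by (rule eventually_mono) (simp add: pair_deriv_def deriv_cmult)
qed

text \<open>The coefficients of \<phi> have limits, and so does the derivative of a scalar
  meromorphic function with a limit; the integrand therefore has a limit at
  \<open>z\<close>.\<close>

lemma res_regular:
  assumes "vlim z \<phi> v" "vlim z \<psi> w" shows "res z \<phi> \<psi> = 0"
proof -
  note \<psi> = vlim_vmero[OF assms(2)]
  have "\<exists>l. (pair_deriv z \<phi> \<psi> \<longlongrightarrow> l) (at 0)"
    using assms(1)
  proof (induction rule: vlim.induct)
    case vlim_zero
    then show ?case by (auto simp: pair_deriv_def)
  next
    case (vlim_term f l \<phi> v a)
    have "((\<lambda>k. form a (\<psi> (chart z k))) \<longlongrightarrow> form a w) (at 0)"
      using vlim_functional[OF assms(2) clin_form_right] by (simp add: tendsto_punctured)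
    moreover have "(\<lambda>k. form a (\<psi> (chart z k))) meromorphic_on {0}"
      by (rule form_meromorphic[OF \<psi>])
    ultimately obtain m where m: "(deriv (\<lambda>k. form a (\<psi> (chart z k))) \<longlongrightarrow> m) (at 0)"
      using deriv_tendsto_meromorphic by blast
    obtain l' where l': "(pair_deriv z \<phi> \<psi> \<longlongrightarrow> l') (at 0)" using vlim_term.IH by blast
    have "((\<lambda>h. f (chart z h) * deriv (\<lambda>k. form a (\<psi> (chart z k))) h + pair_deriv z \<phi> \<psi> h)
      \<longlongrightarrow> l * m + l') (at 0)"
      using vlim_term(2) m l' by (intro tendsto_intros) (simp_all add: tendsto_punctured)
    moreover have "\<forall>\<^sub>F h in at 0. pair_deriv z (\<lambda>p. f p *\<^sub>C a + \<phi> p) \<psi> h =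
      f (chart z h) * deriv (\<lambda>k. form a (\<psi> (chart z k))) h + pair_deriv z \<phi> \<psi> h"
      using pair_deriv_lin_left[OF \<psi>, of z f "\<lambda>_. a" \<phi>] by (simp add: pair_deriv_def)
    ultimately have "(pair_deriv z (\<lambda>p. f p *\<^sub>C a + \<phi> p) \<psi> \<longlongrightarrow> l * m + l') (at 0)"
      by (simp only: tendsto_cong)
    then show ?case ..
  next
    case (vlim_cong \<phi> v \<phi>')
    have "\<forall>\<^sub>F h in at 0. pair_deriv z \<phi> \<psi> h = pair_deriv z \<phi>' \<psi> h"
      using vlim_cong.hyps(2) by (intro pair_deriv_cong) auto
    from tendsto_cong[OF this] show ?case using vlim_cong.IH by simp
  qed
  then show ?thesis
    unfolding res_def
    using residue_tendsto_0 pair_deriv_meromorphic[OF vlim_vmero[OF assms(1)] \<psi>] by blast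
qed

section \<open>Coordinates\<close>

text \<open>The coordinate with pole at the first argument that is inverse to the parameter of
  \<open>chart\<close> there (\<open>kfun_chart\<close>). At the pole the value is 0, in accordance
  with \<open>mero_fun\<close>.\<close>

fun kfun :: "proj \<Rightarrow> proj \<Rightarrow> complex"
  where
    "kfun (Pt c) (Pt x) = 1 / (x - c)"
  | "kfun (Pt c) Infty = 0"
  | "kfun Infty (Pt x) = x"
  | "kfun Infty Infty = 0"

lemma kfun_chart: "kfun P (chart P h) = 1 / h"
  by (cases P) auto

lemma kfun_inj: "kfun P z = kfun P w \<Longrightarrow> z \<noteq> P \<Longrightarrow> w \<noteq> P \<Longrightarrow> z = w"
  by (cases P; cases z; cases w) (auto simp: field_simps)

lemma kfun_analytic:
  assumes "z \<noteq> P"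
  obtains d where "d \<noteq> 0" "((\<lambda>h. kfun P (chart z h)) has_field_derivative d) (at 0)"
    "(\<lambda>h. kfun P (chart z h)) analytic_on {0}"
proof (cases P)
  case (Pt c)
  show thesis
  proof (cases z)
    case z: (Pt a)
    have ac: "a - c \<noteq> 0" using assms by (simp add: Pt z)
    show thesis
    proof (rule that)
      show "((\<lambda>h. kfun P (chart z h)) has_field_derivative - (1 / (a - c)\<^sup>2)) (at 0)"
        using ac by (auto simp: Pt z power2_eq_square intro!: derivative_eq_intros)
      show "(\<lambda>h. kfun P (chart z h)) analytic_on {0}"
        using ac by (auto simp: Pt z intro!: analytic_intros)
    qed (use ac in auto)
  next
    case z: Infty
    have "\<forall>\<^sub>F h in nhds (0::complex). 1 - c * h \<in> - {0}"
      by (rule topological_tendstoD[of "\<lambda>h. 1 - c * h" "1 - c * 0"])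
        (auto intro!: tendsto_eq_intros filterlim_ident)
    then have ev: "\<forall>\<^sub>F h in nhds 0. h / (1 - c * h) = kfun P (chart z h)"
      by (rule eventually_mono) (auto simp: Pt z divide_simps)
    show thesis
    proof (rule that)
      have "((\<lambda>h. h / (1 - c * h)) has_field_derivative 1) (at 0)"
        by (auto intro!: derivative_eq_intros)
      then show "((\<lambda>h. kfun P (chart z h)) has_field_derivative 1) (at 0)"
        using DERIV_cong_ev[OF refl ev refl] by simp
      have "(\<lambda>h. h / (1 - c * h)) analytic_on {0}" by (auto intro!: analytic_intros)
      then show "(\<lambda>h. kfun P (chart z h)) analytic_on {0}"
        using analytic_at_cong[OF ev refl] by simp
    qed auto
  qed
next
  case Infty
  then obtain a where z: "z = Pt a" using assms by (cases z) auto
  show thesis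
    by (rule that[of 1]) (auto simp: Infty z intro!: derivative_eq_intros analytic_intros)
qed

lemma tendsto_chart_iff_isCont: "((\<lambda>h. f (chart z h)) \<longlongrightarrow> f z) (at 0) \<longleftrightarrow> isCont (\<lambda>h. f (chart z h)) 0"
  by (simp add: isCont_def)

lemma kfun_tendsto: "z \<noteq> P \<Longrightarrow> (kfun P \<longlongrightarrow> kfun P z) (punctured z)"
  unfolding tendsto_punctured tendsto_chart_iff_isCont
  by (elim kfun_analytic) (rule analytic_at_imp_isCont)

lemma amero_kfun: "amero (kfun P)"
  unfolding amero_def
proof
  fix z
  show "(\<lambda>h. kfun P (chart z h)) meromorphic_on {0}"
  proof (cases "z = P")
    case True
    then show ?thesis by (auto simp: kfun_chart intro!: meromorphic_intros)
  qed (metis kfun_analytic analytic_on_imp_meromorphic_on)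
qed

text \<open>With \<open>c\<close> the coefficient of the simple pole, \<open>u - c * kfun P\<close>
  has no pole left and is constant by Liouville.\<close>

lemma coordinate_kfun:
  assumes "coordinate u P"
  obtains c d where "c \<noteq> 0" "\<And>p. p \<noteq> P \<Longrightarrow> u p = c * kfun P p + d"
proof -
  have u: "mero_fun u" "\<And>p. has_pole u p \<longleftrightarrow> p = P" "zorder (\<lambda>h. u (chart P h)) 0 = -1"
    using assms by (auto simp: coordinate_def)
  obtain F where F: "(\<lambda>h. u (chart P h)) has_laurent_expansion F"
    using mero_fun_amero[OF u(1)] by (auto simp: amero_def meromorphic_at_0)
  have pole: "is_pole (\<lambda>h. u (chart P h)) 0" using u(2) by (simp add: has_pole_def)
  have neg: "fls_subdegree F < 0" using is_pole_0_imp_neg_fls_subdegree[OF F pole] .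
  then have "F \<noteq> 0" by auto
  then have sub: "fls_subdegree F = -1" using has_laurent_expansion_zorder_0[OF F] u(3) by simp
  define c where "c = fls_nth F (-1)"
  have c: "c \<noteq> 0" using sub nth_fls_subdegree_nonzero[OF \<open>F \<noteq> 0\<close>] by (simp add: c_def)
  define g where "g p = u p - c * kfun P p" for p
  have am: "amero g" unfolding g_def
    by (intro amero_diff amero_mult amero_const amero_kfun mero_fun_amero[OF u(1)])
  have "(\<lambda>h. u (chart P h) - c * (1 / h)) has_laurent_expansion F - fls_const c * (1 / fls_X)"
    by (intro laurent_expansion_intros F)
  then have G: "(\<lambda>h. g (chart P h)) has_laurent_expansion F - fls_const c * fls_X_inv"
    by (simp add: g_def kfun_chart fls_inverse_X inverse_eq_divide[symmetric] del: fls_divide_X)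
  have "fls_nth (F - fls_const c * fls_X_inv) k = 0" if "k < 0" for k
    using that sub by (cases "k = -1") (auto simp: c_def)
  then have "fls_subdegree (F - fls_const c * fls_X_inv) \<ge> 0"
    by (cases "F - fls_const c * fls_X_inv = 0") (auto intro!: fls_subdegree_geI)
  then have "(g \<longlongrightarrow> fls_nth (F - fls_const c * fls_X_inv) 0) (punctured P)"
    unfolding tendsto_punctured Laurent_tendsto_iff[OF G] by simp
  then have P: "\<not> has_pole g P" by (rule not_pole_tendsto)
  have lim: "(g \<longlongrightarrow> g z) (punctured z)" if "z \<noteq> P" for z
    unfolding g_def using that u by (intro tendsto_intros kfun_tendsto mero_fun_tendsto) auto
  have "\<not> has_pole (nice g) z" for z
    using P lim not_pole_tendsto has_pole_cong[OF nice_ae[OF am]] by (cases "z = P") auto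
  then have "nice g p = nice g P" for p
    by (intro Liouville_proj mero_fun_nice am)
  then have "g p = nice g P" if "p \<noteq> P" for p
    using nice_eqI[OF lim[OF that]] by metis
  then have "u p = c * kfun P p + nice g P" if "p \<noteq> P" for p
    using that by (auto simp: g_def algebra_simps)
  with c show thesis by (rule that)
qed

lemma removable_quotient:
  assumes "f meromorphic_on {0}" "(f \<longlongrightarrow> l) (at 0)"
  obtains m where "((\<lambda>h. (f h - l) / h) \<longlongrightarrow> m) (at 0)"
proof -
  obtain F where F: "f has_laurent_expansion F"
    using assms by (auto simp: meromorphic_at_0)
  have sub: "fls_subdegree F \<ge> 0" "fls_nth F 0 = l" using assms(2) by (simp_all add: Laurent_tendsto_iff[OF F])
  define G where "G = (F - fls_const l) * fls_X_inv"
  have "(\<lambda>h. (f h - l) * inverse h) has_laurent_expansion (F - fls_const l) * inverse fls_X"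
    by (intro laurent_expansion_intros F)
  then have G: "(\<lambda>h. (f h - l) / h) has_laurent_expansion G"
    by (simp add: G_def fls_inverse_X divide_inverse)
  have "fls_nth G k = 0" if "k < 0" for k
  proof (cases "k = -1")
    case False
    then have "fls_nth F (k + 1) = 0" using that sub by (intro fls_eq0_below_subdegree) auto
    then show ?thesis using False by (simp add: G_def fls_X_inv_times_conv_shift)
  qed (use sub in \<open>simp add: G_def fls_X_inv_times_conv_shift\<close>)
  then have "fls_subdegree G \<ge> 0"
    by (cases "G = 0") (auto intro!: fls_subdegree_geI)
  then show thesis using that Laurent_tendsto_iff[OF G] by blast
qed

lemma scaled_difference:
  "(x * (f - l)) *\<^sub>C a + x *\<^sub>C (b - v) = x *\<^sub>C (f *\<^sub>C a + b - (l *\<^sub>C a + v))"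
  for a b v :: "'v::complex_vector"
proof -
  have "(x * (f - l)) *\<^sub>C a = x *\<^sub>C (f *\<^sub>C a - l *\<^sub>C a)"
    by (metis scaleC_scaleC complex_vector.scale_left_diff_distrib)
  then show ?thesis by (simp only: scaleC_add_right[symmetric] add_diff_add)
qed

section \<open>A fixed coordinate and difference quotients with respect to it\<close>

locale coord =
  fixes u :: "proj \<Rightarrow> complex" and P :: proj
  assumes coordinate: "coordinate u P"
begin

lemma amero_u: "amero u"
  using coordinate by (simp add: coordinate_def mero_fun_amero)

lemma u_chart:
  assumes "z \<noteq> P"
  shows "(\<lambda>h. u (chart z h)) analytic_on {0}" "diff_at u z \<noteq> 0"
    "((\<lambda>h. u (chart z h)) has_field_derivative diff_at u z) (at 0)"
proof -
  obtain c d where c: "c \<noteq> 0" "\<And>p. p \<noteq> P \<Longrightarrow> u p = c * kfun P p + d"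
    using coordinate by (rule coordinate_kfun) blast
  obtain e where e: "e \<noteq> 0" "((\<lambda>h. kfun P (chart z h)) has_field_derivative e) (at 0)"
    "(\<lambda>h. kfun P (chart z h)) analytic_on {0}"
    using assms by (rule kfun_analytic)
  have "\<forall>\<^sub>F h in at 0. chart z h \<noteq> P"
    using eventually_neq_punctured by (simp add: eventually_punctured)
  then have "\<forall>\<^sub>F h in nhds 0. chart z h \<noteq> P"
    using assms by (simp add: eventually_nhds_conv_at)
  then have ev: "\<forall>\<^sub>F h in nhds 0. c * kfun P (chart z h) + d = u (chart z h)"
    by (rule eventually_mono) (simp add: c)
  have "((\<lambda>h. c * kfun P (chart z h) + d) has_field_derivative c * e) (at 0)"
    using e(2) by (auto intro!: derivative_eq_intros)
  then have *: "((\<lambda>h. u (chart z h)) has_field_derivative c * e) (at 0)"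
    using DERIV_cong_ev[OF refl ev refl] by simp
  have "(\<lambda>h. c * kfun P (chart z h) + d) analytic_on {0}"
    using e(3) by (intro analytic_intros)
  then show "(\<lambda>h. u (chart z h)) analytic_on {0}"
    using analytic_at_cong[OF ev refl] by simp
  have "diff_at u z = c * e" unfolding diff_at_def using * by (rule DERIV_imp_deriv)
  with * c(1) e(1) show "diff_at u z \<noteq> 0"
    "((\<lambda>h. u (chart z h)) has_field_derivative diff_at u z) (at 0)" by auto
qed

lemma u_inj: "u z = u w \<Longrightarrow> z \<noteq> P \<Longrightarrow> w \<noteq> P \<Longrightarrow> z = w"
proof -
  assume *: "u z = u w" "z \<noteq> P" "w \<noteq> P"
  obtain c d where "c \<noteq> 0" "\<And>p. p \<noteq> P \<Longrightarrow> u p = c * kfun P p + d"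
    using coordinate by (rule coordinate_kfun) blast
  with * have "kfun P z = kfun P w" by auto
  with * show "z = w" using kfun_inj by blast
qed

lemma u_tendsto: "z \<noteq> P \<Longrightarrow> (u \<longlongrightarrow> u z) (punctured z)"
  unfolding tendsto_punctured tendsto_chart_iff_isCont
  by (rule analytic_at_imp_isCont, rule u_chart)

lemma u_pole: "filterlim u at_infinity (punctured P)"
  using coordinate by (simp add: coordinate_def is_pole_punctured[symmetric])

lemma frac_vanish: "((\<lambda>p. c / (u p - b)) \<longlongrightarrow> 0) (punctured P)"
proof -
  have "filterlim (\<lambda>p. - b + u p) at_infinity (punctured P)"
    by (rule tendsto_add_filterlim_at_infinity[OF tendsto_const u_pole])
  then show ?thesis by (intro tendsto_divide_0[OF tendsto_const]) (simp add: algebra_simps)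
qed

lemma amero_frac: "amero (\<lambda>p. 1 / (u p - b))"
  by (intro amero_divide amero_diff amero_u) auto

lemma frac_tendsto: "w \<noteq> P \<Longrightarrow> z \<noteq> P \<Longrightarrow> w \<noteq> z \<Longrightarrow>
    ((\<lambda>p. 1 / (u p - u z)) \<longlongrightarrow> 1 / (u w - u z)) (punctured w)"
  using u_inj by (intro tendsto_intros u_tendsto) auto

lemma u_quotient:
  assumes "z \<noteq> P" shows "((\<lambda>h. (u (chart z h) - u z) / h) \<longlongrightarrow> diff_at u z) (at 0)"
  using u_chart(3)[OF assms] by (simp add: DERIV_def)

text \<open>Numerator and denominator are both divided by the chart parameter: the first then
  converges, the second tends to \<open>diff_at u z\<close>, which is nonzero off
  \<open>P\<close>.\<close>

lemma divided_difference:
  assumes "amero f" "(f \<longlongrightarrow> l) (punctured z)" "z \<noteq> P"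
  obtains m where "((\<lambda>p. 1 / (u p - u z) * (f p - l)) \<longlongrightarrow> m) (punctured z)"
proof -
  obtain m where m: "((\<lambda>h. (f (chart z h) - l) / h) \<longlongrightarrow> m) (at 0)"
    using removable_quotient[OF amero_meromorphic[OF assms(1)], of z l] assms(2)
    by (auto simp: tendsto_punctured)
  have "((\<lambda>h. ((f (chart z h) - l) / h) / ((u (chart z h) - u z) / h)) \<longlongrightarrow> m / diff_at u z) (at 0)"
    using assms(3) by (intro tendsto_divide m u_quotient u_chart)
  moreover have "\<forall>\<^sub>F h in at 0. ((f (chart z h) - l) / h) / ((u (chart z h) - u z) / h) =
    1 / (u (chart z h) - u z) * (f (chart z h) - l)"
    by (auto simp: eventually_at_filter intro!: always_eventually)
  ultimately have "((\<lambda>p. 1 / (u p - u z) * (f p - l)) \<longlongrightarrow> m / diff_at u z) (punctured z)"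
    unfolding tendsto_punctured by (rule Lim_transform_eventually)
  then show thesis by (rule that)
qed

lemma vmero_frac: "vmero \<phi> \<Longrightarrow> vmero (\<lambda>p. (1 / (u p - b)) *\<^sub>C \<phi> p)"
  by (rule vmero_scale[OF _ amero_frac])

lemma vlim_divided_difference:
  assumes "vlim z \<phi> v" "z \<noteq> P"
  shows "\<exists>w. vlim z (\<lambda>p. (1 / (u p - u z)) *\<^sub>C (\<phi> p - v)) w"
  using assms(1)
proof (induction rule: vlim.induct)
  case vlim_zero
  then show ?case using vlim.vlim_zero by auto
next
  case (vlim_term f l \<phi> v a)
  then obtain w where w: "vlim z (\<lambda>p. (1 / (u p - u z)) *\<^sub>C (\<phi> p - v)) w" by blast
  obtain m where m: "((\<lambda>p. 1 / (u p - u z) * (f p - l)) \<longlongrightarrow> m) (punctured z)"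
    using vlim_term(1,2) assms(2) by (rule divided_difference)
  have "vlim z (\<lambda>p. (1 / (u p - u z) * (f p - l)) *\<^sub>C a + (1 / (u p - u z)) *\<^sub>C (\<phi> p - v)) (m *\<^sub>C a + w)"
    using amero_frac vlim_term(1) m w by (intro vlim.vlim_term amero_mult amero_diff) auto
  moreover have "(1 / (u p - u z) * (f p - l)) *\<^sub>C a + (1 / (u p - u z)) *\<^sub>C (\<phi> p - v) =
    (1 / (u p - u z)) *\<^sub>C (f p *\<^sub>C a + \<phi> p - (l *\<^sub>C a + v))" for p
    by (rule scaled_difference)
  ultimately show ?case by auto
next
  case (vlim_cong \<phi> v \<psi>)
  then obtain w where w: "vlim z (\<lambda>p. (1 / (u p - u z)) *\<^sub>C (\<phi> p - v)) w" by blast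
  have "vlim z (\<lambda>p. (1 / (u p - u z)) *\<^sub>C (\<psi> p - v)) w"
    by (rule vlim.vlim_cong[OF w]) (use vlim_cong.hyps(2) in \<open>auto elim: eventually_mono\<close>)
  then show ?case ..
qed

end

section \<open>Operations on meromorphic maps\<close>

lemma vmero_lie: "vmero \<phi> \<Longrightarrow> vmero \<psi> \<Longrightarrow> vmero (\<lambda>p. lie (\<phi> p) (\<psi> p))"
  by (rule vmero_bilinear) (rule clin_lie_left clin_lie_right | assumption)+

lemma vlim_lie: "vlim z \<phi> v \<Longrightarrow> vlim z \<psi> w \<Longrightarrow> vlim z (\<lambda>p. lie (\<phi> p) (\<psi> p)) (lie v w)"
  by (rule vlim_bilinear) (rule clin_lie_left clin_lie_right | assumption)+

lemma vmero_lin: "vmero \<phi> \<Longrightarrow> vmero \<psi> \<Longrightarrow> vmero (\<lambda>p. c *\<^sub>C \<phi> p + \<psi> p)"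
  by (intro vmero_add vmero_scale) auto

lemma vlim_lin: "vlim z \<phi> v \<Longrightarrow> vlim z \<psi> w \<Longrightarrow> vlim z (\<lambda>p. c *\<^sub>C \<phi> p + \<psi> p) (c *\<^sub>C v + w)"
  by (intro vlim_add vlim_scale) auto

context
  fixes \<alpha> \<beta> :: "'g::complex_lie_algebra mmap"
  assumes mero: "mero_map \<alpha>" "mero_map \<beta>"
begin

lemma mero_map_mlin: "mero_map (mlin c \<alpha> \<beta>)"
  and mlin_ae: "\<forall>\<^sub>F p in cofinite. val (mlin c \<alpha> \<beta>) p = c *\<^sub>C val \<alpha> p + val \<beta> p"
  and mlin_value: "\<alpha> z = Some v \<Longrightarrow> \<beta> z = Some w \<Longrightarrow> mlin c \<alpha> \<beta> z = Some (c *\<^sub>C v + w)"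
  and mero_map_mdiff: "mero_map (mdiff \<alpha> \<beta>)"
  and mdiff_ae: "\<forall>\<^sub>F p in cofinite. val (mdiff \<alpha> \<beta>) p = val \<alpha> p - val \<beta> p"
  and mero_map_mlie: "mero_map (mlie \<alpha> \<beta>)"
  and mlie_ae: "\<forall>\<^sub>F p in cofinite. val (mlie \<alpha> \<beta>) p = lie (val \<alpha> p) (val \<beta> p)"
  and mlie_value: "\<alpha> z = Some v \<Longrightarrow> \<beta> z = Some w \<Longrightarrow> mlie \<alpha> \<beta> z = Some (lie v w)"
proof -
  note vm = vmero_lin[OF mero[THEN vmero_val], of c] vmero_diff[OF mero[THEN vmero_val]]
    vmero_lie[OF mero[THEN vmero_val]]
  note [simp] = mero_map_vlim[OF mero(1)] mero_map_vlim[OF mero(2)]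
  show "mero_map (mlin c \<alpha> \<beta>)" unfolding mlin_def by (intro mero_map_mext vm)
  show "\<forall>\<^sub>F p in cofinite. val (mlin c \<alpha> \<beta>) p = c *\<^sub>C val \<alpha> p + val \<beta> p"
    unfolding mlin_def by (intro mext_ae vm)
  show "\<alpha> z = Some v \<Longrightarrow> \<beta> z = Some w \<Longrightarrow> mlin c \<alpha> \<beta> z = Some (c *\<^sub>C v + w)"
    unfolding mlin_def mext_vlim[OF vm(1)] by (simp add: vlim_lin)
  show "mero_map (mdiff \<alpha> \<beta>)" unfolding mdiff_def by (intro mero_map_mext vm)
  show "\<forall>\<^sub>F p in cofinite. val (mdiff \<alpha> \<beta>) p = val \<alpha> p - val \<beta> p"
    unfolding mdiff_def by (intro mext_ae vm)
  show "mero_map (mlie \<alpha> \<beta>)" unfolding mlie_def by (intro mero_map_mext vm)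
  show "\<forall>\<^sub>F p in cofinite. val (mlie \<alpha> \<beta>) p = lie (val \<alpha> p) (val \<beta> p)"
    unfolding mlie_def by (intro mext_ae vm)
  show "\<alpha> z = Some v \<Longrightarrow> \<beta> z = Some w \<Longrightarrow> mlie \<alpha> \<beta> z = Some (lie v w)"
    unfolding mlie_def mext_vlim[OF vm(3)] by (simp add: vlim_lie)
qed

end

lemma mconst_val [simp]: "val (mconst c) = (\<lambda>_. c)" "mconst c z = Some c"
  by (simp_all add: mconst_def fun_eq_iff)

lemma mlie_mlin_right:
  assumes "mero_map f" "mero_map \<alpha>" "mero_map \<beta>"
  shows "mlie f (mlin c \<alpha> \<beta>) = mlin c (mlie f \<alpha>) (mlie f \<beta>)"
proof (rule mero_map_eqI)
  note m = assms mero_map_mlin[OF assms(2,3), of c] mero_map_mlie[OF assms(1,2)] mero_map_mlie[OF assms(1,3)]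
  show "mero_map (mlie f (mlin c \<alpha> \<beta>))" "mero_map (mlin c (mlie f \<alpha>) (mlie f \<beta>))"
    by (intro mero_map_mlin mero_map_mlie assms)+
  show "\<forall>\<^sub>F p in cofinite. val (mlie f (mlin c \<alpha> \<beta>)) p = val (mlin c (mlie f \<alpha>) (mlie f \<beta>)) p"
    using mlie_ae[OF m(1) m(4)] mlin_ae[OF m(2,3), of c] mlin_ae[OF m(5,6), of c] mlie_ae[OF m(1,2)] mlie_ae[OF m(1,3)]
    by eventually_elim simp
qed

lemma mlie_mlin_left:
  assumes "mero_map f" "mero_map g" "mero_map \<alpha>"
  shows "mlie (mlin c f g) \<alpha> = mlin c (mlie f \<alpha>) (mlie g \<alpha>)"
proof (rule mero_map_eqI)
  note m = assms mero_map_mlin[OF assms(1,2), of c] mero_map_mlie[OF assms(1,3)] mero_map_mlie[OF assms(2,3)]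
  show "mero_map (mlie (mlin c f g) \<alpha>)" "mero_map (mlin c (mlie f \<alpha>) (mlie g \<alpha>))"
    by (intro mero_map_mlin mero_map_mlie assms)+
  show "\<forall>\<^sub>F p in cofinite. val (mlie (mlin c f g) \<alpha>) p = val (mlin c (mlie f \<alpha>) (mlie g \<alpha>)) p"
    using mlie_ae[OF m(4,3)] mlin_ae[OF m(1,2), of c] mlin_ae[OF m(5,6), of c] mlie_ae[OF m(1,3)] mlie_ae[OF m(2,3)]
    by eventually_elim simp
qed

lemma lie_leibniz: "lie a (lie b c) = lie (lie a b) c - lie (lie a c) (b::'g::complex_lie_algebra)"
proof -
  have "lie b (lie c a) = lie (lie a c) b"
    by (subst lie_anti) (subst lie_anti[of c a], simp)
  moreover have "lie c (lie a b) = - lie (lie a b) c" by (rule lie_anti)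
  ultimately show ?thesis using lie_jacobi[of a b c] by (simp add: algebra_simps)
qed

text \<open>The Jacobi identity, written with \<open>mlin (-1)\<close> because linearity of letters
  and of modes is stated for \<open>mlin\<close>.\<close>

lemma mlie_leibniz:
  assumes "mero_map f" "mero_map \<alpha>" "mero_map \<beta>"
  shows "mlie f (mlie \<alpha> \<beta>) = mlin (-1) (mlie (mlie f \<beta>) \<alpha>) (mlie (mlie f \<alpha>) \<beta>)"
proof (rule mero_map_eqI)
  note m = mero_map_mlie[OF assms(2,3)] mero_map_mlie[OF assms(1,2)] mero_map_mlie[OF assms(1,3)]
  note m' = mero_map_mlie[OF m(3) assms(2)] mero_map_mlie[OF m(2) assms(3)]
  show "mero_map (mlie f (mlie \<alpha> \<beta>))"
    "mero_map (mlin (-1) (mlie (mlie f \<beta>) \<alpha>) (mlie (mlie f \<alpha>) \<beta>))"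
    by (intro mero_map_mlin mero_map_mlie assms)+
  show "\<forall>\<^sub>F p in cofinite. val (mlie f (mlie \<alpha> \<beta>)) p =
      val (mlin (-1) (mlie (mlie f \<beta>) \<alpha>) (mlie (mlie f \<alpha>) \<beta>)) p"
    using mlie_ae[OF assms(1) m(1)] mlie_ae[OF assms(2,3)] mlin_ae[OF m', of "-1"]
      mlie_ae[OF m(3) assms(2)] mlie_ae[OF m(2) assms(3)] mlie_ae[OF assms(1,2)] mlie_ae[OF assms(1,3)]
    by eventually_elim (simp add: lie_leibniz[of "val f _"] complex_vector.scale_minus_left)
qed

definition mres :: "proj \<Rightarrow> 'g::quadratic_lie_algebra mmap \<Rightarrow> 'g mmap \<Rightarrow> complex"
  where "mres z f \<alpha> = res z (val f) (val \<alpha>)"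

lemma mres_mlin_left:
  assumes "mero_map f" "mero_map g" "mero_map \<alpha>"
  shows "mres z (mlin c f g) \<alpha> = c * mres z f \<alpha> + mres z g \<alpha>"
  unfolding mres_def res_lin_left[OF assms[THEN vmero_val], symmetric]
  using mlin_ae[OF assms(1,2)] by (intro res_cong) auto

lemma mres_mlin_right:
  assumes "mero_map f" "mero_map \<alpha>" "mero_map \<beta>"
  shows "mres z f (mlin c \<alpha> \<beta>) = c * mres z f \<alpha> + mres z f \<beta>"
  unfolding mres_def res_lin_right[OF assms[THEN vmero_val], symmetric]
  using mlin_ae[OF assms(2,3)] by (intro res_cong) auto

lemma mres_mlie:
  assumes "mero_map f" "mero_map \<alpha>" "mero_map \<beta>"
  shows "mres z f (mlie \<alpha> \<beta>) = mres z (mlie f \<alpha>) \<beta> - mres z (mlie f \<beta>) \<alpha>"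
proof -
  have "mres z f (mlie \<alpha> \<beta>) = res z (val f) (\<lambda>p. lie (val \<alpha> p) (val \<beta> p))"
    unfolding mres_def using mlie_ae[OF assms(2,3)] by (intro res_cong) auto
  moreover have "mres z (mlie f \<alpha>) \<beta> = res z (\<lambda>p. lie (val f p) (val \<alpha> p)) (val \<beta>)"
    unfolding mres_def using mlie_ae[OF assms(1,2)] by (intro res_cong) auto
  moreover have "mres z (mlie f \<beta>) \<alpha> = res z (\<lambda>p. lie (val f p) (val \<beta> p)) (val \<alpha>)"
    unfolding mres_def using mlie_ae[OF assms(1,3)] by (intro res_cong) auto
  ultimately show ?thesis using res_cocycle[OF assms[THEN vmero_val]] by simp
qed

lemma mres_regular:
  "mero_map f \<Longrightarrow> mero_map \<alpha> \<Longrightarrow> f z \<noteq> None \<Longrightarrow> \<alpha> z \<noteq> None \<Longrightarrow> mres z f \<alpha> = 0"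
  using res_regular mero_map_vlim unfolding mres_def by (metis option.exhaust)

lemma mres_mconst [simp]: "mres z f (mconst c) = 0"
  by (simp add: mres_def)


section \<open>Local computation of residues\<close>

text \<open>Models \<open>u - u z\<close> in the chart at \<open>z\<close>, so that residues can be
  computed in \<open>U\<close> instead of the chart parameter.\<close>

locale simple_zero =
  fixes U :: "complex \<Rightarrow> complex" and d :: complex
  assumes analytic: "U analytic_on {0}" and U_deriv: "(U has_field_derivative d) (at 0)"
    and zero: "U 0 = 0" and d_nonzero: "d \<noteq> 0"
begin

lemma U_meromorphic: "U meromorphic_on {0}"
  using analytic by (rule analytic_on_imp_meromorphic_on)

lemma quotient: "((\<lambda>h. U h / h) \<longlongrightarrow> d) (at 0)"
  using U_deriv by (simp add: DERIV_def zero)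

lemma eventually_nonzero: "\<forall>\<^sub>F h in at 0. U h \<noteq> 0"
proof -
  have "\<forall>\<^sub>F h in at 0. U h / h \<in> - {0}"
    using quotient d_nonzero by (intro topological_tendstoD) auto
  then show ?thesis by (rule eventually_mono) auto
qed

lemma deriv_tendsto: "(deriv U \<longlongrightarrow> d) (at 0)"
proof -
  have "isCont (deriv U) 0" using analytic analytic_deriv analytic_at_imp_isCont by blast
  then show ?thesis using DERIV_imp_deriv[OF U_deriv] by (simp add: isCont_def)
qed

lemma residue_log:
  assumes "c meromorphic_on {0}" "(c \<longlongrightarrow> c0) (at 0)"
  shows "residue (\<lambda>h. deriv U h / U h * c h) 0 = c0"
proof (rule residue_tendsto)
  show "(\<lambda>h. deriv U h / U h * c h) meromorphic_on {0}"
    by (intro meromorphic_on_mult meromorphic_on_divide meromorphic_on_deriv U_meromorphic assms)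
  have "((\<lambda>h. deriv U h / (U h / h) * c h) \<longlongrightarrow> d / d * c0) (at 0)"
    by (intro tendsto_intros deriv_tendsto quotient assms d_nonzero)
  then show "((\<lambda>h. deriv U h / U h * c h * h) \<longlongrightarrow> c0) (at 0)"
    using d_nonzero by (simp add: field_simps)
qed

lemma eventually_diff: "\<forall>\<^sub>F h in at 0. U field_differentiable at h"
  by (rule eventually_differentiable_meromorphic[OF U_meromorphic])

text \<open>For \<open>g = l + U b\<close> one has \<open>dg / U = b dU / U + db\<close>, and the
  exact term has no residue.\<close>

lemma residue_first_order:
  assumes "b meromorphic_on {0}" "(b \<longlongrightarrow> b0) (at 0)"
    and g: "\<forall>\<^sub>F k in at 0. g k = l + U k * b k"
  shows "residue (\<lambda>h. 1 / U h * deriv g h) 0 = b0"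
proof -
  have "\<forall>\<^sub>F h in at 0. 1 / U h * deriv g h = 1 * (deriv U h / U h * b h) + deriv b h"
    using eventually_at_eventually_nhds[OF g] eventually_nonzero eventually_diff
      eventually_differentiable_meromorphic[OF assms(1)]
  proof eventually_elim
    case (elim h)
    have "deriv g h = deriv (\<lambda>k. l + U k * b k) h"
      by (rule deriv_cong_ev[OF elim(1) refl])
    also have "\<dots> = U h * deriv b h + deriv U h * b h"
      using elim by (simp add: deriv_mult field_differentiable_mult)
    finally show ?case using elim(2) by (simp add: field_simps)
  qed
  then have "residue (\<lambda>h. 1 / U h * deriv g h) 0 =
    residue (\<lambda>h. 1 * (deriv U h / U h * b h) + deriv b h) 0" by (intro residue_cong) auto
  also have "\<dots> = 1 * residue (\<lambda>h. deriv U h / U h * b h) 0 + residue (deriv b) 0"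
    by (intro residue_lin_meromorphic meromorphic_on_mult meromorphic_on_divide meromorphic_on_deriv
        U_meromorphic assms)
  finally show ?thesis using residue_log[OF assms(1,2)] residue_deriv[OF assms(1)] by simp
qed

text \<open>For constant \<open>b\<close>, \<open>dg / U^2 = b d(-1 / U) + 2 c dU / U + dc\<close>;
  only the middle term has a residue.\<close>

lemma residue_second_order:
  assumes "c meromorphic_on {0}" "(c \<longlongrightarrow> c0) (at 0)"
    and g: "\<forall>\<^sub>F k in at 0. g k = l + U k * (b + U k * c k)"
  shows "residue (\<lambda>h. 1 / (U h)\<^sup>2 * deriv g h) 0 = 2 * c0"
proof -
  let ?r = "\<lambda>h. 2 * (deriv U h / U h * c h) + deriv c h"
  have "\<forall>\<^sub>F h in at 0. 1 / (U h)\<^sup>2 * deriv g h = b * deriv (\<lambda>k. - inverse (U k)) h + ?r h"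
    using eventually_at_eventually_nhds[OF g] eventually_nonzero eventually_diff
      eventually_differentiable_meromorphic[OF assms(1)]
  proof eventually_elim
    case (elim h)
    obtain U' where U': "(U has_field_derivative U') (at h)"
      using elim(3) by (auto simp: field_differentiable_def)
    obtain c' where c': "(c has_field_derivative c') (at h)"
      using elim(4) by (auto simp: field_differentiable_def)
    have "deriv g h = deriv (\<lambda>k. l + U k * (b + U k * c k)) h"
      by (rule deriv_cong_ev[OF elim(1) refl])
    also have "\<dots> = U' * (b + U h * c h) + U h * (U' * c h + U h * c')"
      by (rule DERIV_imp_deriv) (auto intro!: derivative_eq_intros U' c' simp: algebra_simps)
    finally have 1: "deriv g h = U' * (b + U h * c h) + U h * (U' * c h + U h * c')" .
    have 2: "deriv (\<lambda>k. - inverse (U k)) h = U' / (U h)\<^sup>2"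
      by (rule DERIV_imp_deriv)
        (use elim(2) in \<open>auto intro!: derivative_eq_intros U' simp: field_simps power2_eq_square\<close>)
    show ?case unfolding 1 2 DERIV_imp_deriv[OF U'] DERIV_imp_deriv[OF c']
      using elim(2) by (simp add: field_simps power2_eq_square)
  qed
  then have "residue (\<lambda>h. 1 / (U h)\<^sup>2 * deriv g h) 0 =
    residue (\<lambda>h. b * deriv (\<lambda>k. - inverse (U k)) h + ?r h) 0" by (intro residue_cong) auto
  also have "\<dots> = b * residue (deriv (\<lambda>k. - inverse (U k))) 0 + residue ?r 0"
    by (intro residue_lin_meromorphic meromorphic_intros U_meromorphic assms(1))
  also have "residue (deriv (\<lambda>k. - inverse (U k))) 0 = 0"
    by (intro residue_deriv meromorphic_intros U_meromorphic)
  also have "residue ?r 0 = 2 * residue (\<lambda>h. deriv U h / U h * c h) 0 + residue (deriv c) 0"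
    by (intro residue_lin_meromorphic meromorphic_intros U_meromorphic assms(1))
  finally show ?thesis using residue_log[OF assms(1,2)] residue_deriv[OF assms(1)] by simp
qed

text \<open>The form is exact, with primitive \<open>c / (2 U^2)\<close>.\<close>

lemma residue_frac_frac: "residue (\<lambda>h. 1 / U h * deriv (\<lambda>k. c / U k) h) 0 = 0"
proof -
  have "\<forall>\<^sub>F h in at 0. 1 / U h * deriv (\<lambda>k. c / U k) h =
    deriv (\<lambda>k. c / 2 * (inverse (U k))\<^sup>2) h"
    using eventually_nonzero eventually_diff
  proof eventually_elim
    case (elim h)
    obtain U' where U': "(U has_field_derivative U') (at h)"
      using elim(2) by (auto simp: field_differentiable_def)
    have 1: "deriv (\<lambda>k. c / U k) h = - c * U' / (U h)\<^sup>2"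
      by (rule DERIV_imp_deriv)
        (use elim(1) in \<open>auto intro!: derivative_eq_intros U' simp: field_simps power2_eq_square\<close>)
    have 2: "deriv (\<lambda>k. c / 2 * (inverse (U k))\<^sup>2) h = - c * U' / (U h)^3"
      by (rule DERIV_imp_deriv)
        (use elim(1) in \<open>auto intro!: derivative_eq_intros U' simp: field_simps power2_eq_square power3_eq_cube\<close>)
    show ?case unfolding 1 2 using elim(1) by (simp add: field_simps power2_eq_square power3_eq_cube)
  qed
  then have "residue (\<lambda>h. 1 / U h * deriv (\<lambda>k. c / U k) h) 0 =
    residue (deriv (\<lambda>k. c / 2 * (inverse (U k))\<^sup>2)) 0" by (intro residue_cong) auto
  also have "\<dots> = 0" by (intro residue_deriv meromorphic_intros U_meromorphic)
  finally show ?thesis .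
qed

end


section \<open>Divided differences\<close>

text \<open>Its value at \<open>z\<close> is the derivative of \<open>\<alpha>\<close> with respect
  to \<open>u\<close>, and that of the second iterate is half the second derivative: these are
  Taylor coefficients in the coordinate \<open>u\<close>.\<close>

definition dd :: "(proj \<Rightarrow> complex) \<Rightarrow> proj \<Rightarrow> 'g::complex_vector mmap \<Rightarrow> 'g mmap"
  where "dd u z \<alpha> = mext (\<lambda>p. (1 / (u p - u z)) *\<^sub>C (val \<alpha> p - val \<alpha> z))"

text \<open>The derivative of \<open>mfrac u z a\<close> with respect to the parameter
  \<open>u z\<close>.\<close>

definition mfrac2 :: "(proj \<Rightarrow> complex) \<Rightarrow> proj \<Rightarrow> 'g::complex_vector \<Rightarrow> 'g mmap"
  where "mfrac2 u z a = mext (\<lambda>p. (1 / (u p - u z)\<^sup>2) *\<^sub>C a)"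

context coord
begin

lemma mero_map_mfrac [intro, simp]: "mero_map (mfrac u z a)"
  and mfrac_ae: "\<forall>\<^sub>F p in cofinite. val (mfrac u z a) p = (1 / (u p - u z)) *\<^sub>C a"
  unfolding mfrac_def by (rule mero_map_mext mext_ae, rule vmero_frac, rule vmero_const)+

lemma mfrac_value:
  assumes "w \<noteq> P" "z \<noteq> P" "w \<noteq> z" shows "mfrac u z a w = Some ((1 / (u w - u z)) *\<^sub>C a)"
  unfolding mfrac_def mext_vlim[OF vmero_frac[OF vmero_const]]
  using frac_tendsto[OF assms] amero_frac by (rule vlim_scale_const[rotated])

lemma mfrac_P: "mfrac u z a P = Some 0"
  using vlim_scale_const[OF amero_frac frac_vanish, of "u z" a]
  unfolding mfrac_def mext_vlim[OF vmero_frac[OF vmero_const]] by simp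

lemma amero_frac2: "amero (\<lambda>p. 1 / (u p - u z)\<^sup>2)"
  by (intro amero_divide amero_power amero_diff amero_u) auto

lemma mero_map_mfrac2 [intro, simp]: "mero_map (mfrac2 u z a)"
  and mfrac2_ae: "\<forall>\<^sub>F p in cofinite. val (mfrac2 u z a) p = (1 / (u p - u z)\<^sup>2) *\<^sub>C a"
  unfolding mfrac2_def by (rule mero_map_mext mext_ae, rule vmero_scale_const, rule amero_frac2)+

lemma mfrac2_value:
  assumes "w \<noteq> P" "z \<noteq> P" "w \<noteq> z" shows "mfrac2 u z a w = Some ((1 / (u w - u z)\<^sup>2) *\<^sub>C a)"
proof -
  have "((\<lambda>p. (1 / (u p - u z))\<^sup>2) \<longlongrightarrow> (1 / (u w - u z))\<^sup>2) (punctured w)"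
    by (intro tendsto_intros frac_tendsto assms)
  then show ?thesis
    unfolding mfrac2_def mext_vlim[OF vmero_scale_const[OF amero_frac2]]
    by (intro vlim_scale_const amero_frac2) (simp add: power_divide)
qed

context
  fixes \<alpha> :: "'g::complex_vector mmap" and z :: proj
  assumes \<alpha>: "mero_map \<alpha>" "\<alpha> z \<noteq> None" "z \<noteq> P"
begin

lemma vmero_dd: "vmero (\<lambda>p. (1 / (u p - u z)) *\<^sub>C (val \<alpha> p - val \<alpha> z))"
  by (intro vmero_frac vmero_diff vmero_val \<alpha> vmero_const)

lemma mero_map_dd: "mero_map (dd u z \<alpha>)"
  unfolding dd_def by (rule mero_map_mext[OF vmero_dd])

lemma dd_ae: "\<forall>\<^sub>F p in cofinite. val (dd u z \<alpha>) p = (1 / (u p - u z)) *\<^sub>C (val \<alpha> p - val \<alpha> z)"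
  unfolding dd_def by (rule mext_ae[OF vmero_dd])

lemma u_neq_ae: "\<forall>\<^sub>F p in cofinite. u p \<noteq> u z"
proof -
  have "{p. u p = u z} \<subseteq> {P, z}" using u_inj \<alpha>(3) by blast
  then show ?thesis by (simp add: eventually_cofinite finite_subset)
qed

lemma dd_expand_ae: "\<forall>\<^sub>F p in cofinite. val \<alpha> p = val \<alpha> z + (u p - u z) *\<^sub>C val (dd u z \<alpha>) p"
  using dd_ae u_neq_ae by eventually_elim simp

lemma dd_regular: "dd u z \<alpha> z \<noteq> None"
proof -
  have "vlim z (val \<alpha>) (val \<alpha> z)" using \<alpha> mero_map_vlim by (metis option.exhaust_sel)
  from vlim_divided_difference[OF this \<alpha>(3)] show ?thesis
    unfolding dd_def using mext_vlim[OF vmero_dd] by blast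
qed

lemma dd_P: "\<alpha> P = Some 0 \<Longrightarrow> dd u z \<alpha> P = Some 0"
proof -
  assume "\<alpha> P = Some 0"
  then have "vlim P (val \<alpha>) 0" using \<alpha>(1) mero_map_vlim by blast
  from vlim_scale[OF vlim_diff[OF this vlim_const[of _ "val \<alpha> z"]] amero_frac frac_vanish[of 1 "u z"]]
  show ?thesis unfolding dd_def mext_vlim[OF vmero_dd] by simp
qed

lemma dd_value:
  assumes "w \<noteq> P" "w \<noteq> z" "\<alpha> w \<noteq> None"
  shows "dd u z \<alpha> w = Some ((1 / (u w - u z)) *\<^sub>C (val \<alpha> w - val \<alpha> z))"
proof -
  have "vlim w (val \<alpha>) (val \<alpha> w)" using \<alpha>(1) assms mero_map_vlim by (metis option.exhaust_sel)
  from vlim_scale[OF vlim_diff[OF this vlim_const] amero_frac frac_tendsto] assms \<alpha>(3)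
  show ?thesis unfolding dd_def mext_vlim[OF vmero_dd] by blast
qed

end

lemma simple_zero: "z \<noteq> P \<Longrightarrow> simple_zero (\<lambda>h. u (chart z h) - u z) (diff_at u z)"
  using u_chart by unfold_locales (auto intro!: analytic_intros derivative_eq_intros)

context
  fixes \<alpha> :: "'g::quadratic_lie_algebra mmap" and z :: proj
  assumes \<alpha>: "mero_map \<alpha>" "\<alpha> z \<noteq> None" "z \<noteq> P"
begin

lemma form_dd_expand:
  "\<forall>\<^sub>F h in at 0. form a (val \<alpha> (chart z h)) =
    form a (val \<alpha> z) + (u (chart z h) - u z) * form a (val (dd u z \<alpha>) (chart z h))"
  using cofinite_imp_punctured[OF dd_expand_ae[OF \<alpha>], of z] unfolding eventually_punctured
  by (rule eventually_mono) simp

lemma form_dd_tendsto: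
  "((\<lambda>h. form a (val (dd u z \<alpha>) (chart z h))) \<longlongrightarrow> form a (val (dd u z \<alpha>) z)) (at 0)"
proof -
  have "vlim z (val (dd u z \<alpha>)) (val (dd u z \<alpha>) z)"
    using dd_regular[OF \<alpha>] mero_map_vlim[OF mero_map_dd[OF \<alpha>]] by (metis option.exhaust_sel)
  from vlim_functional[OF this clin_form_right] show ?thesis by (simp add: tendsto_punctured)
qed

lemma mres_mfrac: "mres z (mfrac u z a) \<alpha> = form a (val (dd u z \<alpha>) z)"
proof -
  interpret simple_zero "\<lambda>h. u (chart z h) - u z" "diff_at u z" using \<alpha>(3) by (rule simple_zero)
  have "mres z (mfrac u z a) \<alpha> = res z (\<lambda>p. (1 / (u p - u z)) *\<^sub>C a) (val \<alpha>)"
    unfolding mres_def using mfrac_ae by (intro res_cong) auto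
  also have "\<dots> = form a (val (dd u z \<alpha>) z)"
    unfolding res_scalar_left[OF vmero_val[OF \<alpha>(1)]]
    by (rule residue_first_order[OF form_meromorphic[OF vmero_val[OF mero_map_dd[OF \<alpha>]]]
          form_dd_tendsto form_dd_expand])
  finally show ?thesis .
qed

text \<open>Together with \<open>mres_mfrac\<close> this turns the term (a, d\<alpha>(z)) in the
  recursion for \<iota> into \<open>diff_at u z\<close> times the residue in the commutator of a
  mode.\<close>

lemma diff_at_form: "diff_at (\<lambda>p. form a (val \<alpha> p)) z = diff_at u z * form a (val (dd u z \<alpha>) z)"
proof -
  have "((\<lambda>h. (u (chart z h) - u z) / h * form a (val (dd u z \<alpha>) (chart z h)))
      \<longlongrightarrow> diff_at u z * form a (val (dd u z \<alpha>) z)) (at 0)"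
    by (intro tendsto_mult u_quotient form_dd_tendsto \<alpha>)
  moreover have "\<forall>\<^sub>F h in at 0. (u (chart z h) - u z) / h * form a (val (dd u z \<alpha>) (chart z h)) =
    (form a (val \<alpha> (chart z h)) - form a (val \<alpha> z)) / h"
    using form_dd_expand[of a] by (rule eventually_mono) simp
  ultimately have "((\<lambda>h. (form a (val \<alpha> (chart z h)) - form a (val \<alpha> z)) / h)
      \<longlongrightarrow> diff_at u z * form a (val (dd u z \<alpha>) z)) (at 0)"
    by (rule Lim_transform_eventually)
  then show ?thesis
    unfolding diff_at_def by (intro DERIV_imp_deriv) (simp add: DERIV_def)
qed

end

text \<open>The residue picks out the second-order term of \<open>\<alpha>\<close> in
  \<open>u - u z\<close>; the factor 2 is that of \<open>residue_second_order\<close>.\<close>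

lemma mres_mfrac2:
  fixes \<alpha> :: "'g::quadratic_lie_algebra mmap"
  assumes \<alpha>: "mero_map \<alpha>" "\<alpha> z \<noteq> None" "z \<noteq> P"
  shows "mres z (mfrac2 u z a) \<alpha> = 2 * form a (val (dd u z (dd u z \<alpha>)) z)"
proof -
  interpret simple_zero "\<lambda>h. u (chart z h) - u z" "diff_at u z" using \<alpha>(3) by (rule simple_zero)
  note dd = mero_map_dd[OF \<alpha>] dd_regular[OF \<alpha>] \<alpha>(3)
  have "\<forall>\<^sub>F h in at 0. form a (val \<alpha> (chart z h)) = form a (val \<alpha> z) + (u (chart z h) - u z) *
    (form a (val (dd u z \<alpha>) z) + (u (chart z h) - u z) * form a (val (dd u z (dd u z \<alpha>)) (chart z h)))"
    using form_dd_expand[OF \<alpha>, of a] form_dd_expand[OF dd, of a] by eventually_elim simp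
  note * = residue_second_order[OF form_meromorphic[OF vmero_val[OF mero_map_dd[OF dd]]]
      form_dd_tendsto[OF dd] this]
  have "mres z (mfrac2 u z a) \<alpha> = res z (\<lambda>p. (1 / (u p - u z)\<^sup>2) *\<^sub>C a) (val \<alpha>)"
    unfolding mres_def using mfrac2_ae by (intro res_cong) auto
  also have "\<dots> = 2 * form a (val (dd u z (dd u z \<alpha>)) z)"
    unfolding res_scalar_left[OF vmero_val[OF \<alpha>(1)]] by (rule *)
  finally show ?thesis .
qed

text \<open>The form is exact. For this reason two modes at one point produce no central term in
  \<open>product_formula\<close>.\<close>

lemma mres_mfrac_mfrac:
  fixes a b :: "'g::quadratic_lie_algebra"
  assumes "z \<noteq> P" shows "mres z (mfrac u z a) (mfrac u z b) = 0"
proof -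
  interpret simple_zero "\<lambda>h. u (chart z h) - u z" "diff_at u z" using assms by (rule simple_zero)
  have "mres z (mfrac u z a) (mfrac u z b) =
    res z (\<lambda>p. (1 / (u p - u z)) *\<^sub>C a) (\<lambda>p. (1 / (u p - u z)) *\<^sub>C b)"
    unfolding mres_def using mfrac_ae by (intro res_cong)
  also have "\<dots> = 0"
    using residue_frac_frac[of "form a b"]
    unfolding res_scalar_left[OF vmero_frac[OF vmero_const]] by simp
  finally show ?thesis .
qed

end

lemma mlin_regular:
  fixes \<alpha> \<beta> :: "'g::complex_lie_algebra mmap"
  assumes "mero_map \<alpha>" "mero_map \<beta>" "\<alpha> z \<noteq> None" "\<beta> z \<noteq> None"
  shows "mlin c \<alpha> \<beta> z \<noteq> None"
proof -
  obtain v w where "\<alpha> z = Some v" "\<beta> z = Some w" using assms(3,4) by blast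
  from mlin_value[OF assms(1,2) this] show ?thesis by simp
qed

lemma mlie_regular:
  assumes "mero_map \<alpha>" "mero_map \<beta>" "\<alpha> z \<noteq> None" "\<beta> z \<noteq> None"
  shows "mlie \<alpha> \<beta> z \<noteq> None"
proof -
  obtain v w where "\<alpha> z = Some v" "\<beta> z = Some w" using assms(3,4) by blast
  from mlie_value[OF assms(1,2) this] show ?thesis by simp
qed

section \<open>Principal parts\<close>

text \<open>Subtracting the leading polar term lowers the bound \<open>m\<close> on the pole order
  by one.\<close>

lemma principal_part_aux:
  assumes "f meromorphic_on {0}" "((\<lambda>h. h ^ m * f h) \<longlongrightarrow> c) (at 0)"
  shows "\<exists>q l. ((\<lambda>h. f h - poly q (1 / h)) \<longlongrightarrow> l) (at 0)"
  using assms
proof (induction m arbitrary: f c)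
  case 0
  then show ?case by (intro exI[of _ 0] exI[of _ c]) simp
next
  case (Suc m)
  define g where "g h = f h - c * (1 / h) ^ Suc m" for h
  have g: "g meromorphic_on {0}"
    unfolding g_def by (intro meromorphic_intros Suc.prems(1))
  have "(\<lambda>h. h ^ Suc m * f h) meromorphic_on {0}" by (intro meromorphic_intros Suc.prems(1))
  then obtain l where l: "((\<lambda>h. (h ^ Suc m * f h - c) / h) \<longlongrightarrow> l) (at 0)"
    using Suc.prems(2) by (rule removable_quotient)
  have "\<forall>\<^sub>F h in at 0. (h ^ Suc m * f h - c) / h = h ^ m * g h"
    by (auto simp: eventually_at_filter g_def field_simps intro!: always_eventually)
  with l have "((\<lambda>h. h ^ m * g h) \<longlongrightarrow> l) (at 0)" by (rule Lim_transform_eventually)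
  from Suc.IH[OF g this] obtain q l' where "((\<lambda>h. g h - poly q (1 / h)) \<longlongrightarrow> l') (at 0)" by blast
  then have "((\<lambda>h. f h - poly (q + monom c (Suc m)) (1 / h)) \<longlongrightarrow> l') (at 0)"
    by (simp add: g_def poly_monom algebra_simps)
  then show ?case by blast
qed

lemma scalar_principal_part:
  assumes "amero f"
  obtains q l where "((\<lambda>p. f p - poly q (kfun z p)) \<longlongrightarrow> l) (punctured z)"
proof -
  obtain F where F: "(\<lambda>h. f (chart z h)) has_laurent_expansion F"
    using assms by (auto simp: amero_def meromorphic_at_0)
  define m where "m = nat (- fls_subdegree F)"
  have "(\<lambda>h. h ^ m * f (chart z h)) has_laurent_expansion fls_X ^ m * F"
    by (intro laurent_expansion_intros F)
  moreover have "fls_subdegree (fls_X ^ m * F) \<ge> 0"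
    by (cases "F = 0") (auto simp: m_def fls_subdegree_mult fls_subdegree_pow)
  ultimately obtain c where "((\<lambda>h. h ^ m * f (chart z h)) \<longlongrightarrow> c) (at 0)"
    using Laurent_tendsto_iff by blast
  from principal_part_aux[OF amero_meromorphic[OF assms] this] show thesis
    using that by (auto simp: tendsto_punctured kfun_chart)
qed

text \<open>On the projective line every polar part at \<open>z\<close> is realized by a global
  function without other poles, namely a polynomial in \<open>kfun z\<close>.\<close>

lemma vmero_principal_part:
  assumes "vmero \<phi>"
  shows "\<exists>\<psi>. vmero \<psi> \<and> (\<forall>w. w \<noteq> z \<longrightarrow> (\<exists>v. vlim w \<psi> v)) \<and> (\<exists>v. vlim z (\<lambda>p. \<phi> p - \<psi> p) v)"
  using assms
proof (induction rule: vmero.induct)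
  case vmero_zero
  then show ?case by (intro exI[of _ "\<lambda>_. 0"]) (auto intro: vmero.vmero_zero vlim_zero)
next
  case (vmero_term f \<phi> a)
  then obtain \<psi> v where \<psi>: "vmero \<psi>" "\<And>w. w \<noteq> z \<Longrightarrow> \<exists>v. vlim w \<psi> v" "vlim z (\<lambda>p. \<phi> p - \<psi> p) v"
    by blast
  obtain q l where q: "((\<lambda>p. f p - poly q (kfun z p)) \<longlongrightarrow> l) (punctured z)"
    using vmero_term(1) by (rule scalar_principal_part)
  have am: "amero (\<lambda>p. poly q (kfun z p))" by (rule amero_poly[OF amero_kfun])
  show ?case
  proof (intro exI[of _ "\<lambda>p. poly q (kfun z p) *\<^sub>C a + \<psi> p"] conjI allI impI)
    show "vmero (\<lambda>p. poly q (kfun z p) *\<^sub>C a + \<psi> p)" using am \<psi>(1) by (rule vmero.vmero_term)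
    fix w assume w: "w \<noteq> z"
    have "((\<lambda>p. poly q (kfun z p)) \<longlongrightarrow> poly q (kfun z w)) (punctured w)"
      by (rule isCont_tendsto_compose[OF poly_isCont kfun_tendsto[OF w]])
    then show "\<exists>v. vlim w (\<lambda>p. poly q (kfun z p) *\<^sub>C a + \<psi> p) v"
      using \<psi>(2)[OF w] am vlim_term by blast
  next
    have "vlim z (\<lambda>p. (f p - poly q (kfun z p)) *\<^sub>C a + (\<phi> p - \<psi> p)) (l *\<^sub>C a + v)"
      using vmero_term(1) am q \<psi>(3) by (intro vlim_term amero_diff)
    then show "\<exists>v. vlim z (\<lambda>p. f p *\<^sub>C a + \<phi> p - (poly q (kfun z p) *\<^sub>C a + \<psi> p)) v"
      by (auto simp: add_diff_add complex_vector.scale_left_diff_distrib)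
  qed
next
  case (vmero_cong \<phi> \<phi>')
  then obtain \<psi> v where \<psi>: "vmero \<psi>" "\<And>w. w \<noteq> z \<Longrightarrow> \<exists>v. vlim w \<psi> v" "vlim z (\<lambda>p. \<phi> p - \<psi> p) v"
    by blast
  have "vlim z (\<lambda>p. \<phi>' p - \<psi> p) v"
    by (rule vlim_cong[OF \<psi>(3)]) (use vmero_cong.hyps(2) in \<open>auto elim: eventually_mono\<close>)
  with \<psi> show ?case by blast
qed

text \<open>No normalization at a base point is imposed, so \<open>F\<close> is fixed up to a
  constant map only. \<open>pp\<close> picks one, and \<open>vac_mconst\<close> makes the choice
  immaterial.\<close>

definition is_pp :: "proj \<Rightarrow> 'g::complex_lie_algebra mmap \<Rightarrow> 'g mmap \<Rightarrow> bool"
  where "is_pp z f F \<longleftrightarrow> mero_map F \<and> (\<forall>w. w \<noteq> z \<longrightarrow> F w \<noteq> None) \<and>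
    (\<exists>v. vlim z (\<lambda>p. val f p - val F p) v)"

definition pp :: "proj \<Rightarrow> 'g::complex_lie_algebra mmap \<Rightarrow> 'g mmap"
  where "pp z f = (SOME F. is_pp z f F)"

lemma is_pp_pp:
  assumes "mero_map f" shows "is_pp z f (pp z f)"
proof -
  obtain \<psi> v where \<psi>: "vmero \<psi>" "\<And>w. w \<noteq> z \<Longrightarrow> \<exists>v. vlim w \<psi> v" "vlim z (\<lambda>p. val f p - \<psi> p) v"
    using vmero_principal_part[OF vmero_val[OF assms]] by blast
  have "is_pp z f (mext \<psi>)" unfolding is_pp_def
  proof (intro conjI allI impI)
    show "mext \<psi> w \<noteq> None" if "w \<noteq> z" for w using \<psi>(2)[OF that] mext_vlim[OF \<psi>(1)] by auto
    have "vlim z (\<lambda>p. val f p - val (mext \<psi>) p) v"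
      by (rule vlim_cong[OF \<psi>(3)]) (use mext_ae[OF \<psi>(1)] in \<open>auto elim: eventually_mono\<close>)
    then show "\<exists>v. vlim z (\<lambda>p. val f p - val (mext \<psi>) p) v" ..
  qed (rule mero_map_mext[OF \<psi>(1)])
  then show ?thesis unfolding pp_def by (rule someI[of "is_pp z f"])
qed

text \<open>The difference \<open>F - G\<close> is regular at \<open>z\<close>, where the polar
  parts cancel, and everywhere else; Liouville applies.\<close>

lemma is_pp_unique:
  assumes "is_pp z f F" "is_pp z f G"
  shows "\<exists>c. mlin (-1) G F = mconst c"
proof (rule regular_imp_mconst)
  have m: "mero_map G" "mero_map F" using assms by (auto simp: is_pp_def)
  then show "mero_map (mlin (-1) G F)" by (rule mero_map_mlin)
  fix w
  show "mlin (-1) G F w \<noteq> None"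
  proof (cases "w = z")
    case True
    obtain v v' where "vlim z (\<lambda>p. val f p - val F p) v" "vlim z (\<lambda>p. val f p - val G p) v'"
      using assms by (auto simp: is_pp_def)
    from vlim_diff[OF this(2,1)] have *: "vlim z (\<lambda>p. val F p - val G p) (v' - v)" by simp
    have "vlim z (val (mlin (-1) G F)) (v' - v)"
      by (rule vlim_cong[OF *])
        (use mlin_ae[OF m, of "-1"] in \<open>auto elim!: eventually_mono simp: complex_vector.scale_minus_left\<close>)
    then have "mlin (-1) G F z = Some (v' - v)" using mero_map_vlim mero_map_mlin[OF m] by blast
    then show ?thesis using True by simp
  next
    case False
    then show ?thesis using assms by (intro mlin_regular m) (auto simp: is_pp_def)
  qed
qed

lemma is_pp_mlin:
  assumes "is_pp z f F" "is_pp z g G" "mero_map f" "mero_map g"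
  shows "is_pp z (mlin c f g) (mlin c F G)"
proof -
  have m: "mero_map F" "mero_map G" using assms by (auto simp: is_pp_def)
  obtain v v' where "vlim z (\<lambda>p. val f p - val F p) v" "vlim z (\<lambda>p. val g p - val G p) v'"
    using assms by (auto simp: is_pp_def)
  from vlim_lin[OF this, of c]
  have "vlim z (\<lambda>p. val (mlin c f g) p - val (mlin c F G) p) (c *\<^sub>C v + v')"
  proof (rule vlim_cong)
    show "\<forall>\<^sub>F p in cofinite. c *\<^sub>C (val f p - val F p) + (val g p - val G p) =
        val (mlin c f g) p - val (mlin c F G) p"
      using mlin_ae[OF m, of c] mlin_ae[OF assms(3,4), of c]
      by eventually_elim (simp add: complex_vector.scale_right_diff_distrib)
  qed
  moreover have "mlin c F G w \<noteq> None" if "w \<noteq> z" for w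
    using that assms by (intro mlin_regular m) (auto simp: is_pp_def)
  ultimately show ?thesis using mero_map_mlin[OF m] by (auto simp: is_pp_def)
qed

lemma is_pp_self:
  assumes "mero_map f" "\<And>w. w \<noteq> z \<Longrightarrow> f w \<noteq> None" shows "is_pp z f f"
  using assms vlim_const[of z 0] by (auto simp: is_pp_def)

lemma is_pp_regular:
  assumes "mero_map f" "f z \<noteq> None" shows "is_pp z f (mconst 0)"
  using assms mero_map_vlim[OF assms(1)] by (auto simp: is_pp_def)

section \<open>The induced module\<close>

lemma clin_comp: "clin S \<Longrightarrow> clin T \<Longrightarrow> clin (\<lambda>x. S (T x))"
  by (simp add: clin_def)

lemma clin_fun:
  "clin S \<Longrightarrow> clin T \<Longrightarrow> clin (\<lambda>x. S x + T x)"
  "clin S \<Longrightarrow> clin T \<Longrightarrow> clin (\<lambda>x. S x - T x)"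
  "clin S \<Longrightarrow> clin (\<lambda>x. c *\<^sub>C S x)"
  by (simp_all add: clin_def complex_vector.scale_right_diff_distrib scaleC_add_right mult.commute
      add_diff_add add.assoc add.left_commute)

lemma clin_lin: "clin T \<Longrightarrow> T (c *\<^sub>C x + y) = c *\<^sub>C T x + T y"
  by (simp add: clin_def)

lemma lin_ext_superset:
  assumes "finite S" "Poly_Mapping.keys x \<subseteq> S"
  shows "lin_ext \<phi> x = (\<Sum>k\<in>S. Poly_Mapping.lookup x k *\<^sub>C \<phi> (fst k) (snd k))"
  unfolding lin_ext_def using assms
  by (intro sum.mono_neutral_left) (auto simp: in_keys_iff)

lemma clin_lin_ext: "clin (lin_ext \<phi> :: ('a, 'b) ivec \<Rightarrow> _)"
  unfolding clin_def
proof (intro allI)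
  fix c and x y :: "('a, 'b) ivec"
  let ?S = "Poly_Mapping.keys x \<union> Poly_Mapping.keys y"
  have sub: "Poly_Mapping.keys (c *\<^sub>C x + y) \<subseteq> ?S"
    by (auto simp: in_keys_iff lookup_add lookup_scaleC)
  have *: "lin_ext \<phi> z = (\<Sum>k\<in>?S. Poly_Mapping.lookup z k *\<^sub>C \<phi> (fst k) (snd k))"
    if "Poly_Mapping.keys z \<subseteq> ?S" for z
    using that by (intro lin_ext_superset) auto
  show "lin_ext \<phi> (c *\<^sub>C x + y) = c *\<^sub>C lin_ext \<phi> x + lin_ext \<phi> y"
    by (subst (1 2 3) *)
      (use sub in \<open>auto simp: lookup_add lookup_scaleC scaleC_add_left complex_vector.scale_sum_right
        sum.distrib[symmetric]\<close>)
qed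

lemma lin_ext_bas [simp]: "lin_ext \<phi> (bas xs w) = \<phi> xs w"
  by (simp add: lin_ext_def bas_def)

lemma ivec_expand: "x = (\<Sum>k\<in>Poly_Mapping.keys x. Poly_Mapping.lookup x k *\<^sub>C bas (fst k) (snd k))"
proof (rule poly_mapping_eqI)
  fix i
  have "(\<Sum>k\<in>Poly_Mapping.keys x. Poly_Mapping.lookup (Poly_Mapping.lookup x k *\<^sub>C bas (fst k) (snd k)) i)
    = (\<Sum>k\<in>Poly_Mapping.keys x. if k = i then Poly_Mapping.lookup x i else 0)"
    by (intro sum.cong) (auto simp: lookup_scaleC bas_def lookup_single when_def)
  then show "Poly_Mapping.lookup x i = Poly_Mapping.lookup
      (\<Sum>k\<in>Poly_Mapping.keys x. Poly_Mapping.lookup x k *\<^sub>C bas (fst k) (snd k)) i"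
    by (simp add: lookup_sum in_keys_iff)
qed

lemma vecs_iff: "x \<in> vecs n W L \<longleftrightarrow> (\<forall>k. Poly_Mapping.lookup x k \<noteq> 0 \<longrightarrow> k \<in> lists L \<times> tuples n W)"
  by (simp only: vecs_def mem_Collect_eq subset_iff in_keys_iff)

lemma csubspace_vecs: "csubspace (vecs n W L)"
proof (rule complex_vector.subspaceI)
  fix x y :: "('a, 'b) ivec"
  assume *: "x \<in> vecs n W L" "y \<in> vecs n W L"
  have "Poly_Mapping.lookup x k \<noteq> 0 \<or> Poly_Mapping.lookup y k \<noteq> 0"
    if "Poly_Mapping.lookup (x + y) k \<noteq> 0" for k using that by (auto simp: lookup_add)
  with * show "x + y \<in> vecs n W L" unfolding vecs_iff by blast
next
  fix c and x :: "('a, 'b) ivec"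
  assume *: "x \<in> vecs n W L"
  have "Poly_Mapping.lookup x k \<noteq> 0"
    if "Poly_Mapping.lookup (c *\<^sub>C x) k \<noteq> 0" for k using that by (auto simp: lookup_scaleC)
  with * show "c *\<^sub>C x \<in> vecs n W L" unfolding vecs_iff by blast
qed (simp add: vecs_iff)

lemma bas_in_vecs [intro, simp]: "xs \<in> lists L \<Longrightarrow> w \<in> tuples n W \<Longrightarrow> bas xs w \<in> vecs n W L"
  by (auto simp: vecs_def bas_def)

lemma vecs_mono: "L \<subseteq> L' \<Longrightarrow> vecs n W L \<subseteq> vecs n W L'"
  unfolding vecs_def using lists_mono by fastforce

lemma vecs_induct [consumes 1, case_names zero lin]:
  assumes x: "x \<in> vecs n W L"
    and zero: "Q 0"
    and lin: "\<And>c xs w y. xs \<in> lists L \<Longrightarrow> w \<in> tuples n W \<Longrightarrow> Q y \<Longrightarrow> Q (c *\<^sub>C bas xs w + y)"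
  shows "Q x"
proof -
  have "Q (\<Sum>k\<in>K. Poly_Mapping.lookup x k *\<^sub>C bas (fst k) (snd k))"
    if "finite K" "K \<subseteq> Poly_Mapping.keys x" for K
    using that x by (induction rule: finite_induct) (auto simp: vecs_def intro!: zero lin)
  from this[of "Poly_Mapping.keys x"] show ?thesis by (subst ivec_expand) simp
qed

lemma clin_vecs:
  assumes "clin T" "\<And>xs w. xs \<in> lists L \<Longrightarrow> w \<in> tuples n W \<Longrightarrow> T (bas xs w) \<in> S" "csubspace S"
    "x \<in> vecs n W L"
  shows "T x \<in> S"
  using assms(4)
  by (induction rule: vecs_induct)
    (use assms in \<open>auto simp: clin_zero clin_lin complex_vector.subspace_0
      intro!: complex_vector.subspace_add complex_vector.subspace_scale\<close>)

lemma clin_eq_vecs: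
  assumes "clin S" "clin T" "\<And>xs w. xs \<in> lists L \<Longrightarrow> w \<in> tuples n W \<Longrightarrow> S (bas xs w) = T (bas xs w)"
    "x \<in> vecs n W L"
  shows "S x = T x"
  using assms(4) by (induction rule: vecs_induct) (use assms in \<open>auto simp: clin_zero clin_lin\<close>)

lemma clin_lmult: "clin (lmult \<alpha>)"
  unfolding lmult_def by (rule clin_lin_ext)

lemma lmult_bas [simp]: "lmult \<alpha> (bas xs w) = bas (\<alpha> # xs) w"
  by (simp add: lmult_def)

lemma lmult_vecs: "\<alpha> \<in> L \<Longrightarrow> x \<in> vecs n W L \<Longrightarrow> lmult \<alpha> x \<in> vecs n W L"
  by (rule clin_vecs[OF clin_lmult _ csubspace_vecs]) auto

text \<open>A linear projection whose kernel is a given subspace turns congruence into equality.\<close>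

lemma projection_with_kernel:
  fixes N :: "'v::complex_vector set"
  assumes "csubspace N"
  obtains T :: "'v \<Rightarrow> 'v" where "clin T" "\<And>x. T x = 0 \<longleftrightarrow> x \<in> N"
proof -
  obtain B where B: "B \<subseteq> N" "\<not> cdependent B" "N \<subseteq> cspan B"
    using complex_vector.maximal_independent_subset[of N] by blast
  define E where "E = complex_vector.extend_basis B"
  have E: "B \<subseteq> E" "\<not> cdependent E" "cspan E = UNIV"
    using B(2) by (simp_all add: E_def complex_vector.extend_basis_superset
        complex_vector.independent_extend_basis)
  obtain T :: "'v \<Rightarrow> 'v" where "Vector_Spaces.linear scaleC scaleC T"
    and T: "\<forall>b\<in>E. T b = (if b \<in> B then 0 else b)"
    using complex_pair.linear_independent_extend[OF E(2), of "\<lambda>b. if b \<in> B then 0 else b"] by blast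
  then have lin: "clin T" by (simp add: clin_imp_linear)
  have ker: "T x = 0" if "x \<in> cspan B" for x
    using that
    by (induction rule: complex_vector.span_induct_alt)
      (use T E(1) in \<open>auto simp: clin_zero[OF lin] clin_lin[OF lin]\<close>)
  have id: "T x = x" if "x \<in> cspan (E - B)" for x
    using that
    by (induction rule: complex_vector.span_induct_alt)
      (use T in \<open>auto simp: clin_zero[OF lin] clin_lin[OF lin]\<close>)
  have "T x = 0 \<longleftrightarrow> x \<in> N" for x
  proof
    assume "T x = 0"
    have "x \<in> cspan (B \<union> (E - B))" using E by (simp add: Un_absorb1)
    then obtain b c where bc: "x = b + c" "b \<in> cspan B" "c \<in> cspan (E - B)"
      unfolding complex_vector.span_Un by blast
    with \<open>T x = 0\<close> have "c = 0" by (simp add: clin_add[OF lin] ker id)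
    moreover have "cspan B \<subseteq> N" using B(1) assms by (rule complex_vector.span_minimal)
    ultimately show "x \<in> N" using bc by auto
  next
    assume "x \<in> N" with B(3) ker show "T x = 0" by blast
  qed
  with lin show thesis by (rule that)
qed

section \<open>The relations and the classes modulo them\<close>

lemma all_maps_iff: "\<alpha> \<in> all_maps \<longleftrightarrow> mero_map \<alpha>"
  by (simp add: all_maps_def)

lemma relatorI:
  "\<alpha> \<in> L \<Longrightarrow> \<beta> \<in> L \<Longrightarrow> xs \<in> lists L \<Longrightarrow> ys \<in> lists L \<Longrightarrow> w \<in> tuples n W \<Longrightarrow>
    bas (xs @ [mlin c \<alpha> \<beta>] @ ys) w - c *\<^sub>C bas (xs @ [\<alpha>] @ ys) w - bas (xs @ [\<beta>] @ ys) w
      \<in> relators n W \<rho> L"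
  "\<alpha> \<in> L \<Longrightarrow> \<beta> \<in> L \<Longrightarrow> xs \<in> lists L \<Longrightarrow> ys \<in> lists L \<Longrightarrow> w \<in> tuples n W \<Longrightarrow>
    bas (xs @ [\<alpha>, \<beta>] @ ys) w - bas (xs @ [\<beta>, \<alpha>] @ ys) w - bas (xs @ [mlie \<alpha> \<beta>] @ ys) w
      \<in> relators n W \<rho> L"
  "k < n \<Longrightarrow> a \<in> W k \<Longrightarrow> b \<in> W k \<Longrightarrow> xs \<in> lists L \<Longrightarrow> w \<in> tuples n W \<Longrightarrow>
    bas xs (w(k := c *\<^sub>C a + b)) - c *\<^sub>C bas xs (w(k := a)) - bas xs (w(k := b)) \<in> relators n W \<rho> L"
  "mconst v \<in> L \<Longrightarrow> xs \<in> lists L \<Longrightarrow> w \<in> tuples n W \<Longrightarrow>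
    bas (xs @ [mconst v]) w - (\<Sum>k<n. bas xs (w(k := \<rho> k v (w k)))) \<in> relators n W \<rho> L"
  subgoal unfolding relators_def by (rule UnI1, rule UnI1, rule UnI1, rule CollectI, (rule exI)+, rule conjI, rule refl, intro conjI) assumption+
  subgoal unfolding relators_def by (rule UnI1, rule UnI1, rule UnI2, rule CollectI, (rule exI)+, rule conjI, rule refl, intro conjI) assumption+
  subgoal unfolding relators_def by (rule UnI1, rule UnI2, rule CollectI, (rule exI)+, rule conjI, rule refl, intro conjI) assumption+
  subgoal unfolding relators_def by (rule UnI2, rule CollectI, (rule exI)+, rule conjI, rule refl, intro conjI) assumption+
  done

lemma relator_cases [consumes 1]:
  assumes "r \<in> relators n W \<rho> L"
  obtains (letter) c \<beta> \<gamma> xs ys w where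
    "r = bas (xs @ [mlin c \<beta> \<gamma>] @ ys) w - c *\<^sub>C bas (xs @ [\<beta>] @ ys) w - bas (xs @ [\<gamma>] @ ys) w"
      "\<beta> \<in> L" "\<gamma> \<in> L" "xs \<in> lists L" "ys \<in> lists L" "w \<in> tuples n W"
  | (bracket) \<beta> \<gamma> xs ys w where
    "r = bas (xs @ [\<beta>, \<gamma>] @ ys) w - bas (xs @ [\<gamma>, \<beta>] @ ys) w - bas (xs @ [mlie \<beta> \<gamma>] @ ys) w"
      "\<beta> \<in> L" "\<gamma> \<in> L" "xs \<in> lists L" "ys \<in> lists L" "w \<in> tuples n W"
  | (vector) c a b k xs w where
    "r = bas xs (w(k := c *\<^sub>C a + b)) - c *\<^sub>C bas xs (w(k := a)) - bas xs (w(k := b))"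
      "k < n" "a \<in> W k" "b \<in> W k" "xs \<in> lists L" "w \<in> tuples n W"
  | (const) c xs w where "r = bas (xs @ [mconst c]) w - (\<Sum>k<n. bas xs (w(k := \<rho> k c (w k))))"
      "mconst c \<in> L" "xs \<in> lists L" "w \<in> tuples n W"
  using assms unfolding relators_def
  by (elim UnE CollectE exE conjE) (rule that; assumption)+

locale tensor_rep =
  fixes n :: nat
    and W :: "nat \<Rightarrow> 'w::complex_vector set"
    and \<rho> :: "nat \<Rightarrow> 'g::quadratic_lie_algebra \<Rightarrow> 'w \<Rightarrow> 'w"
    and \<zeta> :: "nat \<Rightarrow> proj"
  assumes rep: "\<And>k. k < n \<Longrightarrow> is_rep (W k) (\<rho> k)"
begin

lemma rep_closed: "k < n \<Longrightarrow> x \<in> W k \<Longrightarrow> \<rho> k a x \<in> W k"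
  and rep_lin_vec: "k < n \<Longrightarrow> x \<in> W k \<Longrightarrow> y \<in> W k \<Longrightarrow> \<rho> k a (c *\<^sub>C x + y) = c *\<^sub>C \<rho> k a x + \<rho> k a y"
  and rep_lin: "k < n \<Longrightarrow> x \<in> W k \<Longrightarrow> \<rho> k (c *\<^sub>C a + b) x = c *\<^sub>C \<rho> k a x + \<rho> k b x"
  and rep_lie: "k < n \<Longrightarrow> x \<in> W k \<Longrightarrow> \<rho> k (lie a b) x = \<rho> k a (\<rho> k b x) - \<rho> k b (\<rho> k a x)"
  using rep unfolding is_rep_def by blast+

lemma tuples_upd: "w \<in> tuples n W \<Longrightarrow> k < n \<Longrightarrow> x \<in> W k \<Longrightarrow> w(k := x) \<in> tuples n W"
  by (auto simp: tuples_def PiE_iff extensional_def)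

lemma tuples_component: "w \<in> tuples n W \<Longrightarrow> k < n \<Longrightarrow> w k \<in> W k"
  by (auto simp: tuples_def)

lemma tuples_rep: "w \<in> tuples n W \<Longrightarrow> k < n \<Longrightarrow> w(k := \<rho> k a (w k)) \<in> tuples n W"
  by (intro tuples_upd rep_closed tuples_component)

definition null :: "('g, 'w) ivec set"
  where "null = cspan (relators n W \<rho> all_maps)"

text \<open>A linear map with kernel \<open>null\<close>: congruence modulo the relations becomes an
  equation between values of \<open>cls\<close> (\<open>equiv_iff\<close>), accessible to
  rewriting.\<close>

definition cls :: "('g, 'w) ivec \<Rightarrow> ('g, 'w) ivec"
  where "cls = (SOME T. clin T \<and> (\<forall>x. T x = 0 \<longleftrightarrow> x \<in> null))"

lemma clin_cls: "clin cls" and cls_eq_0_iff: "cls x = 0 \<longleftrightarrow> x \<in> null"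
proof -
  have "csubspace null" unfolding null_def by (rule complex_vector.subspace_span)
  then obtain T :: "('g, 'w) ivec \<Rightarrow> ('g, 'w) ivec" where "clin T \<and> (\<forall>x. T x = 0 \<longleftrightarrow> x \<in> null)"
    by (rule projection_with_kernel) blast
  then have "clin cls \<and> (\<forall>x. cls x = 0 \<longleftrightarrow> x \<in> null)" unfolding cls_def
    by (rule someI[of "\<lambda>T. clin T \<and> (\<forall>x. T x = 0 \<longleftrightarrow> x \<in> null)"])
  then show "clin cls" "cls x = 0 \<longleftrightarrow> x \<in> null" by blast+
qed

lemmas cls_linear [simp] = clin_add[OF clin_cls] clin_scale[OF clin_cls] clin_zero[OF clin_cls]
  clin_diff[OF clin_cls] clin_uminus[OF clin_cls] clin_sum[OF clin_cls]

lemma equiv_iff: "equiv_mod n W \<rho> all_maps x y \<longleftrightarrow> cls x = cls y"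
  using cls_eq_0_iff[of "x - y"] by (simp add: equiv_mod_def null_def)

lemma clin_cls_lmult: "clin (\<lambda>x. cls (lmult \<alpha> x))"
  by (rule clin_comp[OF clin_cls clin_lmult])

abbreviation Vec where "Vec \<equiv> vecs n W all_maps"

lemma relator_null: "r \<in> relators n W \<rho> all_maps \<Longrightarrow> cls r = 0"
  unfolding cls_eq_0_iff null_def by (rule complex_vector.span_base)

lemma cls_mlin:
  assumes "mero_map \<alpha>" "mero_map \<beta>" "x \<in> Vec"
  shows "cls (lmult (mlin c \<alpha> \<beta>) x) = c *\<^sub>C cls (lmult \<alpha> x) + cls (lmult \<beta> x)"
proof (rule clin_eq_vecs[OF _ _ _ assms(3)])
  show "clin (\<lambda>x. cls (lmult (mlin c \<alpha> \<beta>) x))" "clin (\<lambda>x. c *\<^sub>C cls (lmult \<alpha> x) + cls (lmult \<beta> x))"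
    by (intro clin_cls_lmult clin_fun)+
  fix xs :: "'g mmap list" and w :: "nat \<Rightarrow> 'w" assume *: "xs \<in> lists all_maps" "w \<in> tuples n W"
  have "bas ([] @ [mlin c \<alpha> \<beta>] @ xs) w - c *\<^sub>C bas ([] @ [\<alpha>] @ xs) w - bas ([] @ [\<beta>] @ xs) w
      \<in> relators n W \<rho> all_maps"
    by (rule relatorI) (use * assms(1,2) in \<open>auto simp: all_maps_iff\<close>)
  from relator_null[OF this]
  show "cls (lmult (mlin c \<alpha> \<beta>) (bas xs w)) = c *\<^sub>C cls (lmult \<alpha> (bas xs w)) + cls (lmult \<beta> (bas xs w))"
    by (simp add: algebra_simps)
qed

lemma cls_mlie:
  assumes "mero_map \<alpha>" "mero_map \<beta>" "x \<in> Vec"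
  shows "cls (lmult (mlie \<alpha> \<beta>) x) = cls (lmult \<alpha> (lmult \<beta> x)) - cls (lmult \<beta> (lmult \<alpha> x))"
proof (rule clin_eq_vecs[OF _ _ _ assms(3)])
  show "clin (\<lambda>x. cls (lmult (mlie \<alpha> \<beta>) x))"
    "clin (\<lambda>x. cls (lmult \<alpha> (lmult \<beta> x)) - cls (lmult \<beta> (lmult \<alpha> x)))"
    by (intro clin_cls_lmult clin_comp[OF clin_cls clin_comp[OF clin_lmult clin_lmult]] clin_fun)+
  fix xs :: "'g mmap list" and w :: "nat \<Rightarrow> 'w" assume *: "xs \<in> lists all_maps" "w \<in> tuples n W"
  have "bas ([] @ [\<alpha>, \<beta>] @ xs) w - bas ([] @ [\<beta>, \<alpha>] @ xs) w - bas ([] @ [mlie \<alpha> \<beta>] @ xs) w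
      \<in> relators n W \<rho> all_maps"
    by (rule relatorI) (use * assms(1,2) in \<open>auto simp: all_maps_iff\<close>)
  from relator_null[OF this]
  show "cls (lmult (mlie \<alpha> \<beta>) (bas xs w)) =
      cls (lmult \<alpha> (lmult \<beta> (bas xs w))) - cls (lmult \<beta> (lmult \<alpha> (bas xs w)))"
    by (simp add: algebra_simps)
qed

lemma cls_tuple_lin:
  assumes "k < n" "a \<in> W k" "b \<in> W k" "xs \<in> lists all_maps" "w \<in> tuples n W"
  shows "cls (bas xs (w(k := c *\<^sub>C a + b))) = c *\<^sub>C cls (bas xs (w(k := a))) + cls (bas xs (w(k := b)))"
proof -
  have "bas xs (w(k := c *\<^sub>C a + b)) - c *\<^sub>C bas xs (w(k := a)) - bas xs (w(k := b))
      \<in> relators n W \<rho> all_maps"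
    using assms by (rule relatorI)
  from relator_null[OF this] show ?thesis by (simp add: algebra_simps)
qed

lemma cls_tuple_diff:
  assumes "k < n" "a \<in> W k" "b \<in> W k" "w \<in> tuples n W"
  shows "cls (bas [] (w(k := a - b))) = cls (bas [] (w(k := a))) - cls (bas [] (w(k := b)))"
  using cls_tuple_lin[OF assms(1) assms(3,2) _ assms(4), of "[]" "-1"]
  by (simp add: complex_vector.scale_minus_left)

lemma cls_mconst:
  assumes "w \<in> tuples n W"
  shows "cls (bas [mconst c] w) = (\<Sum>k<n. cls (bas [] (w(k := \<rho> k c (w k)))))"
proof -
  have "bas ([] @ [mconst c]) w - (\<Sum>k<n. bas [] (w(k := \<rho> k c (w k)))) \<in> relators n W \<rho> all_maps"
    by (rule relatorI) (use assms in \<open>auto simp: all_maps_iff\<close>)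
  from relator_null[OF this] show ?thesis by simp
qed

text \<open>Each kind of relation admits an arbitrary word in front, and a further letter only
  lengthens it.\<close>

lemma lmult_relator:
  assumes "\<alpha> \<in> all_maps" "r \<in> relators n W \<rho> all_maps"
  shows "lmult \<alpha> r \<in> relators n W \<rho> all_maps"
proof -
  note [simp] = clin_diff[OF clin_lmult] clin_scale[OF clin_lmult] clin_sum[OF clin_lmult]
  have Cons: "\<alpha> # xs \<in> lists all_maps" if "xs \<in> lists all_maps" for xs using that assms(1) by simp
  from assms(2) show ?thesis
  proof (cases rule: relator_cases)
    case (letter c \<beta> \<gamma> xs ys w)
    then have "lmult \<alpha> r = bas ((\<alpha> # xs) @ [mlin c \<beta> \<gamma>] @ ys) w - c *\<^sub>C bas ((\<alpha> # xs) @ [\<beta>] @ ys) w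
      - bas ((\<alpha> # xs) @ [\<gamma>] @ ys) w" by simp
    then show ?thesis using letter Cons by (simp only: relatorI)
  next
    case (bracket \<beta> \<gamma> xs ys w)
    then have "lmult \<alpha> r = bas ((\<alpha> # xs) @ [\<beta>, \<gamma>] @ ys) w - bas ((\<alpha> # xs) @ [\<gamma>, \<beta>] @ ys) w
      - bas ((\<alpha> # xs) @ [mlie \<beta> \<gamma>] @ ys) w" by simp
    then show ?thesis using bracket Cons by (simp only: relatorI)
  next
    case (vector c a b k xs w)
    then have "lmult \<alpha> r = bas (\<alpha> # xs) (w(k := c *\<^sub>C a + b)) - c *\<^sub>C bas (\<alpha> # xs) (w(k := a))
      - bas (\<alpha> # xs) (w(k := b))" by simp
    then show ?thesis using vector Cons by (simp only: relatorI)
  next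
    case (const c xs w)
    then have "lmult \<alpha> r = bas ((\<alpha> # xs) @ [mconst c]) w - (\<Sum>k<n. bas (\<alpha> # xs) (w(k := \<rho> k c (w k))))"
      by simp
    then show ?thesis using const Cons by (simp only: relatorI)
  qed
qed

lemma clin_null:
  assumes "clin T" "\<And>r. r \<in> relators n W \<rho> all_maps \<Longrightarrow> T r \<in> null" "x \<in> null"
  shows "T x \<in> null"
  using assms(3) unfolding null_def
proof (induction rule: complex_vector.span_induct_alt)
  case base
  then show ?case by (simp add: clin_zero[OF assms(1)] complex_vector.span_zero)
next
  case (step c r y)
  then show ?case
    using assms(2) unfolding clin_lin[OF assms(1)] null_def
    by (intro complex_vector.span_add complex_vector.span_scale) auto
qed

lemma lmult_null: "mero_map \<alpha> \<Longrightarrow> x \<in> null \<Longrightarrow> lmult \<alpha> x \<in> null"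
  by (rule clin_null[OF clin_lmult])
    (auto simp: null_def all_maps_iff intro!: complex_vector.span_base lmult_relator)

lemma lmult_cong:
  assumes "mero_map \<alpha>" "cls x = cls y" shows "cls (lmult \<alpha> x) = cls (lmult \<alpha> y)"
proof -
  have "x - y \<in> null" using assms(2) by (simp add: cls_eq_0_iff[symmetric])
  from lmult_null[OF assms(1) this] show ?thesis
    by (simp add: cls_eq_0_iff[symmetric] clin_diff[OF clin_lmult])
qed

end

section \<open>Mode operators\<close>

lemma clin_ident: "clin (\<lambda>x. x)"
  by (simp add: clin_def)

context tensor_rep
begin

text \<open>The part of \<open>F\<close> that acts at the adjoined vacuum: left multiplication by a
  global map stands for its action at all points together, and the actions at the nodes are taken
  away.\<close>

definition vac :: "'g mmap \<Rightarrow> (nat \<Rightarrow> 'w) \<Rightarrow> ('g, 'w) ivec"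
  where "vac F w = bas [F] w - (\<Sum>k<n. bas [] (w(k := \<rho> k (val F (\<zeta> k)) (w k))))"

fun mode_word :: "proj \<Rightarrow> 'g mmap \<Rightarrow> 'g mmap list \<Rightarrow> (nat \<Rightarrow> 'w) \<Rightarrow> ('g, 'w) ivec"
  where
    "mode_word z f [] w = vac (pp z f) w"
  | "mode_word z f (\<alpha> # xs) w =
      lmult \<alpha> (mode_word z f xs w) + mode_word z (mlie f \<alpha>) xs w - mres z f \<alpha> *\<^sub>C bas xs w"

definition mode :: "proj \<Rightarrow> 'g mmap \<Rightarrow> ('g, 'w) ivec \<Rightarrow> ('g, 'w) ivec"
  where "mode z f = lin_ext (mode_word z f)"

lemma clin_mode: "clin (mode z f)"
  unfolding mode_def by (rule clin_lin_ext)

lemmas mode_linear [simp] = clin_add[OF clin_mode] clin_scale[OF clin_mode] clin_zero[OF clin_mode]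
  clin_diff[OF clin_mode] clin_sum[OF clin_mode]

lemmas lmult_linear [simp] = clin_add[OF clin_lmult] clin_scale[OF clin_lmult] clin_zero[OF clin_lmult]
  clin_diff[OF clin_lmult] clin_sum[OF clin_lmult]

lemma mode_bas [simp]: "mode z f (bas xs w) = mode_word z f xs w"
  by (simp add: mode_def)

lemma Vec_closed [intro]:
  "0 \<in> Vec" "x \<in> Vec \<Longrightarrow> y \<in> Vec \<Longrightarrow> x + y \<in> Vec" "x \<in> Vec \<Longrightarrow> y \<in> Vec \<Longrightarrow> x - y \<in> Vec"
  "x \<in> Vec \<Longrightarrow> c *\<^sub>C x \<in> Vec" "(\<And>i. i \<in> I \<Longrightarrow> g i \<in> Vec) \<Longrightarrow> (\<Sum>i\<in>I. g i) \<in> Vec"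
  "mero_map \<alpha> \<Longrightarrow> x \<in> Vec \<Longrightarrow> lmult \<alpha> x \<in> Vec"
  using csubspace_vecs[of n W all_maps]
  by (auto simp: all_maps_iff intro!: complex_vector.subspace_0 complex_vector.subspace_add
      complex_vector.subspace_diff complex_vector.subspace_scale complex_vector.subspace_sum lmult_vecs)

lemma mode_lmult:
  assumes "x \<in> Vec"
  shows "mode z f (lmult \<alpha> x) = lmult \<alpha> (mode z f x) + mode z (mlie f \<alpha>) x - mres z f \<alpha> *\<^sub>C x"
  by (rule clin_eq_vecs[OF _ _ _ assms])
    (auto intro!: clin_fun clin_comp[OF clin_mode clin_lmult] clin_comp[OF clin_lmult clin_mode] clin_mode
      clin_ident)

lemma vac_Vec: "mero_map F \<Longrightarrow> w \<in> tuples n W \<Longrightarrow> vac F w \<in> Vec"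
  unfolding vac_def by (intro Vec_closed bas_in_vecs) (auto simp: all_maps_iff tuples_rep)

lemma mero_map_pp: "mero_map f \<Longrightarrow> mero_map (pp z f)"
  using is_pp_pp[of f z] by (simp add: is_pp_def)

lemma mode_word_Vec: "mero_map f \<Longrightarrow> xs \<in> lists all_maps \<Longrightarrow> w \<in> tuples n W \<Longrightarrow> mode_word z f xs w \<in> Vec"
proof (induction xs arbitrary: f)
  case Nil
  then show ?case by (simp add: vac_Vec mero_map_pp)
next
  case (Cons \<alpha> xs)
  then have "mero_map \<alpha>" "xs \<in> lists all_maps" by (auto simp: all_maps_iff)
  with Cons show ?case by (auto intro!: Vec_closed Cons.IH mero_map_mlie)
qed

lemma mode_Vec: "mero_map f \<Longrightarrow> x \<in> Vec \<Longrightarrow> mode z f x \<in> Vec"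
  by (rule clin_vecs[OF clin_mode _ csubspace_vecs]) (auto intro: mode_word_Vec)

definition off_nodes :: "'g mmap \<Rightarrow> bool"
  where "off_nodes F \<longleftrightarrow> mero_map F \<and> (\<forall>k<n. F (\<zeta> k) \<noteq> None)"

lemma vac_mlin:
  assumes "off_nodes F" "off_nodes G" "w \<in> tuples n W"
  shows "cls (vac (mlin c F G) w) = c *\<^sub>C cls (vac F w) + cls (vac G w)"
proof -
  have m: "mero_map F" "mero_map G" using assms by (simp_all add: off_nodes_def)
  have "cls (bas [] (w(k := \<rho> k (val (mlin c F G) (\<zeta> k)) (w k)))) =
    c *\<^sub>C cls (bas [] (w(k := \<rho> k (val F (\<zeta> k)) (w k)))) + cls (bas [] (w(k := \<rho> k (val G (\<zeta> k)) (w k))))"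
    if k: "k < n" for k
  proof -
    have "F (\<zeta> k) \<noteq> None" "G (\<zeta> k) \<noteq> None" using assms(1,2) k by (simp_all add: off_nodes_def)
    then obtain a b where ab: "F (\<zeta> k) = Some a" "G (\<zeta> k) = Some b" by blast
    have wk: "w k \<in> W k" using assms(3) k by (rule tuples_component)
    show ?thesis
      using cls_tuple_lin[OF k rep_closed[OF k wk] rep_closed[OF k wk] _ assms(3), of "[]" c a b]
      by (simp add: ab mlin_value[OF m ab] rep_lin[OF k wk])
  qed
  moreover have "cls (bas [mlin c F G] w) = c *\<^sub>C cls (bas [F] w) + cls (bas [G] w)"
    using cls_mlin[OF m, of "bas [] w" c] assms(3) by simp
  ultimately show ?thesis
    by (simp add: vac_def sum.distrib complex_vector.scale_sum_right complex_vector.scale_right_diff_distrib)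
qed

text \<open>A constant passes through the tensor sign and becomes the sum of its actions at the
  nodes, which is just what \<open>vac\<close> subtracts.\<close>

lemma vac_mconst: "w \<in> tuples n W \<Longrightarrow> cls (vac (mconst c) w) = 0"
  by (simp add: vac_def cls_mconst)

lemma vac_tuple_lin:
  assumes F: "mero_map F" and k: "k < n" "a \<in> W k" "b \<in> W k" and w: "w \<in> tuples n W"
  shows "cls (vac F (w(k := c *\<^sub>C a + b))) = c *\<^sub>C cls (vac F (w(k := a))) + cls (vac F (w(k := b)))"
proof -
  let ?u = "\<lambda>v j. (w(k := v))(j := \<rho> j (val F (\<zeta> j)) ((w(k := v)) j))"
  have "cls (bas [] (?u (c *\<^sub>C a + b) j)) = c *\<^sub>C cls (bas [] (?u a j)) + cls (bas [] (?u b j))"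
    if j: "j < n" for j
  proof (cases "j = k")
    case True
    then show ?thesis
      using cls_tuple_lin[OF k(1) rep_closed[OF k(1,2), of "val F (\<zeta> k)"]
          rep_closed[OF k(1,3), of "val F (\<zeta> k)"] _ w, of "[]" c] k
      by (simp add: rep_lin_vec)
  next
    case False
    have "?u v j = (w(j := \<rho> j (val F (\<zeta> j)) (w j)))(k := v)" for v
      using False by (auto simp: fun_eq_iff)
    then show ?thesis using cls_tuple_lin[OF k _ tuples_rep[OF w j, of "val F (\<zeta> j)"], of "[]" c] by simp
  qed
  moreover have "cls (bas [F] (w(k := c *\<^sub>C a + b))) = c *\<^sub>C cls (bas [F] (w(k := a))) + cls (bas [F] (w(k := b)))"
    using F by (intro cls_tuple_lin k w) (simp add: all_maps_iff)
  ultimately show ?thesis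
    by (simp add: vac_def sum.distrib complex_vector.scale_sum_right complex_vector.scale_right_diff_distrib
        del: fun_upd_apply fun_upd_upd)
qed

text \<open>Compatibility of a mode with the passage of \<open>c\<close> through the tensor sign:
  the left side is the mode applied before \<open>c\<close> is absorbed, the right side after.
  Actions at different nodes commute; at a single node the commutator of \<open>F(\<zeta> k)\<close>
  and \<open>c\<close> is the value of \<open>mlie F (mconst c)\<close> there.\<close>

lemma vac_mlie_mconst:
  assumes F: "off_nodes F" and w: "w \<in> tuples n W"
  shows "cls (lmult (mconst c) (vac F w)) + cls (vac (mlie F (mconst c)) w) =
    (\<Sum>k<n. cls (vac F (w(k := \<rho> k c (w k)))))"
proof -
  have mF: "mero_map F" using F by (simp add: off_nodes_def)
  let ?F = "\<lambda>k. val F (\<zeta> k)"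
  let ?c = "\<lambda>k w. w(k := \<rho> k c (w k))" and ?f = "\<lambda>k w. w(k := \<rho> k (?F k) (w k))"
  have t: "?c k w \<in> tuples n W" "?f k w \<in> tuples n W" if "k < n" for k
    using tuples_rep[OF w that] by blast+
  have e1: "cls (lmult (mconst c) (vac F w)) = cls (bas [mconst c, F] w) - (\<Sum>k<n. \<Sum>j<n. cls (bas [] (?c j (?f k w))))"
    using t by (simp add: vac_def cls_mconst del: fun_upd_apply)
  have e2: "cls (vac (mlie F (mconst c)) w) = cls (bas [F, mconst c] w) - cls (bas [mconst c, F] w)
    - (\<Sum>k<n. cls (bas [] (?f k (?c k w))) - cls (bas [] (?c k (?f k w))))"
  proof -
    have "cls (bas [] (w(k := \<rho> k (val (mlie F (mconst c)) (\<zeta> k)) (w k)))) =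
      cls (bas [] (?f k (?c k w))) - cls (bas [] (?c k (?f k w)))" if k: "k < n" for k
    proof -
      obtain a where a: "F (\<zeta> k) = Some a" using F k by (auto simp: off_nodes_def)
      have wk: "w k \<in> W k" using w k by (rule tuples_component)
      show ?thesis
        using cls_tuple_diff[OF k rep_closed[OF k rep_closed[OF k wk]] rep_closed[OF k rep_closed[OF k wk]] w,
            of a c c a]
        by (simp add: mlie_value[OF mF mero_map_mconst a mconst_val(2)] a rep_lie[OF k wk])
    qed
    moreover have "cls (bas [mlie F (mconst c)] w) = cls (bas [F, mconst c] w) - cls (bas [mconst c, F] w)"
      using cls_mlie[OF mF mero_map_mconst, of "bas [] w" c] w by simp
    ultimately show ?thesis by (simp add: vac_def del: fun_upd_apply)
  qed
  have e3: "cls (bas [F, mconst c] w) = (\<Sum>k<n. cls (bas [F] (?c k w)))"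
  proof -
    have "cls (lmult F (bas [mconst c] w)) = cls (lmult F (\<Sum>k<n. bas [] (?c k w)))"
      using w by (intro lmult_cong mF) (simp add: cls_mconst)
    then show ?thesis by simp
  qed
  \<comment> \<open>Only the terms \<open>j = k\<close> of the double sums survive, since operators
    on different tensor factors commute.\<close>
  have e4: "(\<Sum>k<n. \<Sum>j<n. cls (bas [] (?f j (?c k w)))) - (\<Sum>k<n. \<Sum>j<n. cls (bas [] (?c j (?f k w))))
    = (\<Sum>k<n. cls (bas [] (?f k (?c k w))) - cls (bas [] (?c k (?f k w))))"
  proof -
    have "(\<Sum>k<n. \<Sum>j<n. cls (bas [] (?f j (?c k w)))) = (\<Sum>k<n. \<Sum>j<n. cls (bas [] (?f k (?c j w))))"
      by (rule sum.swap)
    moreover have "(\<Sum>j<n. cls (bas [] (?f k (?c j w))) - cls (bas [] (?c j (?f k w)))) =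
      cls (bas [] (?f k (?c k w))) - cls (bas [] (?c k (?f k w)))" if "k < n" for k
    proof -
      have "?f k (?c j w) = ?c j (?f k w)" if "j \<noteq> k" for j using that by (auto simp: fun_eq_iff)
      then have "(\<Sum>j<n. cls (bas [] (?f k (?c j w))) - cls (bas [] (?c j (?f k w)))) =
        (\<Sum>j<n. if j = k then cls (bas [] (?f k (?c k w))) - cls (bas [] (?c k (?f k w))) else 0)"
        by (intro sum.cong) (auto simp del: fun_upd_apply)
      then show ?thesis using that by simp
    qed
    ultimately show ?thesis by (simp add: sum_subtractf[symmetric] del: fun_upd_apply)
  qed
  have e5: "(\<Sum>k<n. cls (vac F (?c k w))) =
    (\<Sum>k<n. cls (bas [F] (?c k w))) - (\<Sum>k<n. \<Sum>j<n. cls (bas [] (?f j (?c k w))))"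
    by (simp add: vac_def sum_subtractf del: fun_upd_apply)
  show ?thesis unfolding e1 e2 e3 e5 e4[symmetric] by (simp del: fun_upd_apply)
qed

lemma is_pp_mlie_mconst:
  assumes "is_pp z f F" "mero_map f" shows "is_pp z (mlie f (mconst c)) (mlie F (mconst c))"
proof -
  have F: "mero_map F" using assms by (simp add: is_pp_def)
  obtain v where "vlim z (\<lambda>p. val f p - val F p) v" using assms by (auto simp: is_pp_def)
  from vlim_clin[OF clin_lie_left this, of c]
  have "vlim z (\<lambda>p. val (mlie f (mconst c)) p - val (mlie F (mconst c)) p) (lie v c)"
  proof (rule vlim_cong)
    show "\<forall>\<^sub>F p in cofinite. lie (val f p - val F p) c =
        val (mlie f (mconst c)) p - val (mlie F (mconst c)) p"
      using mlie_ae[OF F mero_map_mconst, of c] mlie_ae[OF assms(2) mero_map_mconst, of c]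
      by eventually_elim simp
  qed
  moreover have "mlie F (mconst c) w \<noteq> None" if "w \<noteq> z" for w
    using that assms by (intro mlie_regular F) (auto simp: is_pp_def)
  ultimately show ?thesis using mero_map_mlie[OF F mero_map_mconst] by (auto simp: is_pp_def)
qed

end

locale mode_point = tensor_rep n W \<rho> \<zeta>
  for n :: nat and W :: "nat \<Rightarrow> 'w::complex_vector set"
    and \<rho> :: "nat \<Rightarrow> 'g::quadratic_lie_algebra \<Rightarrow> 'w \<Rightarrow> 'w" and \<zeta> :: "nat \<Rightarrow> proj" +
  fixes z :: proj
  assumes z: "\<And>k. k < n \<Longrightarrow> \<zeta> k \<noteq> z"
begin

lemma is_pp_off_nodes: "is_pp z f F \<Longrightarrow> off_nodes F"
  using z by (auto simp: is_pp_def off_nodes_def)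

lemma mode_nil:
  assumes "mero_map f" "is_pp z f G" "w \<in> tuples n W"
  shows "cls (mode_word z f [] w) = cls (vac G w)"
proof -
  note pp = is_pp_pp[OF assms(1), of z]
  obtain c where c: "mlin (-1) G (pp z f) = mconst c" using is_pp_unique[OF pp assms(2)] by blast
  have "cls (vac (mlin (-1) G (pp z f)) w) = 0" unfolding c using assms(3) by (rule vac_mconst)
  then show ?thesis
    using vac_mlin[OF is_pp_off_nodes[OF assms(2)] is_pp_off_nodes[OF pp] assms(3), of "-1"]
    by (simp add: complex_vector.scale_minus_left)
qed

lemma mode_mlin_word:
  "mero_map f \<Longrightarrow> mero_map g \<Longrightarrow> xs \<in> lists all_maps \<Longrightarrow> w \<in> tuples n W \<Longrightarrow>
    cls (mode_word z (mlin c f g) xs w) = c *\<^sub>C cls (mode_word z f xs w) + cls (mode_word z g xs w)"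
proof (induction xs arbitrary: f g)
  case Nil
  note pp = is_pp_pp[OF Nil(1), of z] is_pp_pp[OF Nil(2), of z]
  have "cls (mode_word z (mlin c f g) [] w) = cls (vac (mlin c (pp z f) (pp z g)) w)"
    using Nil pp by (intro mode_nil mero_map_mlin is_pp_mlin)
  also have "\<dots> = c *\<^sub>C cls (vac (pp z f) w) + cls (vac (pp z g) w)"
    using Nil pp by (intro vac_mlin is_pp_off_nodes) auto
  finally show ?case by simp
next
  case (Cons \<alpha> xs)
  then have \<alpha>: "mero_map \<alpha>" "xs \<in> lists all_maps" by (auto simp: all_maps_iff)
  have "cls (lmult \<alpha> (mode_word z (mlin c f g) xs w)) =
      cls (lmult \<alpha> (c *\<^sub>C mode_word z f xs w + mode_word z g xs w))"
    using Cons \<alpha> by (intro lmult_cong) auto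
  then show ?case
    using Cons \<alpha>
    by (simp add: mlie_mlin_left mero_map_mlie mres_mlin_left scaleC_add_left scaleC_add_right
        complex_vector.scale_right_diff_distrib algebra_simps)
qed

lemma mode_mlin:
  assumes "mero_map f" "mero_map g" "x \<in> Vec"
  shows "cls (mode z (mlin c f g) x) = c *\<^sub>C cls (mode z f x) + cls (mode z g x)"
  by (rule clin_eq_vecs[OF _ _ _ assms(3)])
    (auto intro!: clin_fun clin_comp[OF clin_cls clin_mode] simp: mode_mlin_word assms(1,2))

text \<open>The principal part of a regular \<open>f\<close> is 0, brackets with regular letters
  stay regular, and their residues vanish. With a letter singular at \<open>z\<close> the second
  step fails; that failure is the correction in \<open>coordinate_change\<close>.\<close>

lemma mode_regular_word:
  "f \<in> regular_at z \<Longrightarrow> xs \<in> lists (regular_at z) \<Longrightarrow> w \<in> tuples n W \<Longrightarrow> cls (mode_word z f xs w) = 0"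
proof (induction xs arbitrary: f)
  case Nil
  then show ?case
    using mode_nil[OF _ is_pp_regular] vac_mconst by (auto simp: regular_at_def)
next
  case (Cons \<alpha> xs)
  then have *: "mero_map \<alpha>" "\<alpha> z \<noteq> None" "mero_map f" "f z \<noteq> None" "xs \<in> lists (regular_at z)"
    by (auto simp: regular_at_def)
  then have "mlie f \<alpha> \<in> regular_at z"
    using mlie_regular[of f \<alpha> z] by (simp add: regular_at_def mero_map_mlie)
  moreover have "cls (lmult \<alpha> (mode_word z f xs w)) = cls (lmult \<alpha> 0)"
    using Cons * by (intro lmult_cong) auto
  ultimately show ?case using Cons * by (simp add: mres_regular)
qed

lemma mode_regular:
  assumes "f \<in> regular_at z" "x \<in> vecs n W (regular_at z)" shows "cls (mode z f x) = 0"
  by (rule clin_eq_vecs[OF clin_comp[OF clin_cls clin_mode] _ _ assms(2)])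
    (auto simp: clin_def mode_regular_word assms(1))

text \<open>Requiring all modes to vanish at once makes the set stable under left multiplication,
  because commuting \<open>mode z f\<close> past a letter yields the mode of another map. A relation
  then has to be tested only with its prefix removed.\<close>

definition kernel :: "('g, 'w) ivec set"
  where "kernel = {x \<in> Vec. cls x = 0 \<and> (\<forall>f. mero_map f \<longrightarrow> cls (mode z f x) = 0)}"

lemma kernel_lmult:
  assumes "mero_map \<alpha>" "x \<in> kernel" shows "lmult \<alpha> x \<in> kernel"
proof -
  have x: "x \<in> Vec" "cls x = 0" "\<And>f. mero_map f \<Longrightarrow> cls (mode z f x) = 0"
    using assms(2) by (auto simp: kernel_def)
  have "cls (lmult \<alpha> (mode z f x)) = 0" if "mero_map f" for f
    using lmult_cong[OF assms(1), of "mode z f x" 0] x(3)[OF that] by simp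
  moreover have "cls (lmult \<alpha> x) = 0" using lmult_cong[OF assms(1), of x 0] x(2) by simp
  ultimately show ?thesis
    using x assms(1) by (auto simp: kernel_def mode_lmult mero_map_mlie)
qed

lemma kernel_prefix: "xs \<in> lists all_maps \<Longrightarrow> x \<in> kernel \<Longrightarrow> foldr lmult xs x \<in> kernel"
  by (induction xs) (auto simp: all_maps_iff intro: kernel_lmult)

lemma foldr_lmult_bas: "foldr lmult xs (bas ys w) = bas (xs @ ys) w"
  by (induction xs) auto

lemma clin_foldr_lmult: "clin (foldr lmult xs)"
  by (induction xs) (auto simp: clin_def)

lemmas foldr_lmult_linear = clin_diff[OF clin_foldr_lmult] clin_scale[OF clin_foldr_lmult]
  clin_sum[OF clin_foldr_lmult] foldr_lmult_bas

lemma kernelI: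
  assumes "x \<in> Vec" "cls x = 0" "\<And>f. mero_map f \<Longrightarrow> cls (mode z f x) = 0" shows "x \<in> kernel"
  using assms by (simp add: kernel_def)

text \<open>For the bracket relation the nested brackets recombine by the Jacobi identity
  (\<open>mlie_leibniz\<close>) and the residues by the cocycle property (\<open>mres_mlie\<close>);
  the relation for constants rests on \<open>vac_mlie_mconst\<close>.\<close>

lemma relator_kernel:
  assumes "r \<in> relators n W \<rho> all_maps" shows "r \<in> kernel"
  using assms
proof (cases rule: relator_cases)
  case (letter c \<beta> \<gamma> xs ys w)
  let ?X = "bas ys w"
  have m: "mero_map \<beta>" "mero_map \<gamma>" "?X \<in> Vec" using letter by (auto simp: all_maps_iff)
  let ?r = "lmult (mlin c \<beta> \<gamma>) ?X - c *\<^sub>C lmult \<beta> ?X - lmult \<gamma> ?X"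
  have "?r \<in> kernel"
  proof (rule kernelI)
    show "?r \<in> Vec" using m by (intro Vec_closed mero_map_mlin)
    show "cls ?r = 0" using cls_mlin[OF m, of c] by (simp del: lmult_bas)
    fix f :: "'g mmap" assume f: "mero_map f"
    show "cls (mode z f ?r) = 0"
      using cls_mlin[OF m(1,2) mode_Vec[OF f m(3)], of c z]
        mode_mlin[OF mero_map_mlie[OF f m(1)] mero_map_mlie[OF f m(2)] m(3), of c]
      by (simp add: mode_lmult[OF m(3)] mlie_mlin_right[OF f m(1,2)] mres_mlin_right[OF f m(1,2)]
          scaleC_add_left scaleC_add_right complex_vector.scale_right_diff_distrib
          del: lmult_bas mode_bas)
  qed
  then have "foldr lmult xs ?r \<in> kernel" using letter by (intro kernel_prefix)
  then show ?thesis using letter by (simp add: foldr_lmult_linear)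
next
  case (bracket \<beta> \<gamma> xs ys w)
  let ?X = "bas ys w"
  have m: "mero_map \<beta>" "mero_map \<gamma>" "?X \<in> Vec" using bracket by (auto simp: all_maps_iff)
  let ?r = "lmult \<beta> (lmult \<gamma> ?X) - lmult \<gamma> (lmult \<beta> ?X) - lmult (mlie \<beta> \<gamma>) ?X"
  have "?r \<in> kernel"
  proof (rule kernelI)
    show "?r \<in> Vec" using m by (intro Vec_closed mero_map_mlie)
    show "cls ?r = 0" using cls_mlie[OF m] by (simp del: lmult_bas)
    fix f :: "'g mmap" assume f: "mero_map f"
    note fm = mero_map_mlie[OF f m(1)] mero_map_mlie[OF f m(2)]
    have V: "lmult \<beta> ?X \<in> Vec" "lmult \<gamma> ?X \<in> Vec"
      using m by (simp_all add: Vec_closed(6) del: lmult_bas)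
    show "cls (mode z f ?r) = 0"
      using cls_mlie[OF m(1,2) mode_Vec[OF f m(3)], of z]
        mode_mlin[OF mero_map_mlie[OF fm(2) m(1)] mero_map_mlie[OF fm(1) m(2)] m(3), of "-1"]
      by (simp add: mode_lmult[OF m(3)] mode_lmult[OF V(1)] mode_lmult[OF V(2)] mlie_leibniz[OF f m(1,2)]
          mres_mlie[OF f m(1,2)] complex_vector.scale_left_diff_distrib
          complex_vector.scale_minus_left
          del: lmult_bas mode_bas)
  qed
  then have "foldr lmult xs ?r \<in> kernel" using bracket by (intro kernel_prefix)
  then show ?thesis using bracket by (simp add: foldr_lmult_linear)
next
  case (vector c a b k xs w)
  let ?r = "bas [] (w(k := c *\<^sub>C a + b)) - c *\<^sub>C bas [] (w(k := a)) - bas [] (w(k := b))"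
  have W: "c *\<^sub>C a + b \<in> W k"
    using rep[OF vector(2)] vector(3,4) unfolding is_rep_def
    by (intro complex_vector.subspace_add complex_vector.subspace_scale) auto
  have "?r \<in> kernel"
  proof (rule kernelI)
    show "?r \<in> Vec" using vector W by (intro Vec_closed bas_in_vecs tuples_upd) auto
    show "cls ?r = 0" using cls_tuple_lin[OF vector(2-4) _ vector(6), of "[]" c] by simp
    fix f :: "'g mmap" assume f: "mero_map f"
    show "cls (mode z f ?r) = 0"
      using vac_tuple_lin[OF mero_map_pp[OF f] vector(2-4) vector(6), of z c] by simp
  qed
  then have "foldr lmult xs ?r \<in> kernel" using vector by (intro kernel_prefix)
  then show ?thesis using vector by (simp add: foldr_lmult_linear)
next
  case (const c xs w)
  let ?r = "lmult (mconst c) (bas [] w) - (\<Sum>k<n. bas [] (w(k := \<rho> k c (w k))))"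
  have X: "bas [] w \<in> Vec" using const by auto
  have "?r \<in> kernel"
  proof (rule kernelI)
    show "?r \<in> Vec" using const by (intro Vec_closed bas_in_vecs tuples_rep X) auto
    show "cls ?r = 0" using cls_mconst[OF const(4)] by simp
    fix f :: "'g mmap" assume f: "mero_map f"
    note pp = is_pp_pp[OF f, of z]
    \<comment> \<open>The bracket of a principal part with a constant is a principal part of the
      bracket, and \<open>mode_nil\<close> admits any choice of one.\<close>
    have "cls (mode_word z (mlie f (mconst c)) [] w) = cls (vac (mlie (pp z f) (mconst c)) w)"
      using f pp const by (intro mode_nil mero_map_mlie is_pp_mlie_mconst) auto
    then show "cls (mode z f ?r) = 0"
      using vac_mlie_mconst[OF is_pp_off_nodes[OF pp] const(4), of c]
      by (simp add: mode_lmult[OF X] del: lmult_bas)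
  qed
  then have "foldr lmult xs ?r \<in> kernel" using const by (intro kernel_prefix)
  then show ?thesis using const by (simp add: foldr_lmult_linear)
qed

lemma mode_cong:
  assumes "mero_map f" "cls x = cls y" shows "cls (mode z f x) = cls (mode z f y)"
proof -
  have "x - y \<in> null" using assms(2) by (simp add: cls_eq_0_iff[symmetric])
  then have "mode z f (x - y) \<in> null"
  proof (rule clin_null[OF clin_mode, rotated])
    fix r assume "r \<in> relators n W \<rho> all_maps"
    then have "r \<in> kernel" by (rule relator_kernel)
    then show "mode z f r \<in> null" using assms(1) by (simp add: kernel_def cls_eq_0_iff)
  qed
  then show ?thesis by (simp add: cls_eq_0_iff[symmetric])
qed

text \<open>A mode depends on the polar part only, as long as the words are regular at
  \<open>z\<close>. This lets \<open>du / (u - u z)\<close> replace the inverse of the chart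
  parameter.\<close>

lemma mode_cong_regular:
  assumes "mero_map f" "mero_map g" "x \<in> vecs n W (regular_at z)" "vlim z (\<lambda>p. val f p - val g p) v"
  shows "cls (mode z f x) = cls (mode z g x)"
proof -
  have V: "x \<in> Vec" using assms(3) vecs_mono[of "regular_at z" all_maps n W]
    by (auto simp: regular_at_def all_maps_def)
  have "vlim z (val (mlin (-1) g f)) v"
    by (rule vlim_cong[OF assms(4)])
      (use mlin_ae[OF assms(2,1), of "-1"] in \<open>auto elim!: eventually_mono simp: complex_vector.scale_minus_left\<close>)
  then have "mlin (-1) g f \<in> regular_at z"
    using mero_map_vlim[OF mero_map_mlin[OF assms(2,1), of "-1"], of z v] mero_map_mlin[OF assms(2,1)]
    by (simp add: regular_at_def)
  from mode_regular[OF this assms(3)] show ?thesis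
    using mode_mlin[OF assms(2,1) V, of "-1"] by (simp add: complex_vector.scale_minus_left)
qed

end

section \<open>The field in a coordinate\<close>

context tensor_rep
begin

lemma rep_zero: "k < n \<Longrightarrow> x \<in> W k \<Longrightarrow> \<rho> k 0 x = 0"
  using rep_lin[of k x 1 0 0] by simp

lemma rep_scale: "k < n \<Longrightarrow> x \<in> W k \<Longrightarrow> \<rho> k (c *\<^sub>C a) x = c *\<^sub>C \<rho> k a x"
  using rep_lin[of k x c a 0] by (simp add: rep_zero)

lemma W_zero: "k < n \<Longrightarrow> 0 \<in> W k"
  using rep unfolding is_rep_def by (blast intro: complex_vector.subspace_0)

lemma cls_tuple_scale:
  assumes "k < n" "a \<in> W k" "w \<in> tuples n W"
  shows "cls (bas [] (w(k := c *\<^sub>C a))) = c *\<^sub>C cls (bas [] (w(k := a)))"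
proof -
  have "cls (bas [] (w(k := 0))) = 0"
    using cls_tuple_lin[OF assms(1) W_zero W_zero _ assms(3), of "[]" 1] assms(1) by simp
  then show ?thesis
    using cls_tuple_lin[OF assms(1,2) W_zero _ assms(3), of "[]" c] assms(1) by simp
qed

lemma vecs_regular_Vec: "x \<in> vecs n W (regular_at z) \<Longrightarrow> x \<in> Vec"
  using vecs_mono[of "regular_at z" all_maps n W] by (auto simp: regular_at_def all_maps_def)

end

locale field_coord = tensor_rep n W \<rho> \<zeta> + coord u P
  for n :: nat and W :: "nat \<Rightarrow> 'w::complex_vector set"
    and \<rho> :: "nat \<Rightarrow> 'g::quadratic_lie_algebra \<Rightarrow> 'w \<Rightarrow> 'w" and \<zeta> :: "nat \<Rightarrow> proj"
    and u :: "proj \<Rightarrow> complex" and P :: proj +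
  assumes P: "\<And>k. k < n \<Longrightarrow> \<zeta> k \<noteq> P"
begin

definition vanreg :: "proj \<Rightarrow> 'g mmap set"
  where "vanreg z = vanishing_at P \<inter> regular_at z"

lemma vanregD: "\<alpha> \<in> vanreg z \<Longrightarrow> mero_map \<alpha>" "\<alpha> \<in> vanreg z \<Longrightarrow> \<alpha> z \<noteq> None" "\<alpha> \<in> vanreg z \<Longrightarrow> \<alpha> P = Some 0"
  by (auto simp: vanreg_def vanishing_at_def regular_at_def)

lemma vanregI: "mero_map \<alpha> \<Longrightarrow> \<alpha> z \<noteq> None \<Longrightarrow> \<alpha> P = Some 0 \<Longrightarrow> \<alpha> \<in> vanreg z"
  by (auto simp: vanreg_def vanishing_at_def regular_at_def)

lemma vanreg_regular: "x \<in> vecs n W (vanreg z) \<Longrightarrow> x \<in> vecs n W (regular_at z)"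
  using vecs_mono[of "vanreg z" "regular_at z" n W] by (auto simp: vanreg_def)

lemma vanreg_Vec: "x \<in> vecs n W (vanreg z) \<Longrightarrow> x \<in> Vec"
  by (intro vecs_regular_Vec vanreg_regular)

lemma mfrac2_P: "mfrac2 u z a P = Some 0"
proof -
  have "((\<lambda>p. 1 / (u p - u z)\<^sup>2) \<longlongrightarrow> 0) (punctured P)"
    using tendsto_mult[OF frac_vanish[of 1 "u z"] frac_vanish[of 1 "u z"]] by (simp add: power2_eq_square)
  from vlim_scale_const[OF amero_frac2 this, of a] show ?thesis
    unfolding mfrac2_def mext_vlim[OF vmero_scale_const[OF amero_frac2]] by simp
qed

lemma mfrac_regular: "z \<noteq> P \<Longrightarrow> w \<noteq> z \<Longrightarrow> mfrac u z a w \<noteq> None"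
  using mfrac_value[of w z a] mfrac_P[of z a] by (cases "w = P") auto

lemma mfrac2_regular: "z \<noteq> P \<Longrightarrow> w \<noteq> z \<Longrightarrow> mfrac2 u z a w \<noteq> None"
  using mfrac2_value[of w z a] mfrac2_P[of z a] by (cases "w = P") auto

lemma mfrac_mlin: "mfrac u z (c *\<^sub>C a + b) = mlin c (mfrac u z a) (mfrac u z (b :: 'g))"
proof (rule mero_map_eqI)
  show "\<forall>\<^sub>F p in cofinite. val (mfrac u z (c *\<^sub>C a + b)) p = val (mlin c (mfrac u z a) (mfrac u z b)) p"
    using mlin_ae[OF mero_map_mfrac mero_map_mfrac, of c z a z b] mfrac_ae[of z a] mfrac_ae[of z b]
      mfrac_ae[of z "c *\<^sub>C a + b"]
    by eventually_elim (simp add: scaleC_add_right mult.commute)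
qed (intro mero_map_mlin mero_map_mfrac)+

lemma clin_lmult_mfrac: "x \<in> Vec \<Longrightarrow> clin (\<lambda>a. cls (lmult (mfrac u z a) x))"
  unfolding clin_def by (simp add: mfrac_mlin cls_mlin)

lemma mlie_mfrac_mfrac: "mlie (mfrac u z a) (mfrac u z b) = mfrac2 u z (lie a (b :: 'g))"
proof (rule mero_map_eqI)
  show "\<forall>\<^sub>F p in cofinite. val (mlie (mfrac u z a) (mfrac u z b)) p = val (mfrac2 u z (lie a b)) p"
    using mlie_ae[OF mero_map_mfrac mero_map_mfrac, of z a z b] mfrac_ae[of z a] mfrac_ae[of z b]
      mfrac2_ae[of z "lie a b"]
    by eventually_elim (simp add: power2_eq_square)
qed (auto intro: mero_map_mlie)

context
  fixes \<alpha> :: "'g mmap" and z :: proj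
  assumes \<alpha>: "mero_map \<alpha>" "\<alpha> z \<noteq> None" "z \<noteq> P"
begin

text \<open>In \<open>\<alpha> = \<alpha>(z) + (u - u z) dd u z \<alpha>\<close> the first summand
  keeps the pole, while in the second it cancels.\<close>

lemma mlie_mfrac:
  "mlie (mfrac u z a) \<alpha> = mlin 1 (mfrac u z (lie a (val \<alpha> z))) (mlie (mconst a) (dd u z \<alpha>))"
proof (rule mero_map_eqI)
  note m = mero_map_dd[OF \<alpha>] mero_map_mlie[OF mero_map_mconst mero_map_dd[OF \<alpha>], of a]
  show "\<forall>\<^sub>F p in cofinite. val (mlie (mfrac u z a) \<alpha>) p =
      val (mlin 1 (mfrac u z (lie a (val \<alpha> z))) (mlie (mconst a) (dd u z \<alpha>))) p"
    using mlie_ae[OF mero_map_mfrac \<alpha>(1), of z a] mlin_ae[OF mero_map_mfrac m(2), of 1 z "lie a (val \<alpha> z)"]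
      mlie_ae[OF mero_map_mconst m(1), of a] mfrac_ae[of z a] mfrac_ae[of z "lie a (val \<alpha> z)"]
      dd_expand_ae[OF \<alpha>] u_neq_ae[OF \<alpha>]
    by eventually_elim (simp add: scaleC_add_right)
qed (intro mero_map_mlin mero_map_mlie mero_map_mfrac mero_map_mconst mero_map_dd \<alpha>)+

text \<open>Identifies the commutator in the recursion for \<iota> with the regular remainder of
  \<open>mlie_mfrac\<close>.\<close>

lemma mlie_mfrac_mdiff:
  "mlie (mfrac u z a) (mdiff \<alpha> (mconst (val \<alpha> z))) = mlie (mconst a) (dd u z \<alpha>)"
proof (rule mero_map_eqI)
  show "\<forall>\<^sub>F p in cofinite. val (mlie (mfrac u z a) (mdiff \<alpha> (mconst (val \<alpha> z)))) p =
      val (mlie (mconst a) (dd u z \<alpha>)) p"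
    using mlie_ae[OF mero_map_mfrac mero_map_mdiff[OF \<alpha>(1) mero_map_mconst], of z a "val \<alpha> z"]
      mdiff_ae[OF \<alpha>(1) mero_map_mconst, of "val \<alpha> z"]
      mlie_ae[OF mero_map_mconst mero_map_dd[OF \<alpha>], of a] mfrac_ae[of z a]
      dd_expand_ae[OF \<alpha>] u_neq_ae[OF \<alpha>]
    by eventually_elim simp
qed (intro mero_map_mlie mero_map_mdiff mero_map_mfrac mero_map_mconst mero_map_dd \<alpha>)+

text \<open>The expansion of \<open>\<alpha>\<close> to second order: against a double pole the
  linear term leaves a simple one, the source of the \<open>ihat\<close> term in
  \<open>dhat_cons\<close>.\<close>

lemma mlie_mfrac2:
  "mlie (mfrac2 u z a) \<alpha> = mlin 1 (mfrac2 u z (lie a (val \<alpha> z)))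
    (mlin 1 (mfrac u z (lie a (val (dd u z \<alpha>) z))) (mlie (mconst a) (dd u z (dd u z \<alpha>))))"
proof (rule mero_map_eqI)
  let ?\<beta> = "dd u z \<alpha>"
  have \<beta>: "mero_map ?\<beta>" "?\<beta> z \<noteq> None" "z \<noteq> P" using mero_map_dd dd_regular \<alpha> by blast+
  note m1 = mero_map_mlie[OF mero_map_mconst mero_map_dd[OF \<beta>], of a]
  note m2 = mero_map_mlin[OF mero_map_mfrac m1, of 1 z "lie a (val ?\<beta> z)"]
  show "\<forall>\<^sub>F p in cofinite. val (mlie (mfrac2 u z a) \<alpha>) p = val (mlin 1 (mfrac2 u z (lie a (val \<alpha> z)))
    (mlin 1 (mfrac u z (lie a (val ?\<beta> z))) (mlie (mconst a) (dd u z ?\<beta>)))) p"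
    using mlie_ae[OF mero_map_mfrac2 \<alpha>(1), of z a] mlin_ae[OF mero_map_mfrac2 m2, of 1 z "lie a (val \<alpha> z)"]
      mlin_ae[OF mero_map_mfrac m1, of 1 z "lie a (val ?\<beta> z)"] mlie_ae[OF mero_map_mconst mero_map_dd[OF \<beta>], of a]
      mfrac2_ae[of z a] mfrac2_ae[of z "lie a (val \<alpha> z)"] mfrac_ae[of z "lie a (val ?\<beta> z)"]
      dd_expand_ae[OF \<alpha>] dd_expand_ae[OF \<beta>] u_neq_ae[OF \<alpha>]
    by eventually_elim (simp add: scaleC_add_right power2_eq_square)
  show "mero_map (mlin 1 (mfrac2 u z (lie a (val \<alpha> z)))
    (mlin 1 (mfrac u z (lie a (val ?\<beta> z))) (mlie (mconst a) (dd u z ?\<beta>))))"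
    by (intro mero_map_mlin mero_map_mfrac2 m2)
qed (intro mero_map_mlie mero_map_mfrac2 \<alpha>)

lemma mlie_dd_regular: "mlie (mconst a) (dd u z \<alpha>) z \<noteq> None"
  by (intro mlie_regular mero_map_mconst mero_map_dd dd_regular \<alpha>) simp

lemma mlie_dd_vanreg: "\<alpha> P = Some 0 \<Longrightarrow> mlie (mconst a) (dd u z \<alpha>) \<in> vanreg z"
  using mlie_value[of "mconst a" "dd u z \<alpha>" P a 0] dd_P[OF \<alpha>] mero_map_dd[OF \<alpha>]
  by (intro vanregI mlie_dd_regular mero_map_mlie mero_map_mconst mero_map_dd \<alpha>) simp

end

text \<open>Agrees with \<open>iota_hat\<close> on words regular at \<open>z\<close> and vanishing
  at \<open>P\<close> (\<open>cls_iota_hat\<close>), but respects the relations for free, since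
  modes and left multiplications do.\<close>

definition ihat :: "proj \<Rightarrow> 'g \<Rightarrow> ('g, 'w) ivec \<Rightarrow> ('g, 'w) ivec"
  where "ihat z a x = mode z (mfrac u z a) x - lmult (mfrac u z a) x"

text \<open>The derivative of \<open>ihat\<close> with respect to \<open>u z\<close>; see
  \<open>limit_dq\<close>.\<close>

definition dhat :: "proj \<Rightarrow> 'g \<Rightarrow> ('g, 'w) ivec \<Rightarrow> ('g, 'w) ivec"
  where "dhat z a x = mode z (mfrac2 u z a) x - lmult (mfrac2 u z a) x"

lemma clin_ihat: "clin (ihat z a)"
  unfolding ihat_def by (intro clin_fun clin_mode clin_lmult)

lemma clin_dhat: "clin (dhat z a)"
  unfolding dhat_def by (intro clin_fun clin_mode clin_lmult)

end

locale field_point = field_coord n W \<rho> \<zeta> u P + mode_point n W \<rho> \<zeta> z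
  for n :: nat and W :: "nat \<Rightarrow> 'w::complex_vector set"
    and \<rho> :: "nat \<Rightarrow> 'g::quadratic_lie_algebra \<Rightarrow> 'w \<Rightarrow> 'w" and \<zeta> :: "nat \<Rightarrow> proj"
    and u :: "proj \<Rightarrow> complex" and P :: proj and z :: proj +
  assumes zP: "z \<noteq> P"
begin

lemma clin_mode_mfrac: "x \<in> Vec \<Longrightarrow> clin (\<lambda>a. cls (mode z (mfrac u z a) x))"
  unfolding clin_def by (simp add: mfrac_mlin mode_mlin)

lemma clin_ihat_left: "x \<in> Vec \<Longrightarrow> clin (\<lambda>a. cls (ihat z a x))"
  unfolding ihat_def using clin_fun(2)[OF clin_mode_mfrac clin_lmult_mfrac] by simp

lemma ihat_cong: "cls x = cls y \<Longrightarrow> cls (ihat z a x) = cls (ihat z a y)"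
  using mode_cong[OF mero_map_mfrac, of x y z a] lmult_cong[OF mero_map_mfrac, of x y z a]
  by (simp add: ihat_def)

text \<open>A map whose only pole is at \<open>z\<close> is its own principal part. Left
  multiplication cancels against the first term of \<open>vac\<close>, and minus the node values
  remain.\<close>

lemma cls_principal_nil:
  assumes f: "mero_map f" "\<And>w. w \<noteq> z \<Longrightarrow> f w \<noteq> None"
    and c: "\<And>k. k < n \<Longrightarrow> val f (\<zeta> k) = c k *\<^sub>C a" and w: "w \<in> tuples n W"
  shows "cls (mode z f (bas [] w) - lmult f (bas [] w)) =
    (\<Sum>k<n. (- c k) *\<^sub>C cls (bas [] (w(k := \<rho> k a (w k)))))"
proof -
  have "cls (bas [] (w(k := \<rho> k (val f (\<zeta> k)) (w k)))) = c k *\<^sub>C cls (bas [] (w(k := \<rho> k a (w k))))"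
    if k: "k < n" for k
    using cls_tuple_scale[OF k rep_closed[OF k tuples_component[OF w k]] w]
    by (simp add: c[OF k] rep_scale[OF k tuples_component[OF w k]])
  then have "cls (vac f w) = cls (bas [f] w) - (\<Sum>k<n. c k *\<^sub>C cls (bas [] (w(k := \<rho> k a (w k)))))"
    by (simp add: vac_def)
  moreover have "cls (mode z f (bas [] w)) = cls (vac f w)"
    using mode_nil[OF f(1) is_pp_self[OF f] w] by simp
  ultimately show ?thesis by (simp add: sum_negf complex_vector.scale_minus_left)
qed

lemma ihat_nil:
  assumes "w \<in> tuples n W"
  shows "cls (ihat z a (bas [] w)) = (\<Sum>k<n. (1 / (u z - u (\<zeta> k))) *\<^sub>C cls (bas [] (w(k := \<rho> k a (w k)))))"
proof -
  have "val (mfrac u z a) (\<zeta> k) = (1 / (u (\<zeta> k) - u z)) *\<^sub>C a" if "k < n" for k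
    using mfrac_value[OF P[OF that] zP z[OF that], of a] by simp
  from cls_principal_nil[OF mero_map_mfrac mfrac_regular[OF zP] this assms]
  show ?thesis by (simp add: ihat_def minus_divide_right)
qed

lemma dhat_nil:
  assumes "w \<in> tuples n W"
  shows "cls (dhat z a (bas [] w)) =
    (\<Sum>k<n. (- (1 / (u (\<zeta> k) - u z)\<^sup>2)) *\<^sub>C cls (bas [] (w(k := \<rho> k a (w k)))))"
proof -
  have "val (mfrac2 u z a) (\<zeta> k) = (1 / (u (\<zeta> k) - u z)\<^sup>2) *\<^sub>C a" if "k < n" for k
    using mfrac2_value[OF P[OF that] zP z[OF that], of a] by simp
  from cls_principal_nil[OF mero_map_mfrac2 mfrac2_regular[OF zP] this assms]
  show ?thesis by (simp add: dhat_def)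
qed

text \<open>After \<open>mlie_mfrac\<close>, the polar summand enters the mode and the left
  multiplication alike and gives \<open>ihat\<close> again. The regular summand is invisible to the
  mode but not to left multiplication, whence the last term.\<close>

lemma ihat_cons:
  assumes \<alpha>: "mero_map \<alpha>" "\<alpha> z \<noteq> None" and x: "x \<in> vecs n W (regular_at z)"
  shows "cls (ihat z a (lmult \<alpha> x)) = cls (lmult \<alpha> (ihat z a x)) + cls (ihat z (lie a (val \<alpha> z)) x)
    - form a (val (dd u z \<alpha>) z) *\<^sub>C cls x - cls (lmult (mlie (mconst a) (dd u z \<alpha>)) x)"
proof -
  note \<alpha>' = \<alpha> zP
  let ?r = "mlie (mconst a) (dd u z \<alpha>)" and ?f = "mfrac u z a" and ?g = "mfrac u z (lie a (val \<alpha> z))"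
  note V = vecs_regular_Vec[OF x]
  have r: "mero_map ?r" by (intro mero_map_mlie mero_map_mconst mero_map_dd \<alpha>')
  have "?r \<in> regular_at z" using r mlie_dd_regular[OF \<alpha>'] by (simp add: regular_at_def)
  from mode_regular[OF this x] have 1: "cls (mode z (mlie ?f \<alpha>) x) = cls (mode z ?g x)"
    using mode_mlin[OF mero_map_mfrac r V, of 1 z "lie a (val \<alpha> z)"] by (simp add: mlie_mfrac[OF \<alpha>'])
  have 2: "cls (lmult ?f (lmult \<alpha> x)) - cls (lmult \<alpha> (lmult ?f x)) = cls (lmult ?g x) + cls (lmult ?r x)"
    using cls_mlie[OF mero_map_mfrac \<alpha>(1) V, of z a] cls_mlin[OF mero_map_mfrac r V, of 1 z "lie a (val \<alpha> z)"]
    by (simp add: mlie_mfrac[OF \<alpha>'])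
  have "cls (ihat z a (lmult \<alpha> x)) = cls (lmult \<alpha> (mode z ?f x)) + cls (mode z ?g x)
      - form a (val (dd u z \<alpha>) z) *\<^sub>C cls x - cls (lmult ?f (lmult \<alpha> x))"
    by (simp add: ihat_def mode_lmult[OF V] 1 mres_mfrac[OF \<alpha>'])
  also have "cls (lmult ?f (lmult \<alpha> x)) = cls (lmult \<alpha> (lmult ?f x)) + cls (lmult ?g x) + cls (lmult ?r x)"
    using 2 by (simp add: algebra_simps)
  finally show ?thesis by (simp add: ihat_def algebra_simps)
qed

text \<open>As in \<open>ihat_cons\<close>, with the additional simple pole of
  \<open>mlie_mfrac2\<close>.\<close>

lemma dhat_cons:
  assumes \<alpha>: "mero_map \<alpha>" "\<alpha> z \<noteq> None" and x: "x \<in> vecs n W (regular_at z)"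
  shows "cls (dhat z a (lmult \<alpha> x)) = cls (lmult \<alpha> (dhat z a x)) + cls (dhat z (lie a (val \<alpha> z)) x)
    + cls (ihat z (lie a (val (dd u z \<alpha>) z)) x)
    - (2 * form a (val (dd u z (dd u z \<alpha>)) z)) *\<^sub>C cls x
    - cls (lmult (mlie (mconst a) (dd u z (dd u z \<alpha>))) x)"
proof -
  note \<alpha>' = \<alpha> zP
  let ?\<beta> = "dd u z \<alpha>"
  have \<beta>: "mero_map ?\<beta>" "?\<beta> z \<noteq> None" "z \<noteq> P" using mero_map_dd dd_regular \<alpha>' by blast+
  let ?r = "mlie (mconst a) (dd u z ?\<beta>)" and ?f = "mfrac2 u z a"
  let ?g = "mfrac2 u z (lie a (val \<alpha> z))" and ?h = "mfrac u z (lie a (val ?\<beta> z))"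
  note V = vecs_regular_Vec[OF x]
  have r: "mero_map ?r" by (intro mero_map_mlie mero_map_mconst mero_map_dd \<beta>)
  have hr: "mero_map (mlin 1 ?h ?r)" by (intro mero_map_mlin mero_map_mfrac r)
  have "?r \<in> regular_at z" using r mlie_dd_regular[OF \<beta>] by (simp add: regular_at_def)
  from mode_regular[OF this x] have 1: "cls (mode z (mlie ?f \<alpha>) x) = cls (mode z ?g x) + cls (mode z ?h x)"
    using mode_mlin[OF mero_map_mfrac2 hr V, of 1 z "lie a (val \<alpha> z)"]
      mode_mlin[OF mero_map_mfrac r V, of 1 z "lie a (val ?\<beta> z)"] by (simp add: mlie_mfrac2[OF \<alpha>'])
  have 2: "cls (lmult ?f (lmult \<alpha> x)) - cls (lmult \<alpha> (lmult ?f x)) =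
      cls (lmult ?g x) + cls (lmult ?h x) + cls (lmult ?r x)"
    using cls_mlie[OF mero_map_mfrac2 \<alpha>(1) V, of z a] cls_mlin[OF mero_map_mfrac2 hr V, of 1 z "lie a (val \<alpha> z)"]
      cls_mlin[OF mero_map_mfrac r V, of 1 z "lie a (val ?\<beta> z)"]
    by (simp add: mlie_mfrac2[OF \<alpha>'] add.assoc)
  have "cls (dhat z a (lmult \<alpha> x)) = cls (lmult \<alpha> (mode z ?f x)) + cls (mode z ?g x) + cls (mode z ?h x)
      - (2 * form a (val (dd u z ?\<beta>) z)) *\<^sub>C cls x - cls (lmult ?f (lmult \<alpha> x))"
    by (simp add: dhat_def mode_lmult[OF V] 1 mres_mfrac2[OF \<alpha>'])
  also have "cls (lmult ?f (lmult \<alpha> x)) =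
      cls (lmult \<alpha> (lmult ?f x)) + cls (lmult ?g x) + cls (lmult ?h x) + cls (lmult ?r x)"
    using 2 by (simp add: algebra_simps)
  finally show ?thesis by (simp add: dhat_def ihat_def algebra_simps)
qed

lemma vecs_subspace [intro]:
  "x \<in> vecs n W L \<Longrightarrow> y \<in> vecs n W L \<Longrightarrow> x + y \<in> vecs n W L"
  "x \<in> vecs n W L \<Longrightarrow> y \<in> vecs n W L \<Longrightarrow> x - y \<in> vecs n W L"
  "x \<in> vecs n W L \<Longrightarrow> c *\<^sub>C x \<in> vecs n W L"
  "(\<And>i. i \<in> I \<Longrightarrow> g i \<in> vecs n W L) \<Longrightarrow> (\<Sum>i\<in>I. g i) \<in> vecs n W L"
  using csubspace_vecs[of n W L]
  by (auto intro!: complex_vector.subspace_add complex_vector.subspace_diff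
      complex_vector.subspace_scale complex_vector.subspace_sum)

text \<open>By \<open>mlie_mfrac_mdiff\<close> and \<open>diff_at_form\<close> the recursion for
  \<iota> is \<open>ihat_cons\<close> multiplied by \<open>diff_at u z\<close>. Membership in
  \<open>vanreg z\<close> is carried along because \<iota> is to be iterated.\<close>

lemma iota_word_ihat:
  assumes "xs \<in> lists (vanreg z)" "w \<in> tuples n W"
  shows "iota_word n \<rho> \<zeta> u z a xs w \<in> vecs n W (vanreg z) \<and>
    cls (iota_word n \<rho> \<zeta> u z a xs w) = diff_at u z *\<^sub>C cls (ihat z a (bas xs w))"
  using assms
proof (induction xs arbitrary: a)
  case Nil
  have "iota_word n \<rho> \<zeta> u z a [] w \<in> vecs n W (vanreg z)"
    unfolding iota_word.simps using assms(2) by (intro vecs_subspace bas_in_vecs tuples_rep) auto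
  with assms(2) show ?case by (simp add: ihat_nil complex_vector.scale_sum_right)
next
  case (Cons \<alpha> xs)
  then have \<alpha>: "mero_map \<alpha>" "\<alpha> z \<noteq> None" "\<alpha> P = Some 0" and \<alpha>v: "\<alpha> \<in> vanreg z" and xs: "xs \<in> lists (vanreg z)"
    using vanregD by auto
  note \<alpha>' = \<alpha>(1,2) zP
  have X: "bas xs w \<in> vecs n W (vanreg z)" using xs assms(2) by auto
  note IH = Cons.IH[OF assms(2)]
  have l: "cls (lmult \<alpha> (iota_word n \<rho> \<zeta> u z a xs w)) = cls (lmult \<alpha> (diff_at u z *\<^sub>C ihat z a (bas xs w)))"
    by (rule lmult_cong[OF \<alpha>(1)]) (simp add: IH)
  note r = mlie_mfrac_mdiff[OF \<alpha>'] mlie_dd_vanreg[OF \<alpha>' \<alpha>(3)]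
  have "iota_word n \<rho> \<zeta> u z a (\<alpha> # xs) w \<in> vecs n W (vanreg z)"
    unfolding iota_word.simps r(1) using IH \<alpha>v X r(2) xs assms(2)
    by (intro vecs_subspace lmult_vecs bas_in_vecs) auto
  moreover have "cls (ihat z a (bas (\<alpha> # xs) w)) = cls (lmult \<alpha> (ihat z a (bas xs w)))
    + cls (ihat z (lie a (val \<alpha> z)) (bas xs w)) - form a (val (dd u z \<alpha>) z) *\<^sub>C cls (bas xs w)
    - cls (bas (mlie (mconst a) (dd u z \<alpha>) # xs) w)"
    using ihat_cons[OF \<alpha>(1,2) vanreg_regular[OF X], of a] by simp
  ultimately show ?case
    using l by (simp add: r(1) IH diff_at_form[OF \<alpha>'] complex_vector.scale_right_diff_distrib scaleC_add_right)
qed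

lemma clin_iota: "clin (iota n \<rho> \<zeta> u z a)"
  unfolding iota_def by (rule clin_lin_ext)

lemma iota_vecs: "x \<in> vecs n W (vanreg z) \<Longrightarrow> iota n \<rho> \<zeta> u z a x \<in> vecs n W (vanreg z)"
  by (rule clin_vecs[OF clin_iota _ csubspace_vecs]) (auto simp: iota_def iota_word_ihat)

lemma cls_iota:
  assumes "x \<in> vecs n W (vanreg z)"
  shows "cls (iota n \<rho> \<zeta> u z a x) = diff_at u z *\<^sub>C cls (ihat z a x)"
  by (rule clin_eq_vecs[OF clin_comp[OF clin_cls clin_iota]
        clin_fun(3)[OF clin_comp[OF clin_cls clin_ihat]] _ assms])
    (simp add: iota_def iota_word_ihat)

lemma cls_iota_hat:
  "x \<in> vecs n W (vanreg z) \<Longrightarrow> cls (iota_hat n \<rho> \<zeta> u z a x) = cls (ihat z a x)"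
  using u_chart(2)[OF zP] by (simp add: iota_hat_def cls_iota)

lemma iota_hat_vecs: "x \<in> vecs n W (vanreg z) \<Longrightarrow> iota_hat n \<rho> \<zeta> u z a x \<in> vecs n W (vanreg z)"
  unfolding iota_hat_def by (intro vecs_subspace iota_vecs)

text \<open>The outer mode is commuted past the letter \<open>v1 / (u - u z)\<close>. The bracket
  \<open>[v2, v1] / (u - u z)^2\<close> splits into \<open>dhat\<close> and a left multiplication,
  and the latter restores the order of the two letters.\<close>

lemma product_formula:
  assumes y: "y \<in> vecs n W (vanreg z)"
  shows "cls (mode z (mfrac u z v2) (mode z (mfrac u z v1) y)) =
    cls (lmult (mfrac u z v2) (lmult (mfrac u z v1) y)) + cls (lmult (mfrac u z v2) (ihat z v1 y))
    + cls (ihat z v2 (ihat z v1 y)) + cls (lmult (mfrac u z v1) (ihat z v2 y)) + cls (dhat z (lie v2 v1) y)"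
proof -
  note V = vanreg_Vec[OF y]
  let ?f = "mfrac u z v2" and ?g = "mfrac u z v1"
  have g: "mode z ?g y = lmult ?g y + ihat z v1 y" "mode z ?f y = lmult ?f y + ihat z v2 y"
    by (simp_all add: ihat_def)
  have "cls (mode z ?f (lmult ?g y)) = cls (lmult ?g (mode z ?f y)) + cls (mode z (mlie ?f ?g) y)"
    by (simp add: mode_lmult[OF V] mres_mfrac_mfrac[OF zP])
  also have "cls (mode z (mlie ?f ?g) y) = cls (dhat z (lie v2 v1) y) + cls (lmult (mlie ?f ?g) y)"
    by (simp add: dhat_def mlie_mfrac_mfrac)
  also have "cls (lmult (mlie ?f ?g) y) = cls (lmult ?f (lmult ?g y)) - cls (lmult ?g (lmult ?f y))"
    using cls_mlie[OF mero_map_mfrac mero_map_mfrac V] .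
  finally have "cls (mode z ?f (lmult ?g y)) = cls (lmult ?f (lmult ?g y)) + cls (lmult ?g (ihat z v2 y))
    + cls (dhat z (lie v2 v1) y)" by (simp add: g(2))
  then show ?thesis unfolding g(1) by (simp add: ihat_def)
qed

end

section \<open>Rationality\<close>

context coord
begin

text \<open>Both sides have the same principal part at \<open>z\<close> and no other pole, so Liouville applies.\<close>

lemma frac_eq_kfun:
  assumes "z \<noteq> P"
  obtains \<kappa> where "\<And>p. p \<noteq> P \<Longrightarrow> p \<noteq> z \<Longrightarrow> diff_at u z / (u p - u z) = kfun z p + \<kappa>"
proof -
  interpret simple_zero "\<lambda>h. u (chart z h) - u z" "diff_at u z" using assms by (rule simple_zero)
  define g where "g p = diff_at u z * (1 / (u p - u z)) - kfun z p" for p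
  have am: "amero g" unfolding g_def by (intro amero_diff amero_mult amero_const amero_frac amero_kfun)
  have lim: "(g \<longlongrightarrow> g w) (punctured w)" if "w \<noteq> P" "w \<noteq> z" for w
    unfolding g_def using that assms by (intro tendsto_intros frac_tendsto kfun_tendsto) auto
  have limP: "(g \<longlongrightarrow> diff_at u z * 0 - kfun z P) (punctured P)"
    unfolding g_def using assms by (intro tendsto_intros frac_vanish kfun_tendsto) auto
  have "(\<lambda>h. diff_at u z * (h / (u (chart z h) - u z))) meromorphic_on {0}"
    by (intro meromorphic_intros U_meromorphic)
  moreover have "((\<lambda>h. diff_at u z * (h / (u (chart z h) - u z))) \<longlongrightarrow> 1) (at 0)"
  proof -
    have "((\<lambda>h. diff_at u z * (1 / ((u (chart z h) - u z) / h))) \<longlongrightarrow> diff_at u z * (1 / diff_at u z)) (at 0)"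
      by (intro tendsto_intros quotient d_nonzero)
    then show ?thesis using d_nonzero by simp
  qed
  ultimately obtain m where m: "((\<lambda>h. (diff_at u z * (h / (u (chart z h) - u z)) - 1) / h) \<longlongrightarrow> m) (at 0)"
    by (rule removable_quotient)
  have "\<forall>\<^sub>F h in at 0. (diff_at u z * (h / (u (chart z h) - u z)) - 1) / h = g (chart z h)"
    by (auto simp: eventually_at_filter g_def kfun_chart diff_divide_distrib intro!: always_eventually)
  with m have limz: "(g \<longlongrightarrow> m) (punctured z)" unfolding tendsto_punctured by (rule Lim_transform_eventually)
  have "\<not> has_pole (nice g) w" for w
    using has_pole_cong[OF nice_ae[OF am], of w] not_pole_tendsto[OF limz] not_pole_tendsto[OF limP]
      not_pole_tendsto[OF lim, of w] by metis
  then have "nice g w = nice g P" for w by (intro Liouville_proj mero_fun_nice am)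
  then have "g w = nice g P" if "w \<noteq> P" "w \<noteq> z" for w using nice_eqI[OF lim[OF that]] by metis
  then show thesis by (intro that[of "nice g P"]) (auto simp: g_def algebra_simps)
qed

lemma u_poly_ae: assumes "q \<noteq> 0" shows "\<forall>\<^sub>F p in cofinite. poly q (u p) \<noteq> 0"
proof -
  have "finite (u -` {x. poly q x = 0} \<inter> - {P})"
    using assms u_inj by (intro finite_vimage_IntI poly_roots_finite inj_onI) auto
  moreover have "{p. \<not> poly q (u p) \<noteq> 0} \<subseteq> insert P (u -` {x. poly q x = 0} \<inter> - {P})" by auto
  ultimately show ?thesis unfolding eventually_cofinite by (meson finite_insert finite_subset)
qed

text \<open>\<open>tends\<close> speaks of rational functions of \<open>u\<close>, whereas
  meromorphic maps are given analytically; on the projective line the two notions coincide.\<close>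

definition rational :: "(proj \<Rightarrow> complex) \<Rightarrow> bool"
  where "rational f \<longleftrightarrow> (\<exists>N q. q \<noteq> 0 \<and> (\<forall>\<^sub>F p in cofinite. f p = poly N (u p) / poly q (u p)))"

lemma rationalI: "q \<noteq> 0 \<Longrightarrow> \<forall>\<^sub>F p in cofinite. f p = poly N (u p) / poly q (u p) \<Longrightarrow> rational f"
  unfolding rational_def by blast

lemma rational_const: "rational (\<lambda>_. c)"
  by (rule rationalI[of 1 _ "[:c:]"]) auto

lemma rational_add_mult:
  assumes "rational f" "rational g"
  shows "rational (\<lambda>p. f p + g p)" "rational (\<lambda>p. f p * g p)"
proof -
  obtain N q M r where f: "q \<noteq> 0" "\<forall>\<^sub>F p in cofinite. f p = poly N (u p) / poly q (u p)"
    and g: "r \<noteq> 0" "\<forall>\<^sub>F p in cofinite. g p = poly M (u p) / poly r (u p)"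
    using assms unfolding rational_def by blast
  have qr: "q * r \<noteq> 0" using f(1) g(1) by simp
  have "\<forall>\<^sub>F p in cofinite. f p + g p = poly (N * r + M * q) (u p) / poly (q * r) (u p)"
    using f(2) g(2) u_poly_ae[OF f(1)] u_poly_ae[OF g(1)] by eventually_elim (simp add: field_simps)
  then show "rational (\<lambda>p. f p + g p)" by (rule rationalI[OF qr])
  have "\<forall>\<^sub>F p in cofinite. f p * g p = poly (N * M) (u p) / poly (q * r) (u p)"
    using f(2) g(2) by eventually_elim simp
  then show "rational (\<lambda>p. f p * g p)" by (rule rationalI[OF qr])
qed

lemma rational_poly: "rational f \<Longrightarrow> rational (\<lambda>p. poly q (f p))"
  by (induction q) (auto intro: rational_add_mult rational_const)

lemma rational_sum: "(\<And>i. i \<in> I \<Longrightarrow> rational (f i)) \<Longrightarrow> rational (\<lambda>p. \<Sum>i\<in>I. f i p)"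
  by (induction I rule: infinite_finite_induct) (auto intro: rational_add_mult rational_const)

text \<open>If \<open>z = P\<close>, then \<open>u\<close> is affine in \<open>kfun P\<close>;
  otherwise \<open>frac_eq_kfun\<close> presents \<open>kfun z\<close> as a fractional linear
  function of \<open>u\<close>.\<close>

lemma rational_kfun: "rational (kfun z)"
proof (cases "z = P")
  case True
  obtain c d where c: "c \<noteq> 0" "\<And>p. p \<noteq> P \<Longrightarrow> u p = c * kfun P p + d"
    using coordinate by (rule coordinate_kfun) blast
  have "kfun P p = poly [:-d, 1:] (u p) / poly [:c:] (u p)" if "p \<noteq> P" for p
    using c(1) by (simp add: c(2)[OF that])
  then have "{p. \<not> kfun P p = poly [:-d, 1:] (u p) / poly [:c:] (u p)} \<subseteq> {P}" by blast
  then have "\<forall>\<^sub>F p in cofinite. kfun P p = poly [:-d, 1:] (u p) / poly [:c:] (u p)"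
    unfolding eventually_cofinite by (rule finite_subset) simp
  then show ?thesis unfolding True by (rule rationalI[rotated]) (simp add: c(1))
next
  case False
  then obtain \<kappa> where \<kappa>: "\<And>p. p \<noteq> P \<Longrightarrow> p \<noteq> z \<Longrightarrow> diff_at u z / (u p - u z) = kfun z p + \<kappa>"
    by (rule frac_eq_kfun) blast
  let ?N = "[:diff_at u z:] - smult \<kappa> [:- u z, 1:]" and ?q = "[:- u z, 1:]"
  have "kfun z p = poly ?N (u p) / poly ?q (u p)" if p: "p \<noteq> P" "p \<noteq> z" for p
  proof -
    have "u p - u z \<noteq> 0" using u_inj[of p z] p False by auto
    then show ?thesis using \<kappa>[OF p] by (simp add: field_simps)
  qed
  then have "{p. \<not> kfun z p = poly ?N (u p) / poly ?q (u p)} \<subseteq> {P, z}" by blast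
  then have "\<forall>\<^sub>F p in cofinite. kfun z p = poly ?N (u p) / poly ?q (u p)"
    unfolding eventually_cofinite by (rule finite_subset) simp
  then show ?thesis by (rule rationalI[rotated]) simp
qed

text \<open>Subtracting the principal parts at the finitely many poles, each a polynomial in some
  \<open>kfun z\<close>, leaves a constant.\<close>

lemma amero_imp_rational:
  assumes "amero f" shows "rational f"
proof -
  define S where "S = {z. has_pole f z}"
  have "finite S" using not_has_pole_ae[OF assms] by (simp add: eventually_cofinite S_def)
  have "\<forall>z. \<exists>q l. ((\<lambda>p. f p - poly q (kfun z p)) \<longlongrightarrow> l) (punctured z)"
    using scalar_principal_part[OF assms] by metis
  then obtain q l where q: "\<And>z. ((\<lambda>p. f p - poly (q z) (kfun z p)) \<longlongrightarrow> l z) (punctured z)"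
    by metis
  define g where "g p = f p - (\<Sum>z\<in>S. poly (q z) (kfun z p))" for p
  have am: "amero g"
    unfolding g_def by (intro amero_diff amero_sum amero_poly amero_kfun assms)
  have pt: "((\<lambda>p. poly (q z) (kfun z p)) \<longlongrightarrow> poly (q z) (kfun z w)) (punctured w)" if "w \<noteq> z" for w z
    by (rule isCont_tendsto_compose[OF poly_isCont kfun_tendsto[OF that]])
  have "\<not> has_pole g w" for w
  proof (cases "w \<in> S")
    case True
    have "((\<lambda>p. (f p - poly (q w) (kfun w p)) - (\<Sum>z\<in>S - {w}. poly (q z) (kfun z p)))
        \<longlongrightarrow> l w - (\<Sum>z\<in>S - {w}. poly (q z) (kfun z w))) (punctured w)"
      by (intro tendsto_diff q tendsto_sum pt) auto
    then have "(g \<longlongrightarrow> l w - (\<Sum>z\<in>S - {w}. poly (q z) (kfun z w))) (punctured w)"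
      using True \<open>finite S\<close> by (simp add: g_def[abs_def] sum.remove[of S w] algebra_simps)
    then show ?thesis by (rule not_pole_tendsto)
  next
    case False
    then obtain m where "(f \<longlongrightarrow> m) (punctured w)" using amero_cases[OF assms, of w] by (auto simp: S_def)
    then have "(g \<longlongrightarrow> m - (\<Sum>z\<in>S. poly (q z) (kfun z w))) (punctured w)"
      unfolding g_def using False by (intro tendsto_diff tendsto_sum pt) auto
    then show ?thesis by (rule not_pole_tendsto)
  qed
  then have "\<not> has_pole (nice g) w" for w using has_pole_cong[OF nice_ae[OF am]] by blast
  then have const: "nice g w = nice g P" for w by (intro Liouville_proj mero_fun_nice am)
  have "\<forall>\<^sub>F p in cofinite. nice g P + (\<Sum>z\<in>S. poly (q z) (kfun z p)) = f p"
    using nice_ae[OF am] by (rule eventually_mono) (metis const diff_add_cancel g_def)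
  moreover have "rational (\<lambda>p. nice g P + (\<Sum>z\<in>S. poly (q z) (kfun z p)))"
    by (intro rational_add_mult rational_const rational_sum rational_poly rational_kfun)
  then obtain N r where "r \<noteq> 0"
    "\<forall>\<^sub>F p in cofinite. nice g P + (\<Sum>z\<in>S. poly (q z) (kfun z p)) = poly N (u p) / poly r (u p)"
    unfolding rational_def by blast
  ultimately have "\<forall>\<^sub>F p in cofinite. f p = poly N (u p) / poly r (u p)"
    by (auto elim: eventually_elim2)
  with \<open>r \<noteq> 0\<close> show ?thesis by (rule rationalI)
qed

lemma poly_u_tendsto: "z \<noteq> P \<Longrightarrow> ((\<lambda>p. poly q (u p)) \<longlongrightarrow> poly q (u z)) (punctured z)"
  by (rule isCont_tendsto_compose[OF poly_isCont u_tendsto])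

text \<open>As long as the denominator vanishes at \<open>u z\<close>, the finite limit forces the
  numerator to vanish there too, and a factor \<open>u - u z\<close> cancels.\<close>

lemma regular_rational:
  assumes "(f \<longlongrightarrow> l) (punctured z)" "z \<noteq> P" "q \<noteq> 0"
    "\<forall>\<^sub>F p in cofinite. f p = poly N (u p) / poly q (u p)"
  shows "\<exists>N q. poly q (u z) \<noteq> 0 \<and> (\<forall>\<^sub>F p in cofinite. f p = poly N (u p) / poly q (u p))"
  using assms(3,4)
proof (induction "degree q" arbitrary: N q rule: less_induct)
  case less
  show ?case
  proof (cases "poly q (u z) = 0")
    case True
    have "\<forall>\<^sub>F p in cofinite. f p * poly q (u p) = poly N (u p)"
      using less.prems(2) u_poly_ae[OF less.prems(1)] by eventually_elim simp
    moreover have "((\<lambda>p. f p * poly q (u p)) \<longlongrightarrow> l * poly q (u z)) (punctured z)"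
      by (intro tendsto_intros assms poly_u_tendsto)
    ultimately have "((\<lambda>p. poly N (u p)) \<longlongrightarrow> l * poly q (u z)) (punctured z)"
      using tendsto_punctured_cong[of "\<lambda>p. f p * poly q (u p)" "\<lambda>p. poly N (u p)"] by simp
    from tendsto_unique[OF punctured_neq_bot this poly_u_tendsto[OF assms(2)]]
    have "poly N (u z) = 0" using True by simp
    then obtain N' q' where N': "N = [:- u z, 1:] * N'" and q': "q = [:- u z, 1:] * q'"
      using True unfolding poly_eq_0_iff_dvd dvd_def by blast
    have "q' \<noteq> 0" using less.prems(1) q' by auto
    moreover from this have "degree q' < degree q" unfolding q' by (subst degree_mult_eq) auto
    moreover have "\<forall>\<^sub>F p in cofinite. f p = poly N' (u p) / poly q' (u p)"
      using less.prems(2) u_poly_ae[of "[:- u z, 1:]", simplified]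
    proof eventually_elim
      case (elim p)
      have "poly N (u p) = (u p - u z) * poly N' (u p)" "poly q (u p) = (u p - u z) * poly q' (u p)"
        by (simp_all add: N' q' algebra_simps)
      with elim show ?case by simp
    qed
    ultimately show ?thesis using less.hyps by blast
  next
    case False
    with less.prems(2) show ?thesis by blast
  qed
qed

lemma vlim_rational:
  assumes "vlim z \<phi> v" "z \<noteq> P"
  shows "\<exists>A N q. finite A \<and> poly q (u z) \<noteq> 0 \<and>
    (\<forall>\<^sub>F p in cofinite. \<phi> p = (\<Sum>a\<in>A. (poly (N a) (u p) / poly q (u p)) *\<^sub>C a))"
  using assms(1)
proof (induction rule: vlim.induct)
  case vlim_zero
  show ?case by (rule exI[of _ "{}"], rule exI[of _ "\<lambda>_. 0"], rule exI[of _ 1]) auto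
next
  case (vlim_term f l \<phi> v b)
  then obtain A N q where A: "finite A" "poly q (u z) \<noteq> 0"
    "\<forall>\<^sub>F p in cofinite. \<phi> p = (\<Sum>a\<in>A. (poly (N a) (u p) / poly q (u p)) *\<^sub>C a)" by blast
  obtain M r where r: "poly r (u z) \<noteq> 0" "\<forall>\<^sub>F p in cofinite. f p = poly M (u p) / poly r (u p)"
    using amero_imp_rational[OF vlim_term(1)] regular_rational[OF vlim_term(2) assms(2)]
    unfolding rational_def by metis
  have nz: "q \<noteq> 0" "r \<noteq> 0" using A(2) r(1) by auto
  \<comment> \<open>The vector \<open>b\<close> may already occur in \<open>A\<close>; its two
    coefficients are then added over the common denominator.\<close>
  define N' where "N' a = (if a \<in> A then N a * r else 0) + (if a = b then M * q else 0)" for a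
  have "\<forall>\<^sub>F p in cofinite. f p *\<^sub>C b + \<phi> p = (\<Sum>a\<in>insert b A. (poly (N' a) (u p) / poly (q * r) (u p)) *\<^sub>C a)"
    using A(3) r(2) u_poly_ae[OF nz(1)] u_poly_ae[OF nz(2)]
  proof eventually_elim
    case (elim p)
    let ?q = "poly q (u p)" and ?r = "poly r (u p)"
    have "poly (N' a) (u p) / poly (q * r) (u p) =
      (if a \<in> A then poly (N a) (u p) / ?q else 0) + (if a = b then f p else 0)" for a
      using elim by (simp add: N'_def field_simps)
    then have "(\<Sum>a\<in>insert b A. (poly (N' a) (u p) / poly (q * r) (u p)) *\<^sub>C a) =
      (\<Sum>a\<in>insert b A. if a \<in> A then (poly (N a) (u p) / ?q) *\<^sub>C a else 0) +
      (\<Sum>a\<in>insert b A. if a = b then f p *\<^sub>C a else 0)"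
      by (simp add: scaleC_add_left sum.distrib if_distrib[of "\<lambda>x. x *\<^sub>C _"] cong: if_cong)
    also have "(\<Sum>a\<in>insert b A. if a \<in> A then (poly (N a) (u p) / ?q) *\<^sub>C a else 0) =
      (\<Sum>a\<in>A. (poly (N a) (u p) / ?q) *\<^sub>C a)"
      using A(1) by (intro sum.mono_neutral_cong_right) auto
    also have "(\<Sum>a\<in>insert b A. if a = b then f p *\<^sub>C a else 0) = f p *\<^sub>C b" using A(1) by simp
    finally show ?case using elim(1) by (simp add: add.commute)
  qed
  with A(1,2) r(1) show ?case
    by (intro exI[of _ "insert b A"] exI[of _ N'] exI[of _ "q * r"]) auto
next
  case (vlim_cong \<phi> v \<psi>)
  then obtain A N q where A: "finite A" "poly q (u z) \<noteq> 0"
    "\<forall>\<^sub>F p in cofinite. \<phi> p = (\<Sum>a\<in>A. (poly (N a) (u p) / poly q (u p)) *\<^sub>C a)" by blast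
  have "\<forall>\<^sub>F p in cofinite. \<psi> p = (\<Sum>a\<in>A. (poly (N a) (u p) / poly q (u p)) *\<^sub>C a)"
    using A(3) vlim_cong.hyps(2) by eventually_elim simp
  with A(1,2) show ?case by blast
qed

text \<open>One formula describes the map off a finite set and its values near \<open>z1\<close>, so
  that \<open>\<alpha> z\<close> becomes a rational function of \<open>u z\<close>.\<close>

lemma mero_map_rational:
  assumes "mero_map \<alpha>" "\<alpha> z1 \<noteq> None" "z1 \<noteq> P"
  obtains A N q where "finite A" "poly q (u z1) \<noteq> 0"
    "\<forall>\<^sub>F p in cofinite. val \<alpha> p = (\<Sum>a\<in>A. (poly (N a) (u p) / poly q (u p)) *\<^sub>C a)"
    "\<And>z. z \<noteq> P \<Longrightarrow> poly q (u z) \<noteq> 0 \<Longrightarrow> \<alpha> z = Some (\<Sum>a\<in>A. (poly (N a) (u z) / poly q (u z)) *\<^sub>C a)"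
proof -
  obtain v where "\<alpha> z1 = Some v" using assms(2) by blast
  then have "vlim z1 (val \<alpha>) v" by (simp only: mero_map_vlim[OF assms(1)])
  from vlim_rational[OF this assms(3)] obtain A N q where A: "finite A" "poly q (u z1) \<noteq> 0"
    and ae: "\<forall>\<^sub>F p in cofinite. val \<alpha> p = (\<Sum>a\<in>A. (poly (N a) (u p) / poly q (u p)) *\<^sub>C a)" by blast
  have "\<alpha> z = Some (\<Sum>a\<in>A. (poly (N a) (u z) / poly q (u z)) *\<^sub>C a)"
    if z: "z \<noteq> P" "poly q (u z) \<noteq> 0" for z
  proof -
    have "vlim z (\<lambda>p. \<Sum>a\<in>A. (poly (N a) (u p) / poly q (u p)) *\<^sub>C a)
      (\<Sum>a\<in>A. (poly (N a) (u z) / poly q (u z)) *\<^sub>C a)"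
      by (rule vlim_sum, rule vlim_scale_const)
        (intro amero_divide amero_poly amero_u tendsto_divide poly_u_tendsto z)+
    then show ?thesis by (simp only: mero_map_vlim[OF assms(1)] vlim_cong_iff[OF ae])
  qed
  with A ae show thesis by (rule that)
qed

end


section \<open>Regular families\<close>

text \<open>Contains the centre, since representatives have to be identified at \<open>z1\<close> as
  well as close to it.\<close>

definition near :: "proj \<Rightarrow> proj filter"
  where "near z = filtermap (chart z) (nhds 0)"

lemma eventually_near: "eventually Q (near z) \<longleftrightarrow> (\<forall>\<^sub>F h in nhds 0. Q (chart z h))"
  by (simp add: near_def eventually_filtermap)

lemma eventually_near_iff: "eventually Q (near z) \<longleftrightarrow> eventually Q (punctured z) \<and> Q z"
  by (simp add: eventually_near eventually_punctured eventually_nhds_conv_at)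

lemma bipoly_mult [simp]: "bipoly (p * q) x t = bipoly p x t * bipoly q x t"
  and bipoly_diff [simp]: "bipoly (p - q) x t = bipoly p x t - bipoly q x t"
  and bipoly_const [simp]: "bipoly [:p0:] x t = poly p0 t"
  and bipoly_linear [simp]: "bipoly [:[:0, -1:], 1:] x t = x - t"
  by (simp_all add: bipoly_def)

text \<open>The outer variable of a \<open>bipoly\<close> is \<open>u p\<close>, and its
  coefficients are polynomials in \<open>u z\<close>; constant coefficients mean independence of
  \<open>z\<close>.\<close>

lemma bipoly_lift [simp]: "bipoly (map_poly (\<lambda>c. [:c:]) p) x t = poly p x"
proof -
  have "poly (map_poly (\<lambda>c. [:c:]) p) [:x:] = [:poly p x:]"
    by (induction p) (auto simp: map_poly_pCons)
  then show ?thesis by (simp add: bipoly_def)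
qed

lemma bipoly_one [simp]: "bipoly 1 x t = 1"
  by (simp add: bipoly_def)

context coord
begin

lemma near_poly:
  assumes "z1 \<noteq> P" "poly q (u z1) \<noteq> 0" shows "eventually (\<lambda>z. z \<noteq> P \<and> poly q (u z) \<noteq> 0) (near z1)"
proof -
  have "eventually (\<lambda>z. poly q (u z) \<in> - {0}) (punctured z1)"
    using poly_u_tendsto[OF assms(1)] assms(2) by (intro topological_tendstoD) auto
  moreover have "eventually (\<lambda>z. z \<noteq> P) (punctured z1)" by (rule eventually_neq_punctured)
  ultimately show ?thesis
    using assms unfolding eventually_near_iff by (auto elim: eventually_elim2)
qed

lemma near_regular:
  assumes "mero_map \<alpha>" "\<alpha> z1 \<noteq> None" "z1 \<noteq> P"
  shows "eventually (\<lambda>z. z \<noteq> P \<and> \<alpha> z \<noteq> None) (near z1)"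
proof -
  obtain A N q where q: "poly q (u z1) \<noteq> 0"
    and val: "\<And>z. z \<noteq> P \<Longrightarrow> poly q (u z) \<noteq> 0 \<Longrightarrow> \<alpha> z = Some (\<Sum>a\<in>A. (poly (N a) (u z) / poly q (u z)) *\<^sub>C a)"
    using assms by (rule mero_map_rational) blast
  show ?thesis using near_poly[OF assms(3) q] by (rule eventually_mono) (auto simp: val)
qed

lemma regular_family_const:
  fixes \<alpha> :: "'g::complex_vector mmap"
  assumes "\<alpha> \<in> vanishing_at P" "\<alpha> z1 \<noteq> None" "z1 \<noteq> P"
  shows "regular_family P u z1 (\<lambda>_. \<alpha>)"
proof -
  have m: "mero_map \<alpha>" using assms(1) by (simp add: vanishing_at_def)
  obtain A N q where A: "finite A" "poly q (u z1) \<noteq> 0"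
    "\<forall>\<^sub>F p in cofinite. val \<alpha> p = (\<Sum>a\<in>A. (poly (N a) (u p) / poly q (u p)) *\<^sub>C a)"
    using m assms(2,3) by (rule mero_map_rational) blast
  let ?l = "map_poly (\<lambda>c. [:c:])"
  have "\<alpha> = mext (\<lambda>p. \<Sum>a\<in>A. (bipoly (?l (N a)) (u p) (u z) / bipoly (?l q) (u p) (u z)) *\<^sub>C a)" for z
    using A(3) mero_map_eqI[OF mero_map_mext m] m
    by (simp add: mext_eqI vmero_cong[OF vmero_val[OF m] A(3)] eq_commute)
  then show ?thesis
    unfolding regular_family_def using A(1,2) assms(1)
    by (intro conjI exI[of _ A] exI[of _ "\<lambda>a. ?l (N a)"] exI[of _ "?l q"]) auto
qed

text \<open>Each member has a pole at \<open>p = z\<close>, but the denominator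
  \<open>u p - u z\<close> does not vanish identically on \<open>z = z1\<close>, and only that is
  excluded.\<close>

lemma regular_family_mfrac:
  fixes a :: "'g::complex_vector"
  assumes "z1 \<noteq> P"
  shows "regular_family P u z1 (\<lambda>z. mfrac u z a)"
proof -
  have "\<exists>x. x - u z1 \<noteq> 0" by (rule exI[of _ "u z1 + 1"]) simp
  then show ?thesis
    unfolding regular_family_def
    by (intro conjI exI[of _ "{a}"] exI[of _ "\<lambda>_. 1"] exI[of _ "[:[:0, -1:], 1:]"])
      (auto simp: mfrac_def[symmetric] vanishing_at_def mfrac_P)
qed

lemma regular_family_dd:
  fixes \<alpha> :: "'g::complex_vector mmap"
  assumes "\<alpha> \<in> vanishing_at P" "\<alpha> z1 \<noteq> None" "z1 \<noteq> P"
  obtains \<Lambda> where "regular_family P u z1 \<Lambda>" "eventually (\<lambda>z. \<Lambda> z = dd u z \<alpha>) (near z1)"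
proof -
  have m: "mero_map \<alpha>" "\<alpha> P = Some 0" using assms(1) by (simp_all add: vanishing_at_def)
  obtain A N q where A: "finite A" "poly q (u z1) \<noteq> 0"
    and ae: "\<forall>\<^sub>F p in cofinite. val \<alpha> p = (\<Sum>a\<in>A. (poly (N a) (u p) / poly q (u p)) *\<^sub>C a)"
    and val: "\<And>z. z \<noteq> P \<Longrightarrow> poly q (u z) \<noteq> 0 \<Longrightarrow> \<alpha> z = Some (\<Sum>a\<in>A. (poly (N a) (u z) / poly q (u z)) *\<^sub>C a)"
    using m(1) assms(2,3) by (rule mero_map_rational) blast
  let ?l = "map_poly (\<lambda>c. [:c:])"
  \<comment> \<open>Numerators of the difference quotient of \<open>N a / q\<close> over the common
    denominator \<open>(x - t) q(x) q(t)\<close>, with \<open>x = u p\<close> and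
    \<open>t = u z\<close>.\<close>
  define M where "M a = ?l (N a) * [:q:] - [:N a:] * ?l q" for a
  have q0: "q \<noteq> 0" using A(2) by auto
  define r where "r = [:[:0, -1:], 1:] * ?l q * [:q:]"
  have bM: "bipoly (M a) x t = poly (N a) x * poly q t - poly (N a) t * poly q x" for a x t
    by (simp only: M_def bipoly_diff bipoly_mult bipoly_lift bipoly_const)
  have br: "bipoly r x t = (x - t) * poly q x * poly q t" for x t
    by (simp only: r_def bipoly_mult bipoly_lift bipoly_const bipoly_linear)
  define \<Lambda> where "\<Lambda> z = mext (\<lambda>p. \<Sum>a\<in>A. (bipoly (M a) (u p) (u z) / bipoly r (u p) (u z)) *\<^sub>C a)" for z
  have eq: "\<Lambda> z = dd u z \<alpha>" if z: "z \<noteq> P" "poly q (u z) \<noteq> 0" for z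
  proof -
    have reg: "mero_map \<alpha>" "\<alpha> z \<noteq> None" "z \<noteq> P" using val[OF z] m(1) z by auto
    have "\<forall>\<^sub>F p in cofinite. (1 / (u p - u z)) *\<^sub>C (val \<alpha> p - val \<alpha> z) =
      (\<Sum>a\<in>A. (bipoly (M a) (u p) (u z) / bipoly r (u p) (u z)) *\<^sub>C a)"
      using ae u_neq_ae[OF reg] u_poly_ae[OF q0]
    proof eventually_elim
      case (elim p)
      note q = elim(3)
      have "(1 / (u p - u z)) *\<^sub>C (val \<alpha> p - val \<alpha> z) = (\<Sum>a\<in>A. (1 / (u p - u z)) *\<^sub>C
        ((poly (N a) (u p) / poly q (u p)) *\<^sub>C a - (poly (N a) (u z) / poly q (u z)) *\<^sub>C a))"
        by (simp add: elim(1) val[OF z] sum_subtractf[symmetric] complex_vector.scale_sum_right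
            del: scaleC_scaleC complex_vector.scale_scale)
      also have "\<dots> = (\<Sum>a\<in>A. (bipoly (M a) (u p) (u z) / bipoly r (u p) (u z)) *\<^sub>C a)"
      proof (intro sum.cong refl)
        fix a
        have "1 / (u p - u z) * (poly (N a) (u p) / poly q (u p) - poly (N a) (u z) / poly q (u z)) =
          bipoly (M a) (u p) (u z) / bipoly r (u p) (u z)"
          using elim(2) q z(2) by (simp add: bM br divide_simps)
        then show "(1 / (u p - u z)) *\<^sub>C ((poly (N a) (u p) / poly q (u p)) *\<^sub>C a -
            (poly (N a) (u z) / poly q (u z)) *\<^sub>C a) = (bipoly (M a) (u p) (u z) / bipoly r (u p) (u z)) *\<^sub>C a"
          by (metis complex_vector.scale_left_diff_distrib scaleC_scaleC)
      qed
      finally show ?case .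
    qed
    then show ?thesis unfolding \<Lambda>_def dd_def by (rule mext_cong[OF vmero_dd[OF reg], symmetric])
  qed
  have ev: "eventually (\<lambda>z. \<Lambda> z = dd u z \<alpha>) (near z1)"
    using near_poly[OF assms(3) A(2)] by (rule eventually_mono) (auto simp: eq)
  have "\<exists>x. bipoly r x (u z1) \<noteq> 0"
  proof -
    have "[:- u z1, 1:] * q \<noteq> 0" using q0 by (simp only: mult_eq_0_iff) simp
    then obtain x where "poly ([:- u z1, 1:] * q) x \<noteq> 0" using poly_all_0_iff_0 by blast
    then show ?thesis using A(2) by (intro exI[of _ x]) (auto simp: br poly_mult simp del: mult_pCons_left)
  qed
  moreover have "eventually (\<lambda>z. \<Lambda> z \<in> vanishing_at P) (near z1)"
    using near_poly[OF assms(3) A(2)]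
  proof (rule eventually_mono)
    fix z assume z: "z \<noteq> P \<and> poly q (u z) \<noteq> 0"
    then have reg: "mero_map \<alpha>" "\<alpha> z \<noteq> None" "z \<noteq> P" using val[of z] m(1) by auto
    show "\<Lambda> z \<in> vanishing_at P"
      using z mero_map_dd[OF reg] dd_P[OF reg m(2)] by (simp add: eq vanishing_at_def)
  qed
  ultimately have "regular_family P u z1 \<Lambda>"
    unfolding regular_family_def eventually_near
    by (intro conjI exI[of _ A] exI[of _ M] exI[of _ r]) (auto simp: A(1) \<Lambda>_def)
  then show thesis using ev by (rule that)
qed

lemma regular_coeffI:
  "poly q (u z1) \<noteq> 0 \<Longrightarrow> regular_coeff u z1 (\<lambda>z. poly N (u z) / poly q (u z))"
  unfolding regular_coeff_def by blast

lemma regular_coeff_const: "regular_coeff u z1 (\<lambda>_. c)"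
  using regular_coeffI[of 1 z1 "[:c:]"] by simp

lemma regular_coeff_mult: "regular_coeff u z1 r \<Longrightarrow> regular_coeff u z1 s \<Longrightarrow> regular_coeff u z1 (\<lambda>z. r z * s z)"
  unfolding regular_coeff_def
  by (elim exE conjE, rule_tac x = "a * aa" in exI, rule_tac x = "b * ba" in exI) simp

lemma regular_coeff_linear: "regular_coeff u z1 (\<lambda>z. c + d * u z)"
  using regular_coeffI[of 1 z1 "[:c, d:]"] by (simp add: mult.commute)

lemma regular_coeff_frac: "b \<noteq> u z1 \<Longrightarrow> regular_coeff u z1 (\<lambda>z. c / (u z - b))"
  using regular_coeffI[of "[:-b, 1:]" z1 "[:c:]"] by simp

lemma form_rational:
  fixes \<alpha> :: "'g::quadratic_lie_algebra mmap"
  assumes "mero_map \<alpha>" "\<alpha> z1 \<noteq> None" "z1 \<noteq> P"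
  obtains M q where "poly q (u z1) \<noteq> 0"
    "\<And>z. z \<noteq> P \<Longrightarrow> poly q (u z) \<noteq> 0 \<Longrightarrow> \<alpha> z \<noteq> None \<and> form a (val \<alpha> z) = poly M (u z) / poly q (u z)"
proof -
  obtain A N q where A: "poly q (u z1) \<noteq> 0"
    and val: "\<And>z. z \<noteq> P \<Longrightarrow> poly q (u z) \<noteq> 0 \<Longrightarrow> \<alpha> z = Some (\<Sum>b\<in>A. (poly (N b) (u z) / poly q (u z)) *\<^sub>C b)"
    using assms by (rule mero_map_rational) blast
  have "\<alpha> z \<noteq> None \<and> form a (val \<alpha> z) = poly (\<Sum>b\<in>A. smult (form a b) (N b)) (u z) / poly q (u z)"
    if "z \<noteq> P" "poly q (u z) \<noteq> 0" for z
    using clin_sum[OF clin_form_right, of a "\<lambda>b. (poly (N b) (u z) / poly q (u z)) *\<^sub>C b" A]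
    by (simp add: val[OF that] poly_sum sum_divide_distrib mult.commute)
  with A show thesis by (rule that)
qed

lemma regular_coeff_form:
  fixes \<alpha> :: "'g::quadratic_lie_algebra mmap"
  assumes "mero_map \<alpha>" "\<alpha> z1 \<noteq> None" "z1 \<noteq> P"
  obtains r where "regular_coeff u z1 r" "eventually (\<lambda>z. r z = form a (val \<alpha> z)) (near z1)"
proof -
  obtain M q where q: "poly q (u z1) \<noteq> 0"
    "\<And>z. z \<noteq> P \<Longrightarrow> poly q (u z) \<noteq> 0 \<Longrightarrow> \<alpha> z \<noteq> None \<and> form a (val \<alpha> z) = poly M (u z) / poly q (u z)"
    using assms by (rule form_rational) blast
  show thesis
    by (rule that[OF regular_coeffI[OF q(1)]])
      (use near_poly[OF assms(3) q(1)] q(2) in \<open>auto elim!: eventually_mono\<close>)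
qed

text \<open>At \<open>p = z\<close> the formula for the divided difference reads 0 / 0, so the value
  is obtained as a derivative with respect to \<open>u\<close>; numerator and denominator come from
  the quotient rule.\<close>

lemma regular_coeff_form_dd:
  fixes \<alpha> :: "'g::quadratic_lie_algebra mmap"
  assumes "mero_map \<alpha>" "\<alpha> z1 \<noteq> None" "z1 \<noteq> P"
  obtains r where "regular_coeff u z1 r" "eventually (\<lambda>z. r z = form a (val (dd u z \<alpha>) z)) (near z1)"
proof -
  obtain M q where q: "poly q (u z1) \<noteq> 0"
    and val: "\<And>z. z \<noteq> P \<Longrightarrow> poly q (u z) \<noteq> 0 \<Longrightarrow> \<alpha> z \<noteq> None \<and> form a (val \<alpha> z) = poly M (u z) / poly q (u z)"
    using assms by (rule form_rational) blast
  let ?N = "pderiv M * q - M * pderiv q"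
  have "poly ?N (u z) / poly (q * q) (u z) = form a (val (dd u z \<alpha>) z)"
    if z: "z \<noteq> P" "poly q (u z) \<noteq> 0" for z
  proof -
    have reg: "mero_map \<alpha>" "\<alpha> z \<noteq> None" "z \<noteq> P" using val[OF z] assms(1) z by auto
    have ev: "\<forall>\<^sub>F h in nhds 0. form a (val \<alpha> (chart z h)) = poly M (u (chart z h)) / poly q (u (chart z h))"
      using near_poly[OF z] val unfolding eventually_near by (auto elim!: eventually_mono)
    have "((\<lambda>h. poly M (u (chart z h)) / poly q (u (chart z h))) has_field_derivative
      (poly ?N (u z) / poly (q * q) (u z)) * diff_at u z) (at 0)"
      using z(2) by (auto intro!: derivative_eq_intros u_chart(3) z(1) DERIV_chain'[OF u_chart(3)[OF z(1)] poly_DERIV]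
          simp: field_simps)
    then have "diff_at (\<lambda>p. form a (val \<alpha> p)) z = (poly ?N (u z) / poly (q * q) (u z)) * diff_at u z"
      unfolding diff_at_def using DERIV_cong_ev[OF refl ev refl] by (intro DERIV_imp_deriv) auto
    then have "diff_at u z * form a (val (dd u z \<alpha>) z) = diff_at u z * (poly ?N (u z) / poly (q * q) (u z))"
      unfolding diff_at_form[OF reg] by (simp only: mult.commute)
    with u_chart(2)[OF z(1)] show ?thesis by (metis mult_left_cancel)
  qed
  then show thesis
    using q(1) near_poly[OF assms(3) q(1)]
    by (intro that[OF regular_coeffI[of "q * q" z1 ?N]]) (auto elim!: eventually_mono)
qed

end

section \<open>Limits\<close>

lemma dd_algebra:
  fixes b g :: "'v::complex_vector"
  shows "(d + e) *\<^sub>C (b + e *\<^sub>C g) - d *\<^sub>C b = e *\<^sub>C (d *\<^sub>C g + (b + e *\<^sub>C g))"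
  by (simp only: scaleC_add_left scaleC_add_right scaleC_scaleC mult.commute[of e d] add.assoc
      add_diff_cancel_left' add_diff_eq[symmetric] diff_add_eq[symmetric] add.left_commute[of "d *\<^sub>C b"]) (simp add: distrib_left scaleC_add_left ac_simps)

lemma dq_algebra:
  fixes x :: "'v::complex_vector"
  assumes "d \<noteq> 0"
  shows "(1 / d) *\<^sub>C ((l' + (d *\<^sub>C i + i2') - (d * f + (d * g + b)) *\<^sub>C x - (d *\<^sub>C m + m2))
      - (l + i2 - b *\<^sub>C x - m2)) =
    (1 / d) *\<^sub>C (l' - l) + (1 / d) *\<^sub>C (i2' - i2) + i - (g + f) *\<^sub>C x - m"
proof -
  have e: "(d * f + (d * g + b)) *\<^sub>C x = d *\<^sub>C ((g + f) *\<^sub>C x) + b *\<^sub>C x"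
    by (simp add: scaleC_add_left[symmetric] distrib_left ac_simps del: complex_vector.scale_left_distrib)
  have "(l' + (d *\<^sub>C i + i2') - (d * f + (d * g + b)) *\<^sub>C x - (d *\<^sub>C m + m2)) - (l + i2 - b *\<^sub>C x - m2) =
    (l' - l) + (i2' - i2) + (d *\<^sub>C i - d *\<^sub>C ((g + f) *\<^sub>C x) - d *\<^sub>C m)"
    unfolding e by (simp only: diff_conv_add_uminus minus_add_distrib minus_minus ac_simps) simp
  also have "\<dots> = (l' - l) + (i2' - i2) + d *\<^sub>C (i - (g + f) *\<^sub>C x - m)"
    by (simp only: complex_vector.scale_right_diff_distrib)
  finally show ?thesis
    using assms by (simp only: scaleC_add_right scaleC_scaleC) (simp add: add_diff_eq)
qed

text \<open>The representatives allowed in \<open>tends\<close>, generated inductively.\<close>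

context field_coord
begin

inductive family :: "proj \<Rightarrow> (proj \<Rightarrow> ('g, 'w) ivec) \<Rightarrow> bool" for z1
  where
    family_zero: "family z1 (\<lambda>_. 0)"
  | family_term: "regular_coeff u z1 r \<Longrightarrow> (\<And>\<psi>. \<psi> \<in> set \<Psi> \<Longrightarrow> regular_family P u z1 \<psi>) \<Longrightarrow>
      w \<in> tuples n W \<Longrightarrow> family z1 R \<Longrightarrow>
      family z1 (\<lambda>z. r z *\<^sub>C bas (map (\<lambda>\<psi>. \<psi> z) \<Psi>) w + R z)"

text \<open>The given family is compared with \<open>R\<close> off \<open>z1\<close> only and may be
  singular at \<open>z1\<close>, as difference quotients are; the value there is supplied by
  \<open>y\<close>.\<close>

definition limit :: "proj \<Rightarrow> (proj \<Rightarrow> ('g, 'w) ivec) \<Rightarrow> ('g, 'w) ivec \<Rightarrow> bool"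
  where "limit z1 c y \<longleftrightarrow> (\<exists>R. family z1 R \<and> (\<forall>\<^sub>F z in punctured z1. cls (c z) = cls (R z)) \<and> cls y = cls (R z1))"

lemma family_sum:
  assumes "family z1 R"
  shows "\<exists>N r \<Lambda> w. (\<forall>i<(N::nat). regular_coeff u z1 (r i) \<and>
      (\<forall>\<psi>\<in>set (\<Lambda> i). regular_family P u z1 \<psi>) \<and> w i \<in> tuples n W) \<and>
    R = (\<lambda>z. (\<Sum>i<N. r i z *\<^sub>C bas (map (\<lambda>\<psi>. \<psi> z) (\<Lambda> i)) (w i)))"
  using assms
proof (induction rule: family.induct)
  case family_zero
  show ?case by (rule exI[of _ 0]) simp
next
  case (family_term r' \<Psi> w' R)
  then obtain N :: nat and r \<Lambda> w where N: "\<And>i. i < N \<Longrightarrow> regular_coeff u z1 (r i) \<and>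
      (\<forall>\<psi>\<in>set (\<Lambda> i). regular_family P u z1 \<psi>) \<and> w i \<in> tuples n W"
    "R = (\<lambda>z. \<Sum>i<N. r i z *\<^sub>C bas (map (\<lambda>\<psi>. \<psi> z) (\<Lambda> i)) (w i))" by blast
  show ?case
  proof (intro exI[of _ "Suc N"] exI[of _ "r(N := r')"] exI[of _ "\<Lambda>(N := \<Psi>)"] exI[of _ "w(N := w')"]
      conjI allI impI)
    fix i assume "i < Suc N"
    then show "regular_coeff u z1 ((r(N := r')) i)" "(w(N := w')) i \<in> tuples n W"
      using N(1) family_term by (auto simp: less_Suc_eq)
    show "\<forall>\<psi>\<in>set ((\<Lambda>(N := \<Psi>)) i). regular_family P u z1 \<psi>"
      using N(1) family_term.hyps \<open>i < Suc N\<close> by (auto simp: less_Suc_eq)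
  next
    show "(\<lambda>z. r' z *\<^sub>C bas (map (\<lambda>\<psi>. \<psi> z) \<Psi>) w' + R z) = (\<lambda>z. \<Sum>i<Suc N. (r(N := r')) i z *\<^sub>C
      bas (map (\<lambda>\<psi>. \<psi> z) ((\<Lambda>(N := \<Psi>)) i)) ((w(N := w')) i))"
      by (simp add: fun_eq_iff N(2) add.commute)
  qed
qed

lemma limit_imp_tends:
  assumes "limit z1 c y" shows "tends n W \<rho> P u z1 c y"
proof -
  obtain R where R: "family z1 R" "\<forall>\<^sub>F z in punctured z1. cls (c z) = cls (R z)" "cls y = cls (R z1)"
    using assms by (auto simp: limit_def)
  obtain N :: nat and r \<Lambda> w where N: "\<forall>i<N. regular_coeff u z1 (r i) \<and>
      (\<forall>\<psi>\<in>set (\<Lambda> i). regular_family P u z1 \<psi>) \<and> w i \<in> tuples n W"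
    and eq: "R = (\<lambda>z. \<Sum>i<N. r i z *\<^sub>C bas (map (\<lambda>\<psi>. \<psi> z) (\<Lambda> i)) (w i))"
    using family_sum[OF R(1)] by blast
  from R(2,3) N show ?thesis
    unfolding tends_def equiv_iff Let_def eventually_punctured eq by blast
qed

lemma limit_cong:
  assumes "limit z1 c y" "\<forall>\<^sub>F z in punctured z1. cls (c' z) = cls (c z)" "cls y' = cls y"
  shows "limit z1 c' y'"
proof -
  obtain R where R: "family z1 R" "\<forall>\<^sub>F z in punctured z1. cls (c z) = cls (R z)" "cls y = cls (R z1)"
    using assms(1) by (auto simp: limit_def)
  have "\<forall>\<^sub>F z in punctured z1. cls (c' z) = cls (R z)"
    using assms(2) R(2) by eventually_elim simp
  with R(1,3) assms(3) show ?thesis unfolding limit_def by auto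
qed

lemma family_add: "family z1 R \<Longrightarrow> family z1 S \<Longrightarrow> family z1 (\<lambda>z. R z + S z)"
  by (induction rule: family.induct) (auto simp: add.assoc intro: family.family_term)

lemma family_scale: "family z1 R \<Longrightarrow> regular_coeff u z1 s \<Longrightarrow> family z1 (\<lambda>z. s z *\<^sub>C R z)"
proof (induction rule: family.induct)
  case (family_term r \<Psi> w R)
  then show ?case
    using family.family_term[OF regular_coeff_mult[of z1 s r], of \<Psi> w "\<lambda>z. s z *\<^sub>C R z"]
    by (simp add: scaleC_add_right)
qed (simp add: family_zero)

lemma family_lmult: "family z1 R \<Longrightarrow> regular_family P u z1 \<Lambda> \<Longrightarrow> family z1 (\<lambda>z. lmult (\<Lambda> z) (R z))"
proof (induction rule: family.induct)
  case (family_term r \<Psi> w R)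
  then show ?case
    using family.family_term[of z1 r "\<Lambda> # \<Psi>" w "\<lambda>z. lmult (\<Lambda> z) (R z)"] by auto
qed (simp add: family_zero)

lemma limit_add:
  assumes "limit z1 c y" "limit z1 c' y'" shows "limit z1 (\<lambda>z. c z + c' z) (y + y')"
proof -
  obtain R where R: "family z1 R" "\<forall>\<^sub>F z in punctured z1. cls (c z) = cls (R z)" "cls y = cls (R z1)"
    using assms(1) by (auto simp: limit_def)
  obtain S where S: "family z1 S" "\<forall>\<^sub>F z in punctured z1. cls (c' z) = cls (S z)" "cls y' = cls (S z1)"
    using assms(2) by (auto simp: limit_def)
  have "\<forall>\<^sub>F z in punctured z1. cls (c z + c' z) = cls (R z + S z)"
    using R(2) S(2) by eventually_elim simp
  then show ?thesis
    unfolding limit_def using R(3) S(3) by (intro exI[of _ "\<lambda>z. R z + S z"]) (auto intro: family_add R S)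
qed

lemma limit_scale:
  assumes "limit z1 c y" "regular_coeff u z1 s" shows "limit z1 (\<lambda>z. s z *\<^sub>C c z) (s z1 *\<^sub>C y)"
proof -
  obtain R where R: "family z1 R" "\<forall>\<^sub>F z in punctured z1. cls (c z) = cls (R z)" "cls y = cls (R z1)"
    using assms(1) by (auto simp: limit_def)
  have "\<forall>\<^sub>F z in punctured z1. cls (s z *\<^sub>C c z) = cls (s z *\<^sub>C R z)"
    using R(2) by eventually_elim simp
  then show ?thesis
    unfolding limit_def using R(3)
    by (intro exI[of _ "\<lambda>z. s z *\<^sub>C R z"]) (auto intro: family_scale R assms)
qed

lemma limit_diff:
  assumes "limit z1 c y" "limit z1 c' y'" shows "limit z1 (\<lambda>z. c z - c' z) (y - y')"
  using limit_add[OF assms(1) limit_scale[OF assms(2) regular_coeff_const[of z1 "-1"]]]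
  by (simp add: complex_vector.scale_minus_left)

lemma limit_zero: "limit z1 (\<lambda>_. 0) 0"
  unfolding limit_def by (intro exI[of _ "\<lambda>_. 0"]) (auto intro: family_zero)

lemma limit_sum:
  "(\<And>i. i \<in> I \<Longrightarrow> limit z1 (c i) (y i)) \<Longrightarrow> limit z1 (\<lambda>z. \<Sum>i\<in>I. c i z) (\<Sum>i\<in>I. y i)"
  by (induction I rule: infinite_finite_induct) (auto intro: limit_zero limit_add)

lemma limit_lmult:
  assumes "limit z1 c y" "regular_family P u z1 \<Lambda>"
  shows "limit z1 (\<lambda>z. lmult (\<Lambda> z) (c z)) (lmult (\<Lambda> z1) y)"
proof -
  obtain R where R: "family z1 R" "\<forall>\<^sub>F z in punctured z1. cls (c z) = cls (R z)" "cls y = cls (R z1)"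
    using assms(1) by (auto simp: limit_def)
  have "eventually (\<lambda>z. mero_map (\<Lambda> z)) (near z1)"
    using assms(2) unfolding regular_family_def eventually_near
    by (auto simp: vanishing_at_def elim!: eventually_mono)
  then have m: "\<forall>\<^sub>F z in punctured z1. mero_map (\<Lambda> z)" "mero_map (\<Lambda> z1)" by (simp_all add: eventually_near_iff)
  have "\<forall>\<^sub>F z in punctured z1. cls (lmult (\<Lambda> z) (c z)) = cls (lmult (\<Lambda> z) (R z))"
    using R(2) m(1) by eventually_elim (rule lmult_cong)
  moreover have "cls (lmult (\<Lambda> z1) y) = cls (lmult (\<Lambda> z1) (R z1))"
    using m(2) R(3) by (rule lmult_cong)
  ultimately show ?thesis
    unfolding limit_def by (intro exI[of _ "\<lambda>z. lmult (\<Lambda> z) (R z)"]) (auto intro: family_lmult R assms)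
qed

lemma limit_tuple: "w \<in> tuples n W \<Longrightarrow> limit z1 (\<lambda>_. bas [] w) (bas [] w)"
  unfolding limit_def using family_term[OF regular_coeff_const[of z1 1], of "[]" w "\<lambda>_. 0"]
  by (intro exI[of _ "\<lambda>_. bas [] w"]) (auto intro: family_zero)

lemma limit_near:
  assumes "limit z1 c (c z1)" "\<forall>\<^sub>F z in near z1. cls (c' z) = cls (c z)"
  shows "limit z1 c' (c' z1)"
proof (rule limit_cong[OF assms(1)])
  show "\<forall>\<^sub>F z in punctured z1. cls (c' z) = cls (c z)" "cls (c' z1) = cls (c z1)"
    using assms(2) unfolding eventually_near_iff by blast+
qed

section \<open>Limits along words with fixed letters\<close>

context
  fixes z1 :: proj
  assumes z1P: "z1 \<noteq> P"
begin

lemma vanreg_family: "\<alpha> \<in> vanreg z1 \<Longrightarrow> regular_family P u z1 (\<lambda>_. \<alpha>)"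
  by (rule regular_family_const) (auto simp: vanreg_def regular_at_def z1P)

lemma limit_const: "x \<in> vecs n W (vanreg z1) \<Longrightarrow> limit z1 (\<lambda>_. x) x"
proof (induction rule: vecs_induct)
  case (lin c xs w y)
  have "limit z1 (\<lambda>_. bas xs w) (bas xs w)"
    using lin(1)
  proof (induction xs)
    case (Cons \<alpha> xs)
    then show ?case using limit_lmult[OF Cons.IH vanreg_family[of \<alpha>]] by simp
  qed (rule limit_tuple[OF lin(2)])
  from limit_add[OF limit_scale[OF this regular_coeff_const[of z1 c]] lin(3)] show ?case .
qed (rule limit_zero)

lemma limit_coeff_near:
  assumes "limit z1 c y" "regular_coeff u z1 r" "eventually (\<lambda>z. r z = s z) (near z1)"
  shows "limit z1 (\<lambda>z. s z *\<^sub>C c z) (s z1 *\<^sub>C y)"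
  using assms(3) by (intro limit_cong[OF limit_scale[OF assms(1,2)]])
    (auto simp: eventually_near_iff elim!: eventually_mono)

lemma limit_lmult_near:
  assumes "limit z1 c y" "regular_family P u z1 \<Lambda>" "eventually (\<lambda>z. \<Lambda> z = \<psi> z) (near z1)"
  shows "limit z1 (\<lambda>z. lmult (\<psi> z) (c z)) (lmult (\<psi> z1) y)"
  using assms(3) by (intro limit_cong[OF limit_lmult[OF assms(1,2)]])
    (auto simp: eventually_near_iff elim!: eventually_mono)

text \<open>The bracket with a constant commutes with divided differences, so the moving letter is
  the divided difference of the fixed map [a, \<alpha>].\<close>

lemma limit_lmult_dd:
  assumes "limit z1 c y" "\<alpha> \<in> vanreg z1"
  shows "limit z1 (\<lambda>z. lmult (mlie (mconst a) (dd u z \<alpha>)) (c z)) (lmult (mlie (mconst a) (dd u z1 \<alpha>)) y)"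
proof -
  note \<alpha> = vanregD[OF assms(2)]
  let ?\<beta> = "mlie (mconst a) \<alpha>"
  have \<beta>: "?\<beta> \<in> vanishing_at P" "?\<beta> z1 \<noteq> None" "mero_map ?\<beta>"
    using mlie_value[of "mconst a" \<alpha> P a 0] mlie_regular[of "mconst a" \<alpha> z1] mero_map_mlie[of "mconst a" \<alpha>] \<alpha>
    by (auto simp: vanishing_at_def)
  obtain \<Lambda> where \<Lambda>: "regular_family P u z1 \<Lambda>" "eventually (\<lambda>z. \<Lambda> z = dd u z ?\<beta>) (near z1)"
    using \<beta>(1,2) z1P by (rule regular_family_dd)
  have "dd u z ?\<beta> = mlie (mconst a) (dd u z \<alpha>)" if z: "z \<noteq> P" "\<alpha> z \<noteq> None" for z
  proof (rule mero_map_eqI)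
    obtain v where v: "\<alpha> z = Some v" using z(2) by blast
    have \<beta>z: "?\<beta> z = Some (lie a v)" using mlie_value[of "mconst a" \<alpha> z a v] \<alpha>(1) v by simp
    then have \<beta>': "mero_map ?\<beta>" "?\<beta> z \<noteq> None" "z \<noteq> P" using \<beta>(3) z by auto
    note \<alpha>' = \<alpha>(1) z(2,1)
    show "\<forall>\<^sub>F p in cofinite. val (dd u z ?\<beta>) p = val (mlie (mconst a) (dd u z \<alpha>)) p"
      using dd_ae[of ?\<beta> z, OF \<beta>'] dd_ae[OF \<alpha>'] mlie_ae[OF mero_map_mconst \<alpha>(1), of a]
        mlie_ae[OF mero_map_mconst mero_map_dd[OF \<alpha>'], of a]
      by eventually_elim (simp only: \<beta>z v mconst_val(2) option.sel lie_linear)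
    show "mero_map (dd u z ?\<beta>)" by (rule mero_map_dd[OF \<beta>'])
    show "mero_map (mlie (mconst a) (dd u z \<alpha>))" by (intro mero_map_mlie mero_map_mconst mero_map_dd \<alpha>')
  qed
  then have "eventually (\<lambda>z. dd u z ?\<beta> = mlie (mconst a) (dd u z \<alpha>)) (near z1)"
    using near_regular[OF \<alpha>(1,2) z1P] by (auto elim: eventually_mono)
  with \<Lambda>(2) have "eventually (\<lambda>z. \<Lambda> z = mlie (mconst a) (dd u z \<alpha>)) (near z1)"
    by eventually_elim simp
  with assms(1) \<Lambda>(1) show ?thesis by (rule limit_lmult_near)
qed

end

end

context field_point
begin

lemma near_field_point: "eventually (\<lambda>z'. field_point n W \<rho> \<zeta> u P z') (near z)"
proof -
  have "finite (insert P (\<zeta> ` {..<n}))" by simp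
  then have "eventually (\<lambda>z'. z' \<notin> insert P (\<zeta> ` {..<n})) cofinite" by (simp add: eventually_cofinite)
  then have "eventually (\<lambda>z'. z' \<notin> insert P (\<zeta> ` {..<n})) (near z)"
    using zP z by (auto simp: eventually_near_iff cofinite_imp_punctured)
  then show ?thesis
    by (rule eventually_mono) (unfold_locales, auto)
qed

lemma near_vecs:
  assumes "x \<in> vecs n W (vanreg z)" shows "eventually (\<lambda>z'. x \<in> vecs n W (vanreg z')) (near z)"
  using assms
proof (induction rule: vecs_induct)
  case zero
  show ?case by (simp add: vecs_iff)
next
  case (lin c xs w y)
  have "eventually (\<lambda>z'. xs \<in> lists (vanreg z')) (near z)"
    using lin(1)
  proof (induction xs)
    case (Cons \<alpha> xs)
    then have \<alpha>: "\<alpha> \<in> vanreg z" and IH: "eventually (\<lambda>z'. xs \<in> lists (vanreg z')) (near z)" by auto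
    have "eventually (\<lambda>z'. z' \<noteq> P \<and> \<alpha> z' \<noteq> None) (near z)"
      using vanregD[OF \<alpha>] zP by (intro near_regular)
    with IH show ?case
      by eventually_elim (use vanregD[OF \<alpha>] in \<open>auto intro!: vanregI\<close>)
  qed simp
  with lin(3) show ?case
    by eventually_elim (use lin(2) in \<open>auto intro!: vecs_subspace\<close>)
qed

lemma ihat_cons_at:
  assumes "field_point n W \<rho> \<zeta> u P z'" "\<alpha> \<in> vanreg z'" "x \<in> vecs n W (vanreg z')"
  shows "cls (ihat z' a (lmult \<alpha> x)) = cls (lmult \<alpha> (ihat z' a x) + ihat z' (lie a (val \<alpha> z')) x
    - form a (val (dd u z' \<alpha>) z') *\<^sub>C x - lmult (mlie (mconst a) (dd u z' \<alpha>)) x)"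
proof -
  interpret z': field_point n W \<rho> \<zeta> u P z' by fact
  show ?thesis
    using z'.ihat_cons[of \<alpha> x a] vanregD[OF assms(2)] vanreg_regular[OF assms(3)] by simp
qed

lemma clin_ihat_at:
  assumes "field_point n W \<rho> \<zeta> u P z'" "x \<in> Vec" shows "clin (\<lambda>a. cls (ihat z' a x))"
proof -
  interpret z': field_point n W \<rho> \<zeta> u P z' by fact
  show ?thesis using assms(2) by (rule z'.clin_ihat_left)
qed

text \<open>The letter \<open>\<alpha>(z)\<close> expands in constants with coefficients rational in \<open>u(z)\<close>.\<close>

lemma limit_ihat_value:
  assumes lim: "\<And>a. limit z (\<lambda>z'. ihat z' a x) (ihat z a x)" and x: "x \<in> Vec" and \<beta>: "\<beta> \<in> vanreg z"
  shows "limit z (\<lambda>z'. ihat z' (lie a (val \<beta> z')) x) (ihat z (lie a (val \<beta> z)) x)"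
proof -
  obtain A N q where q: "poly q (u z) \<noteq> 0"
    and val: "\<And>z. z \<noteq> P \<Longrightarrow> poly q (u z) \<noteq> 0 \<Longrightarrow> \<beta> z = Some (\<Sum>b\<in>A. (poly (N b) (u z) / poly q (u z)) *\<^sub>C b)"
    using vanregD(1,2)[OF \<beta>] zP by (rule mero_map_rational) blast
  let ?c = "\<lambda>z'. \<Sum>b\<in>A. (poly (N b) (u z') / poly q (u z')) *\<^sub>C ihat z' (lie a b) x"
  have "limit z ?c (?c z)"
    by (intro limit_sum limit_scale lim regular_coeffI q)
  moreover have "eventually (\<lambda>z'. cls (ihat z' (lie a (val \<beta> z')) x) = cls (?c z')) (near z)"
    using near_poly[OF zP q] near_field_point
  proof eventually_elim
    case (elim z')
    note c = clin_ihat_at[OF elim(2) x]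
    show ?case using elim(1)
      by (simp add: val clin_sum[OF clin_lie_right] clin_sum[OF c] clin_scale[OF c])
  qed
  ultimately show ?thesis by (rule limit_near)
qed

text \<open>The commutator formula holds for the same word at every nearby \<open>z'\<close>, and
  each coefficient and letter occurring in it is regular as a family in \<open>z'\<close>.\<close>

lemma limit_ihat_word:
  assumes "xs \<in> lists (vanreg z)" "w \<in> tuples n W"
  shows "limit z (\<lambda>z'. ihat z' a (bas xs w)) (ihat z a (bas xs w))"
  using assms(1)
proof (induction xs arbitrary: a)
  case Nil
  let ?c = "\<lambda>z'. \<Sum>k<n. (1 / (u z' - u (\<zeta> k))) *\<^sub>C bas [] (w(k := \<rho> k a (w k)))"
  have "u (\<zeta> k) \<noteq> u z" if "k < n" for k using u_inj[OF _ P[OF that] zP] z[OF that] by blast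
  then have "limit z ?c (?c z)"
    by (intro limit_sum limit_scale limit_tuple regular_coeff_frac tuples_rep assms) auto
  moreover have "eventually (\<lambda>z'. cls (ihat z' a (bas [] w)) = cls (?c z')) (near z)"
    using near_field_point
    by (rule eventually_mono) (simp add: field_point.ihat_nil[OF _ assms(2)])
  ultimately show ?case by (rule limit_near)
next
  case (Cons \<alpha> xs)
  then have \<alpha>: "\<alpha> \<in> vanreg z" and xs: "xs \<in> lists (vanreg z)" by auto
  let ?x = "bas xs w"
  have x: "?x \<in> vecs n W (vanreg z)" using xs assms(2) by auto
  note IH = Cons.IH
  let ?c = "\<lambda>z'. lmult \<alpha> (ihat z' a ?x) + ihat z' (lie a (val \<alpha> z')) ?x
    - form a (val (dd u z' \<alpha>) z') *\<^sub>C ?x - lmult (mlie (mconst a) (dd u z' \<alpha>)) ?x"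
  obtain r where r: "regular_coeff u z r" "eventually (\<lambda>z'. r z' = form a (val (dd u z' \<alpha>) z')) (near z)"
    using vanregD(1,2)[OF \<alpha>] zP by (rule regular_coeff_form_dd)
  have "limit z ?c (?c z)"
    by (intro limit_diff limit_add limit_lmult[OF IH vanreg_family[OF zP \<alpha>]]
        limit_ihat_value[OF IH vanreg_Vec[OF x] \<alpha>] limit_coeff_near[OF zP limit_const[OF zP x] r]
        limit_lmult_dd[OF zP limit_const[OF zP x] \<alpha>])
  moreover have "eventually (\<lambda>z'. cls (ihat z' a (bas (\<alpha> # xs) w)) = cls (?c z')) (near z)"
    using near_field_point near_vecs[OF x] near_regular[OF vanregD(1,2)[OF \<alpha>] zP]
  proof eventually_elim
    case (elim z')
    have "\<alpha> \<in> vanreg z'" using elim(3) vanregD[OF \<alpha>] by (intro vanregI) auto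
    from ihat_cons_at[OF elim(1) this elim(2), of a] show ?case by simp
  qed
  ultimately show ?case by (rule limit_near)
qed

lemma limit_ihat:
  assumes "x \<in> vecs n W (vanreg z)" shows "limit z (\<lambda>z'. ihat z' a x) (ihat z a x)"
  using assms
proof (induction rule: vecs_induct)
  case zero
  then show ?case by (simp add: clin_zero[OF clin_ihat] limit_zero)
next
  case (lin c xs w y)
  from limit_add[OF limit_scale[OF limit_ihat_word[OF lin(1,2)] regular_coeff_const[of z c]] lin(3)]
  show ?case by (simp add: clin_lin[OF clin_ihat])
qed

section \<open>The derivative of \<iota> as a limit of difference quotients\<close>

definition dq :: "'g \<Rightarrow> ('g, 'w) ivec \<Rightarrow> proj \<Rightarrow> ('g, 'w) ivec"
  where "dq a x z' = (1 / (u z' - u z)) *\<^sub>C (ihat z' a x - ihat z a x)"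

lemma clin_dq: "clin (\<lambda>x. dq a x z')"
  unfolding dq_def by (intro clin_fun clin_ihat)

text \<open>At \<open>p\<close>, the map \<open>dd u z' (dd u z \<alpha>)\<close> is the second
  divided difference on \<open>z\<close>, \<open>z'\<close>, \<open>p\<close>; the first equation
  expresses its symmetry.\<close>

lemma dd_dd:
  assumes \<alpha>: "\<alpha> \<in> vanreg z" and z': "z' \<noteq> P" "z' \<noteq> z" "\<alpha> z' \<noteq> None"
  shows "dd u z' \<alpha> = mlin (u z' - u z) (dd u z' (dd u z \<alpha>)) (dd u z \<alpha>)"
    and "val \<alpha> z' = (u z' - u z) *\<^sub>C val (dd u z \<alpha>) z' + val \<alpha> z"
    and "dd u z \<alpha> z' \<noteq> None"
proof -
  note \<alpha>z = vanregD(1,2)[OF \<alpha>] zP and \<alpha>' = vanregD(1)[OF \<alpha>] z'(3,1)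
  let ?\<beta> = "dd u z \<alpha>"
  have d: "u z' - u z \<noteq> 0" using u_inj[OF _ z'(1) zP] z'(2) by auto
  have v: "?\<beta> z' = Some ((1 / (u z' - u z)) *\<^sub>C (val \<alpha> z' - val \<alpha> z))"
    using dd_value[OF \<alpha>z z'] .
  then show "?\<beta> z' \<noteq> None" by simp
  then have \<beta>': "mero_map ?\<beta>" "?\<beta> z' \<noteq> None" "z' \<noteq> P" using mero_map_dd[OF \<alpha>z] z'(1) by auto
  show val: "val \<alpha> z' = (u z' - u z) *\<^sub>C val ?\<beta> z' + val \<alpha> z" using d by (simp add: v)
  show "dd u z' \<alpha> = mlin (u z' - u z) (dd u z' ?\<beta>) ?\<beta>"
  proof (rule mero_map_eqI)
    show "\<forall>\<^sub>F p in cofinite. val (dd u z' \<alpha>) p = val (mlin (u z' - u z) (dd u z' ?\<beta>) ?\<beta>) p"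
      using dd_ae[OF \<alpha>'] mlin_ae[OF mero_map_dd[OF \<beta>'] \<beta>'(1), of "u z' - u z"] dd_expand_ae[OF \<beta>']
        dd_expand_ae[OF \<alpha>z] u_neq_ae[OF \<alpha>']
    proof eventually_elim
      case (elim p)
      let ?d = "u z' - u z" and ?e = "u p - u z'" and ?g = "val (dd u z' ?\<beta>) p" and ?b = "val ?\<beta> z'"
      have "val \<alpha> p - val \<alpha> z' = (?d + ?e) *\<^sub>C (?b + ?e *\<^sub>C ?g) - ?d *\<^sub>C ?b"
        unfolding elim(4)[unfolded elim(3)] val by simp
      also have "\<dots> = ?e *\<^sub>C (?d *\<^sub>C ?g + (?b + ?e *\<^sub>C ?g))"
        by (rule dd_algebra)
      finally show ?case using elim(1,2,3,5) by simp
    qed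
  qed (intro mero_map_mlin mero_map_dd \<alpha>' \<beta>')+
qed

lemma dd_vanreg: "\<alpha> \<in> vanreg z \<Longrightarrow> dd u z \<alpha> \<in> vanreg z"
  using vanregD zP by (intro vanregI mero_map_dd dd_regular dd_P) auto

lemma dq_nil: "w \<in> tuples n W \<Longrightarrow> limit z (dq a (bas [] w)) (dhat z a (bas [] w))"
proof -
  assume w: "w \<in> tuples n W"
  have ne: "u (\<zeta> k) \<noteq> u z'" if "k < n" "field_point n W \<rho> \<zeta> u P z'" for k z'
  proof -
    interpret z': field_point n W \<rho> \<zeta> u P z' by fact
    show ?thesis using u_inj[OF _ P[OF that(1)] z'.zP] z'.z[OF that(1)] by blast
  qed
  \<comment> \<open>For \<open>b = u (\<zeta> k)\<close>, the difference of
    \<open>1 / (u z' - b)\<close> and \<open>1 / (u z - b)\<close> divided by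
    \<open>u z' - u z\<close> is \<open>-1 / ((u z - b) (u z' - b))\<close>.\<close>
  let ?c = "\<lambda>z'. \<Sum>k<n. (- (1 / (u z - u (\<zeta> k))) / (u z' - u (\<zeta> k))) *\<^sub>C bas [] (w(k := \<rho> k a (w k)))"
  have "limit z ?c (?c z)"
    using ne field_point_axioms
    by (intro limit_sum limit_scale limit_tuple regular_coeff_frac tuples_rep w) auto
  then show ?thesis
  proof (rule limit_cong)
    have "eventually (field_point n W \<rho> \<zeta> u P) (punctured z)"
      using near_field_point by (simp add: eventually_near_iff)
    then show "\<forall>\<^sub>F z' in punctured z. cls (dq a (bas [] w) z') = cls (?c z')"
      using eventually_neq_punctured[of z z]
    proof eventually_elim
      case (elim z')
      interpret z': field_point n W \<rho> \<zeta> u P z' by fact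
      have d: "u z' - u z \<noteq> 0" using u_inj[OF _ z'.zP zP] elim(2) by auto
      have "(1 / (u z' - u z)) *\<^sub>C ((1 / (u z' - u (\<zeta> k))) *\<^sub>C v - (1 / (u z - u (\<zeta> k))) *\<^sub>C v) =
        (- (1 / (u z - u (\<zeta> k))) / (u z' - u (\<zeta> k))) *\<^sub>C v" if "k < n" for k and v :: "('g, 'w) ivec"
      proof -
        have "1 / (u z' - u z) * (1 / (u z' - u (\<zeta> k)) - 1 / (u z - u (\<zeta> k))) =
          - (1 / (u z - u (\<zeta> k))) / (u z' - u (\<zeta> k))"
          using d ne[OF that elim(1)] ne[OF that field_point_axioms] by (simp add: divide_simps)
        then show ?thesis by (metis complex_vector.scale_left_diff_distrib scaleC_scaleC)
      qed
      then show ?case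
        by (simp add: dq_def z'.ihat_nil[OF w] ihat_nil[OF w] sum_subtractf[symmetric]
            complex_vector.scale_sum_right del: scaleC_scaleC complex_vector.scale_scale
            cong: sum.cong_simp)
    qed
    have "- (1 / (u (\<zeta> k) - u z)\<^sup>2) = - (1 / (u z - u (\<zeta> k))) / (u z - u (\<zeta> k))" for k
      by (simp add: power2_eq_square algebra_simps)
    then show "cls (dhat z a (bas [] w)) = cls (?c z)"
      by (simp add: dhat_nil[OF w])
  qed
qed

text \<open>The commutator formulas at \<open>z'\<close> and at \<open>z\<close> are subtracted; by
  \<open>dd_dd\<close> the difference of each pair of corresponding coefficients or letters is
  divisible by \<open>u z' - u z\<close>.\<close>

lemma dq_cons:
  assumes \<alpha>: "\<alpha> \<in> vanreg z" and x: "x \<in> vecs n W (vanreg z)"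
    and IH: "\<And>a. limit z (dq a x) (dhat z a x)"
  shows "limit z (dq a (lmult \<alpha> x)) (dhat z a (lmult \<alpha> x))"
proof -
  let ?\<beta> = "dd u z \<alpha>"
  let ?\<gamma> = "dd u z ?\<beta>"
  note \<beta> = dd_vanreg[OF \<alpha>]
  note \<gamma> = dd_vanreg[OF \<beta>]
  let ?c = "\<lambda>z'. lmult \<alpha> (dq a x z') + dq (lie a (val \<alpha> z)) x z' + ihat z' (lie a (val ?\<beta> z')) x
    - (form a (val ?\<gamma> z') *\<^sub>C x + form a (val (dd u z' ?\<beta>) z') *\<^sub>C x)
    - lmult (mlie (mconst a) (dd u z' ?\<beta>)) x"
  \<comment> \<open>The two form coefficients of the family tend to the same value, which accounts
    for the factor 2 in \<open>dhat_cons\<close>.\<close>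
  let ?y = "lmult \<alpha> (dhat z a x) + dhat z (lie a (val \<alpha> z)) x + ihat z (lie a (val ?\<beta> z)) x
    - (form a (val ?\<gamma> z) *\<^sub>C x + form a (val ?\<gamma> z) *\<^sub>C x)
    - lmult (mlie (mconst a) ?\<gamma>) x"
  obtain r where r: "regular_coeff u z r" "eventually (\<lambda>z'. r z' = form a (val ?\<gamma> z')) (near z)"
    using vanregD(1,2)[OF \<gamma>] zP by (rule regular_coeff_form)
  obtain s where s: "regular_coeff u z s" "eventually (\<lambda>z'. s z' = form a (val (dd u z' ?\<beta>) z')) (near z)"
    using vanregD(1,2)[OF \<beta>] zP by (rule regular_coeff_form_dd)
  have "limit z ?c ?y"
    by (intro limit_diff limit_add limit_lmult[OF IH vanreg_family[OF zP \<alpha>]] IH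
        limit_ihat_value[OF limit_ihat[OF x] vanreg_Vec[OF x] \<beta>] limit_coeff_near[OF zP limit_const[OF zP x] r]
        limit_coeff_near[OF zP limit_const[OF zP x] s] limit_lmult_dd[OF zP limit_const[OF zP x] \<beta>])
  then show ?thesis
  proof (rule limit_cong)
    show "cls (dhat z a (lmult \<alpha> x)) = cls ?y"
      using dhat_cons[OF vanregD(1,2)[OF \<alpha>] vanreg_regular[OF x], of a]
      by (simp add: scaleC_add_left[symmetric] del: complex_vector.scale_left_distrib)
    have "eventually (\<lambda>z'. field_point n W \<rho> \<zeta> u P z') (punctured z)"
      "eventually (\<lambda>z'. x \<in> vecs n W (vanreg z')) (punctured z)"
      "eventually (\<lambda>z'. z' \<noteq> P \<and> \<alpha> z' \<noteq> None) (punctured z)"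
      using near_field_point near_vecs[OF x] near_regular[OF vanregD(1,2)[OF \<alpha>] zP]
      by (simp_all add: eventually_near_iff)
    then show "\<forall>\<^sub>F z' in punctured z. cls (dq a (lmult \<alpha> x) z') = cls (?c z')"
      using eventually_neq_punctured[of z z]
    proof eventually_elim
      case (elim z')
      interpret z': field_point n W \<rho> \<zeta> u P z' by fact
      let ?d = "u z' - u z"
      have d: "?d \<noteq> 0" using u_inj[OF _ z'.zP zP] elim(4) by auto
      have \<alpha>': "\<alpha> \<in> vanreg z'" using elim(3) vanregD[OF \<alpha>] by (intro vanregI) auto
      note da = dd_dd[OF \<alpha> z'.zP elim(4) vanregD(2)[OF \<alpha>']]
      have \<beta>': "?\<beta> \<in> vanreg z'" using da(3) vanregD[OF \<beta>] by (intro vanregI) auto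
      note db = dd_dd[OF \<beta> z'.zP elim(4) vanregD(2)[OF \<beta>']]
      note m = vanregD(1)[OF z'.dd_vanreg[OF \<beta>']] vanregD(1)[OF \<beta>]
      have v: "val (dd u z' \<alpha>) z' = ?d *\<^sub>C val (dd u z' ?\<beta>) z' + val ?\<beta> z'"
      proof -
        obtain p q where "dd u z' ?\<beta> z' = Some p" "?\<beta> z' = Some q"
          using vanregD(2)[OF z'.dd_vanreg[OF \<beta>']] vanregD(2)[OF \<beta>'] by blast
        then show ?thesis using mlin_value[OF m] by (simp add: da(1))
      qed
      note V = vanreg_Vec[OF x]
      note c = clin_ihat_at[OF elim(1) V]
      have i: "cls (ihat z' (lie a (val \<alpha> z')) x) = ?d *\<^sub>C cls (ihat z' (lie a (val ?\<beta> z')) x)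
          + cls (ihat z' (lie a (val \<alpha> z)) x)"
        unfolding da(2) by (simp add: clin_add[OF c] clin_scale[OF c])
      have l: "cls (lmult (mlie (mconst a) (dd u z' \<alpha>)) x) =
          ?d *\<^sub>C cls (lmult (mlie (mconst a) (dd u z' ?\<beta>)) x) + cls (lmult (mlie (mconst a) ?\<beta>) x)"
        unfolding da(1) mlie_mlin_right[OF mero_map_mconst m]
        by (intro cls_mlin mero_map_mlie mero_map_mconst m V)
      have f: "form a (val (dd u z' \<alpha>) z') =
          ?d * form a (val (dd u z' ?\<beta>) z') + (?d * form a (val ?\<gamma> z') + form a (val ?\<beta> z))"
        unfolding v using arg_cong[OF db(2), of "form a"] by simp
      have "cls (dq a (lmult \<alpha> x) z') = (1 / ?d) *\<^sub>C (cls (ihat z' a (lmult \<alpha> x)) - cls (ihat z a (lmult \<alpha> x)))"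
        by (simp add: dq_def)
      also have "\<dots> = (1 / ?d) *\<^sub>C (
          (cls (lmult \<alpha> (ihat z' a x)) + (?d *\<^sub>C cls (ihat z' (lie a (val ?\<beta> z')) x)
          + cls (ihat z' (lie a (val \<alpha> z)) x)) - (?d * form a (val (dd u z' ?\<beta>) z') +
            (?d * form a (val ?\<gamma> z') + form a (val ?\<beta> z))) *\<^sub>C cls x
          - (?d *\<^sub>C cls (lmult (mlie (mconst a) (dd u z' ?\<beta>)) x) + cls (lmult (mlie (mconst a) ?\<beta>) x)))
          - (cls (lmult \<alpha> (ihat z a x)) + cls (ihat z (lie a (val \<alpha> z)) x)
          - form a (val ?\<beta> z) *\<^sub>C cls x - cls (lmult (mlie (mconst a) ?\<beta>) x)))"
        unfolding ihat_cons_at[OF elim(1) \<alpha>' elim(2)] ihat_cons_at[OF field_point_axioms \<alpha> x]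
          cls_linear i l f ..
      also have "\<dots> = cls (?c z')"
        unfolding dq_algebra[OF d] by (simp add: dq_def scaleC_add_left)
      finally show ?case .
    qed
  qed
qed

lemma limit_dq:
  assumes "x \<in> vecs n W (vanreg z)" shows "limit z (dq a x) (dhat z a x)"
  using assms
proof (induction rule: vecs_induct)
  case zero
  then show ?case by (simp add: clin_zero[OF clin_dhat] clin_zero[OF clin_dq] limit_zero)
next
  case (lin c xs w y)
  have "limit z (dq a (bas xs w)) (dhat z a (bas xs w))" for a
    using lin(1)
  proof (induction xs arbitrary: a)
    case Nil
    then show ?case using dq_nil[OF lin(2)] by blast
  next
    case (Cons \<alpha> xs)
    then show ?case using dq_cons[of \<alpha> "bas xs w" a] lin(2) by auto
  qed
  from limit_add[OF limit_scale[OF this regular_coeff_const[of z c]] lin(3)]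
  show ?case by (simp add: clin_lin[OF clin_dhat] clin_lin[OF clin_dq])
qed

end

section \<open>The field\<close>

text \<open>The chart parameter at \<open>z\<close> trivializes the fibre of the canonical bundle,
  so its inverse, realized globally by \<open>kfun z\<close>, gives the field without reference to
  \<open>P\<close> or \<open>u\<close>.\<close>

definition kmap :: "proj \<Rightarrow> 'g::complex_vector \<Rightarrow> 'g mmap"
  where "kmap z a = mext (\<lambda>p. kfun z p *\<^sub>C a)"

lemma mero_map_kmap: "mero_map (kmap z a)"
  and kmap_ae: "\<forall>\<^sub>F p in cofinite. val (kmap z a) p = kfun z p *\<^sub>C a"
  unfolding kmap_def by (rule mero_map_mext mext_ae, rule vmero_scale_const, rule amero_kfun)+

lemma mres_mconst_left: "mero_map \<alpha> \<Longrightarrow> mres z (mconst c) \<alpha> = 0"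
proof -
  assume "mero_map \<alpha>"
  have "pair_deriv z (\<lambda>_. c) (val \<alpha>) = deriv (\<lambda>k. form c (val \<alpha> (chart z k)))"
    by (simp add: pair_deriv_def fun_eq_iff)
  then show ?thesis
    using residue_deriv[OF form_meromorphic[OF vmero_val[OF \<open>mero_map \<alpha>\<close>]]]
    by (simp add: mres_def res_def)
qed

lemma relators_mono: assumes "L \<subseteq> L'" shows "relators n W \<rho> L \<subseteq> relators n W \<rho> L'"
proof
  have l: "lists L \<subseteq> lists L'" using assms by (rule lists_mono)
  fix r assume "r \<in> relators n W \<rho> L"
  then show "r \<in> relators n W \<rho> L'"
  proof (cases rule: relator_cases)
    case (letter c \<beta> \<gamma> xs ys w)
    with assms l have "\<beta> \<in> L'" "\<gamma> \<in> L'" "xs \<in> lists L'" "ys \<in> lists L'" by blast+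
    then show ?thesis unfolding letter(1) using letter(6) by (intro relatorI)
  next
    case (bracket \<beta> \<gamma> xs ys w)
    with assms l have "\<beta> \<in> L'" "\<gamma> \<in> L'" "xs \<in> lists L'" "ys \<in> lists L'" by blast+
    then show ?thesis unfolding bracket(1) using bracket(6) by (intro relatorI)
  next
    case (vector c a b k xs w)
    with assms l have "xs \<in> lists L'" by blast
    then show ?thesis unfolding vector(1) using vector(2-4,6) by (intro relatorI)
  next
    case (const c xs w)
    with assms l have "mconst c \<in> L'" "xs \<in> lists L'" by blast+
    then show ?thesis unfolding const(1) using const(4) by (intro relatorI)
  qed
qed

text \<open>By \<open>frac_eq_kfun\<close> each of the two quotients is \<open>kfun z\<close> plus a
  constant.\<close>

lemma moebius_relation:
  assumes "coordinate u P" "coordinate t Q" "z \<noteq> P" "z \<noteq> Q"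
  obtains \<kappa> where "\<And>p. p \<noteq> P \<Longrightarrow> p \<noteq> Q \<Longrightarrow> p \<noteq> z \<Longrightarrow>
    diff_at u z / (u p - u z) = diff_at t z / (t p - t z) + \<kappa>"
proof -
  interpret U: coord u P by (rule coord.intro) fact
  interpret T: coord t Q by (rule coord.intro) fact
  obtain \<kappa> where "\<And>p. p \<noteq> P \<Longrightarrow> p \<noteq> z \<Longrightarrow> diff_at u z / (u p - u z) = kfun z p + \<kappa>"
    using U.frac_eq_kfun[OF assms(3)] by metis
  moreover obtain \<mu> where "\<And>p. p \<noteq> Q \<Longrightarrow> p \<noteq> z \<Longrightarrow> diff_at t z / (t p - t z) = kfun z p + \<mu>"
    using T.frac_eq_kfun[OF assms(4)] by metis
  ultimately show thesis by (intro that[of "\<kappa> - \<mu>"]) simp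
qed

text \<open>Solving the relation for \<open>u p\<close> exhibits \<open>u\<close> as a fractional
  linear function of \<open>t\<close>; \<open>E\<close> is its denominator at \<open>w\<close>, and
  the quotient rule gives the differential there.\<close>

lemma moebius_differential:
  assumes "coordinate u P" "coordinate t Q" "z \<noteq> P" "z \<noteq> Q"
    and \<kappa>: "\<And>p. p \<noteq> P \<Longrightarrow> p \<noteq> Q \<Longrightarrow> p \<noteq> z \<Longrightarrow>
      diff_at u z / (u p - u z) = diff_at t z / (t p - t z) + \<kappa>"
    and w: "w \<noteq> P" "w \<noteq> Q" "w \<noteq> z"
  defines "E \<equiv> diff_at t z + \<kappa> * (t w - t z)"
  shows "E \<noteq> 0" "u w - u z = diff_at u z * (t w - t z) / E"
    "diff_at u w = diff_at u z * diff_at t z * diff_at t w / E\<^sup>2"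
proof -
  interpret U: coord u P by (rule coord.intro) fact
  interpret T: coord t Q by (rule coord.intro) fact
  let ?E = "\<lambda>p. diff_at t z + \<kappa> * (t p - t z)"
  note d = U.u_chart(2)[OF assms(3)] T.u_chart(2)[OF assms(4)]
  have *: "?E p \<noteq> 0" "u p - u z = diff_at u z * (t p - t z) / ?E p"
    if p: "p \<noteq> P" "p \<noteq> Q" "p \<noteq> z" for p
  proof -
    have n: "u p - u z \<noteq> 0" "t p - t z \<noteq> 0"
      using U.u_inj[of p z] T.u_inj[of p z] p assms(3,4) by auto
    have "diff_at u z / (u p - u z) = ?E p / (t p - t z)"
      using \<kappa>[OF p] n(2) by (simp add: add_divide_distrib)
    then have e: "diff_at u z * (t p - t z) = ?E p * (u p - u z)"
      using n by (simp add: frac_eq_eq)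
    with d(1) n show nz: "?E p \<noteq> 0" by (metis mult_eq_0_iff)
    from e nz show "u p - u z = diff_at u z * (t p - t z) / ?E p" by (simp add: eq_divide_eq mult.commute)
  qed
  show E: "E \<noteq> 0" "u w - u z = diff_at u z * (t w - t z) / E"
    unfolding E_def using *[OF w] by auto
  have "eventually (\<lambda>p. p \<notin> {P, Q, z}) cofinite" by (simp add: eventually_cofinite)
  then have "eventually (\<lambda>p. p \<notin> {P, Q, z}) (near w)"
    using w by (auto simp: eventually_near_iff cofinite_imp_punctured)
  then have ev: "\<forall>\<^sub>F h in nhds 0. u z + diff_at u z * (t (chart w h) - t z) / ?E (chart w h) = u (chart w h)"
    unfolding eventually_near by (rule eventually_mono) (use *(2) in \<open>auto simp: diff_eq_eq add.commute\<close>)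
  have "((\<lambda>h. u z + diff_at u z * (t (chart w h) - t z) / ?E (chart w h)) has_field_derivative
    diff_at u z * diff_at t z * diff_at t w / E\<^sup>2) (at 0)"
    using *(1)[OF w] T.u_chart(3)[OF w(2)]
    by (auto intro!: derivative_eq_intros simp: E_def power2_eq_square) (simp add: algebra_simps)
  then have "((\<lambda>h. u (chart w h)) has_field_derivative
    diff_at u z * diff_at t z * diff_at t w / E\<^sup>2) (at 0)"
    using DERIV_cong_ev[OF refl ev refl] by simp
  then show "diff_at u w = diff_at u z * diff_at t z * diff_at t w / E\<^sup>2"
    unfolding diff_at_def[of u w] by (rule DERIV_imp_deriv)
qed

lemma equiv_mod_mono:
  assumes "equiv_mod n W \<rho> (regular_at z) x y" shows "equiv_mod n W \<rho> all_maps x y"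
proof -
  have "relators n W \<rho> (regular_at z) \<subseteq> relators n W \<rho> all_maps"
    by (rule relators_mono) (auto simp: regular_at_def all_maps_def)
  with assms show ?thesis using complex_vector.span_mono unfolding equiv_mod_def by blast
qed

context mode_point
begin

lemma field_induces_linear: "induces_linear n W \<rho> (regular_at z) all_maps (mode z (kmap z a))"
  unfolding induces_linear_def equiv_iff
proof (intro conjI ballI allI impI)
  fix x :: "('g, 'w) ivec" assume "x \<in> vecs n W (regular_at z)"
  then show "mode z (kmap z a) x \<in> Vec" by (intro mode_Vec mero_map_kmap vecs_regular_Vec)
next
  fix x y :: "('g, 'w) ivec" assume "equiv_mod n W \<rho> (regular_at z) x y"
  then have "equiv_mod n W \<rho> all_maps x y" by (rule equiv_mod_mono)
  then show "cls (mode z (kmap z a) x) = cls (mode z (kmap z a) y)"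
    unfolding equiv_iff by (rule mode_cong[OF mero_map_kmap])
next
  fix c and x y :: "('g, 'w) ivec"
  show "cls (mode z (kmap z a) (c *\<^sub>C x + y)) = cls (c *\<^sub>C mode z (kmap z a) x + mode z (kmap z a) y)"
    by (simp add: clin_lin[OF clin_mode])
qed

end

context field_point
begin

text \<open>The map \<open>kmap z a\<close> differs from \<open>du a / (u - u z)\<close> by a
  constant map, which a mode does not see on words regular at \<open>z\<close>.\<close>

lemma mode_kmap:
  assumes "x \<in> vecs n W (regular_at z)"
  shows "cls (mode z (kmap z a) x) = diff_at u z *\<^sub>C cls (mode z (mfrac u z a) x)"
proof -
  obtain \<kappa> where \<kappa>: "\<And>p. p \<noteq> P \<Longrightarrow> p \<noteq> z \<Longrightarrow> diff_at u z / (u p - u z) = kfun z p + \<kappa>"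
    using frac_eq_kfun[OF zP] by metis
  let ?b = "diff_at u z *\<^sub>C a"
  have "eventually (\<lambda>p. p \<notin> {P, z}) cofinite" by (simp add: eventually_cofinite)
  then have "\<forall>\<^sub>F p in cofinite. (- \<kappa>) *\<^sub>C a = val (kmap z a) p - val (mfrac u z ?b) p"
    using kmap_ae[of z a] mfrac_ae[of z ?b]
  proof eventually_elim
    case (elim p)
    have "val (kmap z a) p - val (mfrac u z ?b) p = (kfun z p - diff_at u z / (u p - u z)) *\<^sub>C a"
      by (simp add: elim(2,3) complex_vector.scale_left_diff_distrib mult.commute)
    also have "\<dots> = (- \<kappa>) *\<^sub>C a" using \<kappa>[of p] elim(1) by simp
    finally show ?case by simp
  qed
  from mode_cong_regular[OF mero_map_kmap mero_map_mfrac assms vlim_cong[OF vlim_const this]]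
  show ?thesis by (simp add: clin_scale[OF clin_mode_mfrac[OF vecs_regular_Vec[OF assms]]])
qed

lemma field_restricts:
  assumes "x \<in> vecs n W (vanreg z)"
  shows "cls (mode z (kmap z a) x) = cls (eps u z a x + iota n \<rho> \<zeta> u z a x)"
  by (simp add: mode_kmap[OF vanreg_regular[OF assms]] cls_iota[OF assms] eps_def ihat_def
      complex_vector.scale_right_diff_distrib)

lemma mlie_mconst_mfrac: "mlie (mconst a) (mfrac u w b) = mfrac u w (lie a b)"
proof (rule mero_map_eqI)
  show "\<forall>\<^sub>F p in cofinite. val (mlie (mconst a) (mfrac u w b)) p = val (mfrac u w (lie a b)) p"
    using mlie_ae[OF mero_map_mconst mero_map_mfrac, of a w b] mfrac_ae[of w b] mfrac_ae[of w "lie a b"]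
    by eventually_elim simp
qed (auto intro: mero_map_mlie)

text \<open>Serves for the letter left behind by the inner operator when it is met at the second
  point \<open>w\<close>: its divided difference has the same pole at \<open>z\<close>,
  rescaled.\<close>

lemma dd_mfrac:
  assumes w: "w \<noteq> P" "w \<noteq> z"
  shows "dd u w (mfrac u z b) = mfrac u z ((- (1 / (u w - u z))) *\<^sub>C b)"
proof (rule mero_map_eqI)
  have v: "mfrac u z b w = Some ((1 / (u w - u z)) *\<^sub>C b)" using mfrac_value[OF w(1) zP w(2)] .
  then have reg: "mero_map (mfrac u z b)" "mfrac u z b w \<noteq> None" "w \<noteq> P" using w by auto
  have d: "u w - u z \<noteq> 0" using u_inj[OF _ w(1) zP] w(2) by auto
  have "eventually (\<lambda>p. p \<notin> {P, z, w}) cofinite" by (simp add: eventually_cofinite)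
  then show "\<forall>\<^sub>F p in cofinite. val (dd u w (mfrac u z b)) p = val (mfrac u z ((- (1 / (u w - u z))) *\<^sub>C b)) p"
    using dd_ae[OF reg] mfrac_ae[of z b] mfrac_ae[of z "(- (1 / (u w - u z))) *\<^sub>C b"]
  proof eventually_elim
    case (elim p)
    have n: "u p - u z \<noteq> 0" "u p - u w \<noteq> 0" using u_inj[of p z] u_inj[of p w] elim(1) zP w by auto
    have "1 / (u p - u w) * (1 / (u p - u z) - 1 / (u w - u z)) = 1 / (u p - u z) * - (1 / (u w - u z))"
      using n d by (simp add: divide_simps)
    then show ?case unfolding elim(2-4) v option.sel
      by (metis complex_vector.scale_left_diff_distrib scaleC_scaleC)
  qed
  show "mero_map (dd u w (mfrac u z b))" by (rule mero_map_dd[OF reg])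
qed simp

text \<open>The pole of this letter at the auxiliary point \<open>p = z\<close> rules out
  \<open>regular_family_const\<close>, but its denominator does not involve the moving
  point.\<close>

lemma regular_family_mfrac_const: "regular_family P u z (\<lambda>_. mfrac u z a)"
proof -
  have "\<exists>x. x - u z \<noteq> 0" by (rule exI[of _ "u z + 1"]) simp
  moreover have "bipoly (map_poly (\<lambda>c. [:c:]) [:- u z, 1:]) x t = x - u z" for x t
    by (simp only: bipoly_lift) simp
  ultimately show ?thesis
    unfolding regular_family_def
    by (intro conjI exI[of _ "{a}"] exI[of _ "\<lambda>_. 1"] exI[of _ "map_poly (\<lambda>c. [:c:]) [:- u z, 1:]"])
      (auto simp: mfrac_def[symmetric] vanishing_at_def mfrac_P simp del: map_poly_pCons)
qed

lemma limit_lmult_mfrac: "y \<in> vecs n W (vanreg z) \<Longrightarrow>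
    limit z (\<lambda>_. lmult (mfrac u z a) y) (lmult (mfrac u z a) y)"
  by (rule limit_lmult[OF limit_const[OF zP] regular_family_mfrac_const])

text \<open>The words produced by \<open>mode\<close> contain principal parts, which may fail to
  vanish at \<open>P\<close>. Left multiplication plus \<open>iota_hat\<close> gives admissible
  words for the same class.\<close>

lemma limit_mode_const:
  assumes y: "y \<in> vecs n W (vanreg z)"
  shows "limit z (\<lambda>_. mode z (mfrac u z a) y) (mode z (mfrac u z a) y)"
proof -
  have "limit z (\<lambda>_. lmult (mfrac u z a) y + iota_hat n \<rho> \<zeta> u z a y) (lmult (mfrac u z a) y + iota_hat n \<rho> \<zeta> u z a y)"
    by (intro limit_add limit_lmult_mfrac limit_const[OF zP] iota_hat_vecs y)
  then show ?thesis
    by (rule limit_cong) (simp_all add: cls_iota_hat[OF y] ihat_def)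
qed

text \<open>The inner operator is represented by \<open>iota_hat\<close>, which keeps words in
  \<open>vanreg z\<close>; at \<open>w = z\<close> the five terms recombine by
  \<open>product_formula\<close>.\<close>

lemma limit_regular_part:
  fixes v1 v2 :: 'g
  assumes y: "y \<in> vecs n W (vanreg z)"
  defines "I \<equiv> iota_hat n \<rho> \<zeta> u z v1 y"
  shows "limit z (\<lambda>w. lmult (mfrac u w v2) (lmult (mfrac u z v1) y) + lmult (mfrac u w v2) I + ihat w v2 I
      + lmult (mfrac u z v1) (ihat w v2 y) + dq (lie v2 v1) y w)
    (mode z (mfrac u z v2) (mode z (mfrac u z v1) y))"
proof -
  have I: "I \<in> vecs n W (vanreg z)" "cls I = cls (ihat z v1 y)"
    unfolding I_def by (rule iota_hat_vecs[OF y], rule cls_iota_hat[OF y])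
  have "limit z (\<lambda>w. lmult (mfrac u w v2) (lmult (mfrac u z v1) y) + lmult (mfrac u w v2) I + ihat w v2 I
      + lmult (mfrac u z v1) (ihat w v2 y) + dq (lie v2 v1) y w)
    (lmult (mfrac u z v2) (lmult (mfrac u z v1) y) + lmult (mfrac u z v2) I + ihat z v2 I
      + lmult (mfrac u z v1) (ihat z v2 y) + dhat z (lie v2 v1) y)"
    by (intro limit_add limit_lmult[OF limit_lmult_mfrac[OF y] regular_family_mfrac[OF zP]]
        limit_lmult[OF limit_const[OF zP I(1)] regular_family_mfrac[OF zP]] limit_ihat[OF I(1)]
        limit_lmult[OF limit_ihat[OF y] regular_family_mfrac_const] limit_dq y)
  then show ?thesis
    by (rule limit_cong)
      (simp_all add: product_formula[OF y] ihat_cong[OF I(2)] lmult_cong[OF mero_map_mfrac I(2)])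
qed

text \<open>When \<open>ihat w v2\<close> is commuted past the letter \<open>v1 / (u - u z)\<close>,
  the value of the letter at \<open>w\<close> yields the bracket term with \<open>ihat w\<close>,
  its derivative the double pole, and its divided difference the left multiplication by
  \<open>[v2, v1] / (u - u z)\<close>. With \<open>ihat z\<close> in place of \<open>ihat w\<close>
  the two simple poles would form the field attached to [v2, v1] at \<open>z\<close>; the
  discrepancy is \<open>dq\<close>.\<close>

lemma two_point_product:
  fixes v1 v2 :: 'g
  assumes w: "field_point n W \<rho> \<zeta> u P w" "w \<noteq> z"
    and y: "y \<in> vecs n W (vanreg z)" "y \<in> vecs n W (vanreg w)"
  defines "I \<equiv> iota_hat n \<rho> \<zeta> u z v1 y"
  assumes I: "I \<in> vecs n W (vanreg w)"
  shows "cls (mode w (kmap w v2) (mode z (kmap z v1) y)) = (diff_at u z * diff_at u w) *\<^sub>C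
    (cls (lmult (mfrac u w v2) (lmult (mfrac u z v1) y) + lmult (mfrac u w v2) I + ihat w v2 I
      + lmult (mfrac u z v1) (ihat w v2 y))
     + (form v1 v2 / (u w - u z)\<^sup>2) *\<^sub>C cls y + (1 / (u w - u z)) *\<^sub>C cls (ihat w (lie v2 v1) y)
     + (1 / (u w - u z)) *\<^sub>C cls (lmult (mfrac u z (lie v2 v1)) y))"
proof -
  interpret w: field_point n W \<rho> \<zeta> u P w by fact
  let ?d = "u w - u z"
  have E: "mfrac u z v1 \<in> vanreg w" using mfrac_regular[OF zP w(2)] mfrac_P by (intro vanregI) auto
  have Ey: "lmult (mfrac u z v1) y \<in> vecs n W (vanreg w)" by (rule lmult_vecs[OF E y(2)])
  have V: "lmult (mfrac u z v1) y + I \<in> vecs n W (vanreg w)" using Ey I by (rule vecs_subspace)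
  note yV = vanreg_Vec[OF y(1)]
  have v: "val (mfrac u z v1) w = (1 / ?d) *\<^sub>C v1" using mfrac_value[OF w.zP zP w(2), of v1] by simp
  have "cls (mode z (kmap z v1) y) = cls (diff_at u z *\<^sub>C (lmult (mfrac u z v1) y + I))"
    using cls_iota_hat[OF y(1), of v1] by (simp add: mode_kmap[OF vanreg_regular[OF y(1)]] I_def ihat_def)
  from w.mode_cong[OF mero_map_kmap[of w v2] this]
  have 1: "cls (mode w (kmap w v2) (mode z (kmap z v1) y)) = (diff_at u z * diff_at u w) *\<^sub>C
    cls (mode w (mfrac u w v2) (lmult (mfrac u z v1) y + I))"
    by (simp only: mode_linear(2) cls_linear(2) w.mode_kmap[OF vanreg_regular[OF V]] scaleC_scaleC)
  have "mode w (mfrac u w v2) (lmult (mfrac u z v1) y + I) = lmult (mfrac u w v2) (lmult (mfrac u z v1) y)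
      + lmult (mfrac u w v2) I + ihat w v2 I + ihat w v2 (lmult (mfrac u z v1) y)"
    by (simp add: ihat_def)
  then have 2: "cls (mode w (mfrac u w v2) (lmult (mfrac u z v1) y + I)) =
    cls (lmult (mfrac u w v2) (lmult (mfrac u z v1) y) + lmult (mfrac u w v2) I + ihat w v2 I)
    + cls (ihat w v2 (lmult (mfrac u z v1) y))" by simp
  have m: "mfrac u z (lie v2 ((- (1 / ?d)) *\<^sub>C v1)) = mfrac u z ((- (1 / ?d)) *\<^sub>C lie v2 v1)" by simp
  have "val (mfrac u z ((- (1 / ?d)) *\<^sub>C v1)) w = (- (1 / ?d\<^sup>2)) *\<^sub>C v1"
    using mfrac_value[OF w.zP zP w(2), of "(- (1 / ?d)) *\<^sub>C v1"] by (simp add: power2_eq_square)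
  then have "cls (ihat w v2 (lmult (mfrac u z v1) y)) = cls (lmult (mfrac u z v1) (ihat w v2 y))
    + (1 / ?d) *\<^sub>C cls (ihat w (lie v2 v1) y) + (form v1 v2 / ?d\<^sup>2) *\<^sub>C cls y
    + (1 / ?d) *\<^sub>C cls (lmult (mfrac u z (lie v2 v1)) y)"
    using clin_scale[OF w.clin_ihat_left[OF yV], of "1 / ?d" "lie v2 v1"]
      clin_scale[OF clin_lmult_mfrac[OF yV, of z], of "- (1 / ?d)" "lie v2 v1"] form_sym[of v1 v2]
    unfolding ihat_cons_at[OF w(1) E y(2)] dd_mfrac[OF w.zP w(2)] mlie_mconst_mfrac v m
    by (simp add: complex_vector.scale_minus_left)
  then show ?thesis unfolding 1 2 by (simp add: algebra_simps)
qed

end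

section \<open>The limit in a second coordinate\<close>

lemma final_algebra:
  fixes y :: "'v::complex_vector"
  assumes "c * p = r" "c * m = r * f" "c * w * d = r * e - k"
  shows "c *\<^sub>C (p *\<^sub>C (b + f *\<^sub>C y + e *\<^sub>C i2 + e *\<^sub>C Y) - m *\<^sub>C y - w *\<^sub>C (d *\<^sub>C (Y + i1))) =
    r *\<^sub>C (b + e *\<^sub>C (i2 - i1)) + k *\<^sub>C (Y + i1)"
proof -
  have "c *\<^sub>C (p *\<^sub>C (b + f *\<^sub>C y + e *\<^sub>C i2 + e *\<^sub>C Y) - m *\<^sub>C y - w *\<^sub>C (d *\<^sub>C (Y + i1))) =
    (c * p) *\<^sub>C (b + f *\<^sub>C y + e *\<^sub>C i2 + e *\<^sub>C Y) - (c * m) *\<^sub>C y - (c * w * d) *\<^sub>C (Y + i1)"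
    by (simp only: complex_vector.scale_right_diff_distrib scaleC_scaleC mult.assoc)
  also have "\<dots> = r *\<^sub>C b + (r * e) *\<^sub>C i2 + (r * e) *\<^sub>C Y - ((r * e) *\<^sub>C (Y + i1) - k *\<^sub>C (Y + i1))"
    unfolding assms by (simp add: scaleC_add_right complex_vector.scale_left_diff_distrib)
  also have "\<dots> = r *\<^sub>C (b + e *\<^sub>C (i2 - i1)) + k *\<^sub>C (Y + i1)"
    by (simp add: scaleC_add_right complex_vector.scale_right_diff_distrib)
  finally show ?thesis .
qed

text \<open>A change of coordinate adds a constant map to \<open>v\<^sub>2 / (u - u(z))\<close>. On the product of two modes this
  is not negligible, the inner mode having a pole at \<open>z\<close>: it contributes a bracket.\<close>

lemma coordinate_change:
  fixes v1 v2 :: "'g::quadratic_lie_algebra" and W :: "nat \<Rightarrow> 'w::complex_vector set"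
  assumes U: "field_point n W \<rho> \<zeta> u P z" and T: "field_point n W \<rho> \<zeta> t Q z"
    and \<kappa>: "\<And>p. p \<noteq> P \<Longrightarrow> p \<noteq> Q \<Longrightarrow> p \<noteq> z \<Longrightarrow>
      diff_at u z / (u p - u z) = diff_at t z / (t p - t z) + \<kappa>"
    and y: "y \<in> vecs n W (field_coord.vanreg Q z)"
    and xy: "tensor_rep.cls n W \<rho> x = tensor_rep.cls n W \<rho> y"
  defines "cls \<equiv> tensor_rep.cls n W \<rho>" and "mode \<equiv> tensor_rep.mode n \<rho> \<zeta>"
  shows "(diff_at u z)\<^sup>2 *\<^sub>C cls (mode z (mfrac u z v2) (mode z (mfrac u z v1) x)) =
    (diff_at t z)\<^sup>2 *\<^sub>C cls (mode z (mfrac t z v2) (mode z (mfrac t z v1) y))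
    + (\<kappa> * diff_at t z) *\<^sub>C cls (mode z (mfrac t z (lie v2 v1)) y)"
proof -
  interpret U: field_point n W \<rho> \<zeta> u P z by fact
  interpret T: field_point n W \<rho> \<zeta> t Q z by fact
  let ?du = "diff_at u z" and ?dt = "diff_at t z" and ?Z = "U.mode z (mfrac t z v1) y"
  note yr = T.vanreg_regular[OF y]
  note yV = T.vanreg_Vec[OF y]
  have Z: "?Z \<in> U.Vec" by (intro U.mode_Vec T.mero_map_mfrac yV)
  have "?du *\<^sub>C U.cls (U.mode z (mfrac u z v1) x) = ?du *\<^sub>C U.cls (U.mode z (mfrac u z v1) y)"
    using U.mode_cong[OF U.mero_map_mfrac xy] by simp
  also have "\<dots> = ?dt *\<^sub>C U.cls ?Z"
    using U.mode_kmap[OF yr, of v1] T.mode_kmap[OF yr, of v1] by simp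
  finally have "U.cls (?du *\<^sub>C U.mode z (mfrac u z v1) x) = U.cls (?dt *\<^sub>C ?Z)" by simp
  from U.mode_cong[OF U.mero_map_mfrac[of z v2] this]
  have 1: "?du *\<^sub>C U.cls (U.mode z (mfrac u z v2) (U.mode z (mfrac u z v1) x)) =
    ?dt *\<^sub>C U.cls (U.mode z (mfrac u z v2) ?Z)" by simp
  have "mfrac u z (?du *\<^sub>C v2) = mlin ?dt (mfrac t z v2) (mconst (\<kappa> *\<^sub>C v2))"
  proof (rule mero_map_eqI)
    have "eventually (\<lambda>p. p \<notin> {P, Q, z}) cofinite" by (simp add: eventually_cofinite)
    then show "\<forall>\<^sub>F p in cofinite. val (mfrac u z (?du *\<^sub>C v2)) p =
        val (mlin ?dt (mfrac t z v2) (mconst (\<kappa> *\<^sub>C v2))) p"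
      using U.mfrac_ae[of z "?du *\<^sub>C v2"] T.mfrac_ae[of z v2]
        mlin_ae[OF T.mero_map_mfrac[of z v2] mero_map_mconst[of "\<kappa> *\<^sub>C v2"], of ?dt]
    proof eventually_elim
      case (elim p)
      have "(1 / (u p - u z)) *\<^sub>C ?du *\<^sub>C v2 = (?du / (u p - u z)) *\<^sub>C v2" by simp
      also have "\<dots> = ?dt *\<^sub>C (1 / (t p - t z)) *\<^sub>C v2 + \<kappa> *\<^sub>C v2"
        using \<kappa>[of p] elim(1) by (simp add: scaleC_add_left)
      finally show ?case unfolding elim(2-4) by (simp only: mconst_val(2) option.sel)
    qed
    show "mero_map (mlin ?dt (mfrac t z v2) (mconst (\<kappa> *\<^sub>C v2)))"
      by (intro mero_map_mlin T.mero_map_mfrac mero_map_mconst)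
  qed (rule U.mero_map_mfrac)
  then have 2: "?du *\<^sub>C U.cls (U.mode z (mfrac u z v2) ?Z) =
    ?dt *\<^sub>C U.cls (U.mode z (mfrac t z v2) ?Z) + U.cls (U.mode z (mconst (\<kappa> *\<^sub>C v2)) ?Z)"
    using clin_scale[OF U.clin_mode_mfrac[OF Z], of ?du v2]
      U.mode_mlin[OF T.mero_map_mfrac[of z v2] mero_map_mconst[of "\<kappa> *\<^sub>C v2"] Z, of ?dt] by simp
  let ?c = "mconst (\<kappa> *\<^sub>C v2)" and ?I = "iota_hat n \<rho> \<zeta> t z v1 y"
  have creg: "?c \<in> regular_at z" by (simp add: regular_at_def)
  have "U.cls ?Z = U.cls (lmult (mfrac t z v1) y + ?I)"
    using T.cls_iota_hat[OF y, of v1] by (simp add: T.ihat_def)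
  from U.mode_cong[OF mero_map_mconst[of "\<kappa> *\<^sub>C v2"] this]
  have c1: "U.cls (U.mode z ?c ?Z) = U.cls (U.mode z ?c (lmult (mfrac t z v1) y)) + U.cls (U.mode z ?c ?I)"
    by (simp del: mconst_val)
  have c2: "U.cls (U.mode z ?c ?I) = 0"
    by (rule U.mode_regular[OF creg T.vanreg_regular[OF T.iota_hat_vecs[OF y]]])
  \<comment> \<open>The inner letter is singular at \<open>z\<close>, so the constant leaves a
    bracket. There is no residue, because (c, d\<alpha>) is exact for constant
    \<open>c\<close>.\<close>
  have c3: "U.cls (U.mode z ?c (lmult (mfrac t z v1) y)) =
    U.cls (lmult (mfrac t z v1) (U.mode z ?c y)) + U.cls (U.mode z (mfrac t z (lie (\<kappa> *\<^sub>C v2) v1)) y)"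
    by (simp add: U.mode_lmult[OF yV] T.mlie_mconst_mfrac mres_mconst_left[OF T.mero_map_mfrac] del: lie_linear)
  have c4: "U.cls (lmult (mfrac t z v1) (U.mode z ?c y)) = 0"
    using U.lmult_cong[OF T.mero_map_mfrac, of "U.mode z ?c y" 0 z v1] U.mode_regular[OF creg yr] by simp
  have c5: "U.cls (U.mode z (mfrac t z (lie (\<kappa> *\<^sub>C v2) v1)) y) = \<kappa> *\<^sub>C U.cls (U.mode z (mfrac t z (lie v2 v1)) y)"
    using clin_scale[OF T.clin_mode_mfrac[OF yV], of \<kappa> "lie v2 v1"] by simp
  have 3: "U.cls (U.mode z ?c ?Z) = \<kappa> *\<^sub>C U.cls (U.mode z (mfrac t z (lie v2 v1)) y)"
    unfolding c1 c2 c3 c4 c5 by simp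
  have "?du\<^sup>2 *\<^sub>C U.cls (U.mode z (mfrac u z v2) (U.mode z (mfrac u z v1) x)) =
    ?du *\<^sub>C ?dt *\<^sub>C U.cls (U.mode z (mfrac u z v2) ?Z)"
    by (simp only: 1[symmetric] power2_eq_square scaleC_scaleC)
  also have "\<dots> = ?dt *\<^sub>C ?du *\<^sub>C U.cls (U.mode z (mfrac u z v2) ?Z)"
    by (simp only: scaleC_scaleC mult.commute)
  also have "\<dots> = ?dt\<^sup>2 *\<^sub>C U.cls (U.mode z (mfrac t z v2) ?Z) +
    (\<kappa> * ?dt) *\<^sub>C U.cls (U.mode z (mfrac t z (lie v2 v1)) y)"
    by (simp only: 2 3 scaleC_add_right scaleC_scaleC power2_eq_square mult.commute)
  finally show ?thesis by (simp only: cls_def mode_def)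
qed

text \<open>The operators are expanded in \<open>t\<close>, where the regular part is known, while
  the singular terms stay in \<open>u\<close>. The double poles match exactly; the simple poles
  match up to a regular multiple of the field attached to [v2, v1].\<close>

lemma field_limit:
  fixes v1 v2 :: "'g::quadratic_lie_algebra" and W :: "nat \<Rightarrow> 'w::complex_vector set"
  assumes U: "field_point n W \<rho> \<zeta> u P z" and T: "field_point n W \<rho> \<zeta> t Q z"
    and y: "y \<in> vecs n W (field_coord.vanreg Q z)"
  defines "j \<equiv> \<lambda>a z. tensor_rep.mode n \<rho> \<zeta> z (kmap z a)" and "cls \<equiv> tensor_rep.cls n W \<rho>"
    and "mode \<equiv> tensor_rep.mode n \<rho> \<zeta>"
  assumes x: "cls y = cls x"
    and r: "cls r = cls (mode z (mfrac u z v2) (mode z (mfrac u z v1) x))"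
  shows "tends n W \<rho> Q t z (\<lambda>w. (1 / (diff_at u z * diff_at u w)) *\<^sub>C
      (j v2 w (j v1 z y) - (form v1 v2 * diff_at u z * diff_at u w / (u z - u w)\<^sup>2) *\<^sub>C y
       - (1 / (u w - u z) * diff_at u w) *\<^sub>C j (lie v2 v1) z y)) r"
proof -
  interpret U: field_point n W \<rho> \<zeta> u P z by fact
  interpret T: field_point n W \<rho> \<zeta> t Q z by fact
  let ?du = "diff_at u z" and ?dt = "diff_at t z" and ?v = "lie v2 v1"
  obtain \<kappa> where \<kappa>: "\<And>p. p \<noteq> P \<Longrightarrow> p \<noteq> Q \<Longrightarrow> p \<noteq> z \<Longrightarrow>
      diff_at u z / (u p - u z) = diff_at t z / (t p - t z) + \<kappa>"
    using moebius_relation[OF U.coordinate T.coordinate U.zP T.zP] by metis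
  note du = U.u_chart(2)[OF U.zP] T.u_chart(2)[OF T.zP]
  let ?I = "iota_hat n \<rho> \<zeta> t z v1 y"
  let ?B = "\<lambda>w. lmult (mfrac t w v2) (lmult (mfrac t z v1) y) + lmult (mfrac t w v2) ?I + T.ihat w v2 ?I
      + lmult (mfrac t z v1) (T.ihat w v2 y)"
  define E where "E w = ?dt + \<kappa> * (t w - t z)" for w
  \<comment> \<open>Its square is the ratio of the products of differentials of \<open>t\<close> and
    of \<open>u\<close> at \<open>z\<close> and \<open>w\<close> (equation \<open>a1\<close>). Being
    affine in \<open>t w\<close>, it is an admissible coefficient without pole.\<close>
  define \<epsilon> where "\<epsilon> w = (?dt - \<kappa> * t z) / ?du + \<kappa> / ?du * t w" for w
  have \<epsilon>: "\<epsilon> w = E w / ?du" for w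
    using du by (simp add: \<epsilon>_def E_def field_simps)
  have rc: "regular_coeff t z \<epsilon>" unfolding \<epsilon>_def by (rule T.regular_coeff_linear)
  \<comment> \<open>The last summand is what remains of the simple pole subtracted in
    \<open>u\<close> after that in \<open>t\<close> has cancelled (equation
    \<open>a3\<close>).\<close>
  let ?c = "\<lambda>w. (\<epsilon> w * \<epsilon> w) *\<^sub>C (?B w + T.dq ?v y w) + (\<kappa> / ?du * \<epsilon> w) *\<^sub>C U.mode z (mfrac t z ?v) y"
  let ?y = "(\<epsilon> z * \<epsilon> z) *\<^sub>C U.mode z (mfrac t z v2) (U.mode z (mfrac t z v1) y)
    + (\<kappa> / ?du * \<epsilon> z) *\<^sub>C U.mode z (mfrac t z ?v) y"
  have "T.limit z ?c ?y"
    by (intro T.limit_add T.limit_scale T.limit_regular_part T.limit_mode_const y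
        T.regular_coeff_mult T.regular_coeff_const rc)
  then show ?thesis
  proof (rule T.limit_imp_tends[OF T.limit_cong])
    note I = T.iota_hat_vecs[OF y, of v1]
    have "\<forall>\<^sub>F w in punctured z. field_point n W \<rho> \<zeta> t Q w" "\<forall>\<^sub>F w in punctured z. field_point n W \<rho> \<zeta> u P w"
      "\<forall>\<^sub>F w in punctured z. y \<in> vecs n W (T.vanreg w)" "\<forall>\<^sub>F w in punctured z. ?I \<in> vecs n W (T.vanreg w)"
      using T.near_field_point U.near_field_point T.near_vecs[OF y] T.near_vecs[OF I]
      by (simp_all add: eventually_near_iff)
    then show "\<forall>\<^sub>F w in punctured z. U.cls ((1 / (?du * diff_at u w)) *\<^sub>C
      (j v2 w (j v1 z y) - (form v1 v2 * ?du * diff_at u w / (u z - u w)\<^sup>2) *\<^sub>C y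
       - (1 / (u w - u z) * diff_at u w) *\<^sub>C j ?v z y)) = U.cls (?c w)"
      using eventually_neq_punctured[of z z]
    proof eventually_elim
      case (elim w)
      interpret Uw: field_point n W \<rho> \<zeta> u P w by fact
      interpret Tw: field_point n W \<rho> \<zeta> t Q w by fact
      note m = moebius_differential[OF U.coordinate T.coordinate U.zP T.zP \<kappa> Uw.zP Tw.zP elim(5)]
      let ?s = "t w - t z" and ?dw = "diff_at u w" and ?tw = "diff_at t w" and ?E = "E w"
      have s: "?s \<noteq> 0" using T.u_inj[of w z] elim(5) T.zP Tw.zP by auto
      have E: "?E \<noteq> 0" "u w - u z = ?du * ?s / ?E" "?dw = ?du * ?dt * ?tw / ?E\<^sup>2"
        using m by (simp_all add: E_def)
      note nz = du T.u_chart(2)[OF Tw.zP] s E(1)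
      have "u z - u w = - (?du * ?s / ?E)" using E(2) by (simp add: algebra_simps)
      then have sq: "(u z - u w)\<^sup>2 = (?du * ?s / ?E)\<^sup>2" by simp
      have a1: "1 / (?du * ?dw) * (?dt * ?tw) = \<epsilon> w * \<epsilon> w"
        using nz by (simp add: E(3) \<epsilon> field_simps power2_eq_square)
      have a2: "1 / (?du * ?dw) * (form v1 v2 * ?du * ?dw / (u z - u w)\<^sup>2) = \<epsilon> w * \<epsilon> w * (form v1 v2 / ?s\<^sup>2)"
        unfolding sq using nz U.u_chart(2)[OF Uw.zP] by (simp add: \<epsilon> field_simps power2_eq_square)
      have a3: "1 / (?du * ?dw) * (1 / (u w - u z) * ?dw) * ?dt = \<epsilon> w * \<epsilon> w * (1 / ?s) - \<kappa> / ?du * \<epsilon> w"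
      proof -
        have "1 / (?du * ?dw) * (1 / (u w - u z) * ?dw) * ?dt = ?dt * ?E / (?du\<^sup>2 * ?s)"
          unfolding E(2) using nz U.u_chart(2)[OF Uw.zP] by (simp add: field_simps power2_eq_square)
        also have "\<dots> = (?E - \<kappa> * ?s) * ?E / (?du\<^sup>2 * ?s)" by (simp add: E_def)
        also have "\<dots> = \<epsilon> w * \<epsilon> w * (1 / ?s) - \<kappa> / ?du * \<epsilon> w"
          using nz by (simp add: \<epsilon> field_simps power2_eq_square)
        finally show ?thesis .
      qed
      have jz: "U.cls (j ?v z y) = ?dt *\<^sub>C (U.cls (lmult (mfrac t z ?v) y) + U.cls (T.ihat z ?v y))"
        by (simp add: j_def T.mode_kmap[OF T.vanreg_regular[OF y]] T.ihat_def)
      have jj: "U.cls (j v2 w (j v1 z y)) = (?dt * ?tw) *\<^sub>C (U.cls (?B w) + (form v1 v2 / ?s\<^sup>2) *\<^sub>C U.cls y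
        + (1 / ?s) *\<^sub>C U.cls (T.ihat w ?v y) + (1 / ?s) *\<^sub>C U.cls (lmult (mfrac t z ?v) y))"
        unfolding j_def by (rule T.two_point_product[OF elim(1,5) y elim(3,4)])
      have "U.cls ((1 / (?du * ?dw)) *\<^sub>C
        (j v2 w (j v1 z y) - (form v1 v2 * ?du * ?dw / (u z - u w)\<^sup>2) *\<^sub>C y
         - (1 / (u w - u z) * ?dw) *\<^sub>C j ?v z y)) =
        (\<epsilon> w * \<epsilon> w) *\<^sub>C (U.cls (?B w) + (1 / ?s) *\<^sub>C (U.cls (T.ihat w ?v y) - U.cls (T.ihat z ?v y)))
        + (\<kappa> / ?du * \<epsilon> w) *\<^sub>C (U.cls (lmult (mfrac t z ?v) y) + U.cls (T.ihat z ?v y))"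
        unfolding U.cls_linear(2,4) jz jj by (rule final_algebra[OF a1 a2 a3])
      also have "\<dots> = U.cls (?c w)"
        by (simp add: T.dq_def T.ihat_def)
      finally show ?case .
    qed
    \<comment> \<open>Since \<open>\<epsilon> z\<close> is \<open>?dt / ?du\<close>, the value of
      the representative at \<open>z\<close> has exactly the coefficients of
      \<open>coordinate_change\<close>.\<close>
    have "(?du * ?du) *\<^sub>C U.cls ?y = ?dt\<^sup>2 *\<^sub>C U.cls (U.mode z (mfrac t z v2) (U.mode z (mfrac t z v1) y))
      + (\<kappa> * ?dt) *\<^sub>C U.cls (U.mode z (mfrac t z ?v) y)"
      using du by (simp add: \<epsilon> E_def scaleC_add_right power2_eq_square field_simps)
    also have "\<dots> = ?du\<^sup>2 *\<^sub>C U.cls (U.mode z (mfrac u z v2) (U.mode z (mfrac u z v1) x))"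
      using coordinate_change[OF U T \<kappa> y, of x v2 v1] x by (simp add: cls_def)
    finally have "?du\<^sup>2 *\<^sub>C U.cls ?y = ?du\<^sup>2 *\<^sub>C U.cls r"
      using r by (simp add: cls_def mode_def power2_eq_square)
    then show "U.cls r = U.cls ?y" using du by (simp add: complex_vector.scale_cancel_left)
  qed
qed

text \<open>Each \<epsilon> and each \<iota> carries one factor \<open>diff_at u z\<close>, so
  dividing by its square leaves \<open>product_formula\<close>, with \<open>dhat\<close> as the
  derivative of \<open>iota_hat\<close>.\<close>

lemma (in field_point) cls_singular_part:
  assumes x: "x \<in> vecs n W (vanreg z)"
  shows "cls ((1 / (diff_at u z * diff_at u z)) *\<^sub>C
      (iota n \<rho> \<zeta> u z v2 (iota n \<rho> \<zeta> u z v1 x) + eps u z v2 (eps u z v1 x)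
       + eps u z v2 (iota n \<rho> \<zeta> u z v1 x) + eps u z v1 (iota n \<rho> \<zeta> u z v2 x)
       + (diff_at u z)\<^sup>2 *\<^sub>C dhat z (lie v2 v1) x)) =
    cls (mode z (mfrac u z v2) (mode z (mfrac u z v1) x))"
proof -
  let ?d = "diff_at u z"
  have i: "cls (iota n \<rho> \<zeta> u z v x) = cls (?d *\<^sub>C ihat z v x)" for v
    by (simp add: cls_iota[OF x])
  have ii: "cls (iota n \<rho> \<zeta> u z v2 (iota n \<rho> \<zeta> u z v1 x)) = ?d\<^sup>2 *\<^sub>C cls (ihat z v2 (ihat z v1 x))"
    using ihat_cong[OF i, of v2 v1]
    by (simp add: cls_iota[OF iota_vecs[OF x]] clin_scale[OF clin_ihat] power2_eq_square)
  have ei: "cls (eps u z v (iota n \<rho> \<zeta> u z v' x)) = ?d\<^sup>2 *\<^sub>C cls (lmult (mfrac u z v) (ihat z v' x))" for v v'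
    using lmult_cong[OF mero_map_mfrac[of z v] i[of v']] by (simp add: eps_def power2_eq_square)
  have ee: "cls (eps u z v2 (eps u z v1 x)) = ?d\<^sup>2 *\<^sub>C cls (lmult (mfrac u z v2) (lmult (mfrac u z v1) x))"
    by (simp add: eps_def power2_eq_square)
  show ?thesis
    unfolding product_formula[OF x] cls_linear ii ei ee scaleC_add_right
    using u_chart(2)[OF zP] by (simp add: power2_eq_square)
qed

theorem theorem11p12:
  fixes n :: nat
    and W :: "nat \<Rightarrow> 'w::complex_vector set"
    and \<rho> :: "nat \<Rightarrow> 'g::quadratic_lie_algebra \<Rightarrow> 'w \<Rightarrow> 'w"
    and \<zeta> :: "nat \<Rightarrow> proj"
  assumes "\<And>k. k < n \<Longrightarrow> irreducible_rep (W k) (\<rho> k)"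
    and "inj_on \<zeta> {..<n}"
  shows "\<exists>j :: 'g \<Rightarrow> proj \<Rightarrow> ('g, 'w) ivec \<Rightarrow> ('g, 'w) ivec.
    (\<forall>z (\<nu> :: 'g mmap). z \<notin> \<zeta> ` {..<n} \<longrightarrow> \<nu> \<in> regular_at z \<longrightarrow>
      induces_linear n W \<rho> (regular_at z) all_maps (j (val \<nu> z) z) \<and>
      (\<forall>P u. P \<notin> \<zeta> ` {..<n} \<union> {z} \<longrightarrow> coordinate u P \<longrightarrow>
        (\<forall>x \<in> vecs n W (vanishing_at P \<inter> regular_at z).
          equiv_mod n W \<rho> all_maps (j (val \<nu> z) z x)
            (eps u z (val \<nu> z) x + iota n \<rho> \<zeta> u z (val \<nu> z) x)))) \<and>
    (\<forall>v1 v2 z1 P u. z1 \<notin> \<zeta> ` {..<n} \<longrightarrow> P \<notin> \<zeta> ` {..<n} \<union> {z1} \<longrightarrow> coordinate u P \<longrightarrow>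
      (\<forall>x \<in> vecs n W (vanishing_at P \<inter> regular_at z1).
        \<exists>D. tends n W \<rho> P u z1
              (\<lambda>z. (1 / (u z - u z1)) *\<^sub>C
                (iota_hat n \<rho> \<zeta> u z (lie v2 v1) x - iota_hat n \<rho> \<zeta> u z1 (lie v2 v1) x)) D \<and>
          (\<forall>Q t. Q \<notin> \<zeta> ` {..<n} \<union> {z1} \<longrightarrow> coordinate t Q \<longrightarrow>
            (\<forall>y \<in> vecs n W (vanishing_at Q \<inter> regular_at z1).
              equiv_mod n W \<rho> (regular_at z1) y x \<longrightarrow>
              tends n W \<rho> Q t z1
                (\<lambda>z2. (1 / (diff_at u z1 * diff_at u z2)) *\<^sub>C
                  (j v2 z2 (j v1 z1 y)
                   - (form v1 v2 * diff_at u z1 * diff_at u z2 / (u z1 - u z2)\<^sup>2) *\<^sub>C y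
                   - (1 / (u z2 - u z1) * diff_at u z2) *\<^sub>C j (lie v2 v1) z1 y))
                ((1 / (diff_at u z1 * diff_at u z1)) *\<^sub>C
                  (iota n \<rho> \<zeta> u z1 v2 (iota n \<rho> \<zeta> u z1 v1 x)
                   + eps u z1 v2 (eps u z1 v1 x)
                   + eps u z1 v2 (iota n \<rho> \<zeta> u z1 v1 x)
                   + eps u z1 v1 (iota n \<rho> \<zeta> u z1 v2 x)
                   + (diff_at u z1)\<^sup>2 *\<^sub>C D))))))"
proof -
  have tr: "tensor_rep n W \<rho>"
    using assms(1) by unfold_locales (simp add: irreducible_rep_def)
  interpret tensor_rep n W \<rho> \<zeta> by (rule tr)
  have point: "mode_point n W \<rho> \<zeta> z" if "z \<notin> \<zeta> ` {..<n}" for z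
    using tr that by (intro mode_point.intro mode_point_axioms.intro) auto
  have field: "field_point n W \<rho> \<zeta> u P z"
    if "z \<notin> \<zeta> ` {..<n}" "P \<notin> \<zeta> ` {..<n} \<union> {z}" "coordinate u P" for u P z
    using tr point that
    by (intro field_point.intro field_coord.intro field_point_axioms.intro field_coord_axioms.intro coord.intro) auto
  show ?thesis
  \<comment> \<open>The witness involves neither \<open>P\<close> nor \<open>u\<close>; both enter
    only when it is compared with \<epsilon> + \<iota>.\<close>
  proof (intro exI[of _ "\<lambda>a z. mode z (kmap z a)"] conjI allI impI ballI)
    fix z and \<nu> :: "'g mmap" assume "z \<notin> \<zeta> ` {..<n}"
    then show "induces_linear n W \<rho> (regular_at z) all_maps (mode z (kmap z (val \<nu> z)))"
      using mode_point.field_induces_linear[OF point] by blast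
  next
    fix z P u and x :: "('g, 'w) ivec" and \<nu> :: "'g mmap"
    assume *: "z \<notin> \<zeta> ` {..<n}" "P \<notin> \<zeta> ` {..<n} \<union> {z}" "coordinate u P"
      "x \<in> vecs n W (vanishing_at P \<inter> regular_at z)"
    interpret U: field_point n W \<rho> \<zeta> u P z using *(1-3) by (rule field)
    show "equiv_mod n W \<rho> all_maps (mode z (kmap z (val \<nu> z)) x)
        (eps u z (val \<nu> z) x + iota n \<rho> \<zeta> u z (val \<nu> z) x)"
      unfolding equiv_iff using *(4) by (intro U.field_restricts) (simp add: U.vanreg_def)
  next
    fix v1 v2 :: 'g and z1 P u and x :: "('g, 'w) ivec"
    assume *: "z1 \<notin> \<zeta> ` {..<n}" "P \<notin> \<zeta> ` {..<n} \<union> {z1}" "coordinate u P"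
      "x \<in> vecs n W (vanishing_at P \<inter> regular_at z1)"
    interpret U: field_point n W \<rho> \<zeta> u P z1 using *(1-3) by (rule field)
    have x: "x \<in> vecs n W (U.vanreg z1)" using *(4) by (simp add: U.vanreg_def)
    \<comment> \<open>The mode of the double pole, which \<open>limit_dq\<close> identifies as the
      derivative of \<open>iota_hat\<close>.\<close>
    let ?D = "U.dhat z1 (lie v2 v1) x"
    have "\<forall>\<^sub>F w in punctured z1. field_point n W \<rho> \<zeta> u P w" "\<forall>\<^sub>F w in punctured z1. x \<in> vecs n W (U.vanreg w)"
      using U.near_field_point U.near_vecs[OF x] by (simp_all add: eventually_near_iff)
    then have "\<forall>\<^sub>F w in punctured z1. cls ((1 / (u w - u z1)) *\<^sub>C
        (iota_hat n \<rho> \<zeta> u w (lie v2 v1) x - iota_hat n \<rho> \<zeta> u z1 (lie v2 v1) x)) = cls (U.dq (lie v2 v1) x w)"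
      by eventually_elim (simp add: U.dq_def field_point.cls_iota_hat U.cls_iota_hat[OF x])
    then have D: "tends n W \<rho> P u z1 (\<lambda>w. (1 / (u w - u z1)) *\<^sub>C
        (iota_hat n \<rho> \<zeta> u w (lie v2 v1) x - iota_hat n \<rho> \<zeta> u z1 (lie v2 v1) x)) ?D"
      by (intro U.limit_imp_tends[OF U.limit_cong[OF U.limit_dq[OF x]]]) simp_all
    show "\<exists>D. tends n W \<rho> P u z1 (\<lambda>z. (1 / (u z - u z1)) *\<^sub>C
          (iota_hat n \<rho> \<zeta> u z (lie v2 v1) x - iota_hat n \<rho> \<zeta> u z1 (lie v2 v1) x)) D \<and>
        (\<forall>Q t. Q \<notin> \<zeta> ` {..<n} \<union> {z1} \<longrightarrow> coordinate t Q \<longrightarrow>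
          (\<forall>y \<in> vecs n W (vanishing_at Q \<inter> regular_at z1). equiv_mod n W \<rho> (regular_at z1) y x \<longrightarrow>
            tends n W \<rho> Q t z1 (\<lambda>z2. (1 / (diff_at u z1 * diff_at u z2)) *\<^sub>C
                (mode z2 (kmap z2 v2) (mode z1 (kmap z1 v1) y)
                 - (form v1 v2 * diff_at u z1 * diff_at u z2 / (u z1 - u z2)\<^sup>2) *\<^sub>C y
                 - (1 / (u z2 - u z1) * diff_at u z2) *\<^sub>C mode z1 (kmap z1 (lie v2 v1)) y))
              ((1 / (diff_at u z1 * diff_at u z1)) *\<^sub>C
                (iota n \<rho> \<zeta> u z1 v2 (iota n \<rho> \<zeta> u z1 v1 x) + eps u z1 v2 (eps u z1 v1 x)
                 + eps u z1 v2 (iota n \<rho> \<zeta> u z1 v1 x) + eps u z1 v1 (iota n \<rho> \<zeta> u z1 v2 x)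
                 + (diff_at u z1)\<^sup>2 *\<^sub>C D))))"
    proof (rule exI[of _ ?D], intro conjI allI impI ballI D)
      fix Q t and y :: "('g, 'w) ivec"
      assume **: "Q \<notin> \<zeta> ` {..<n} \<union> {z1}" "coordinate t Q"
        "y \<in> vecs n W (vanishing_at Q \<inter> regular_at z1)" "equiv_mod n W \<rho> (regular_at z1) y x"
      have T: "field_point n W \<rho> \<zeta> t Q z1" using *(1) **(1,2) by (rule field)
      then interpret T: field_point n W \<rho> \<zeta> t Q z1 .
      have y: "y \<in> vecs n W (T.vanreg z1)" using **(3) by (simp add: T.vanreg_def)
      \<comment> \<open>Here \<open>y\<close> rewrites the element given by \<open>x\<close> in
        letters vanishing at \<open>Q\<close>; the two agree as classes, not as words.\<close>
      have xy: "cls y = cls x" using equiv_mod_mono[OF **(4)] by (simp add: equiv_iff)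
      show "tends n W \<rho> Q t z1 (\<lambda>z2. (1 / (diff_at u z1 * diff_at u z2)) *\<^sub>C
                (mode z2 (kmap z2 v2) (mode z1 (kmap z1 v1) y)
                 - (form v1 v2 * diff_at u z1 * diff_at u z2 / (u z1 - u z2)\<^sup>2) *\<^sub>C y
                 - (1 / (u z2 - u z1) * diff_at u z2) *\<^sub>C mode z1 (kmap z1 (lie v2 v1)) y))
              ((1 / (diff_at u z1 * diff_at u z1)) *\<^sub>C
                (iota n \<rho> \<zeta> u z1 v2 (iota n \<rho> \<zeta> u z1 v1 x) + eps u z1 v2 (eps u z1 v1 x)
                 + eps u z1 v2 (iota n \<rho> \<zeta> u z1 v1 x) + eps u z1 v1 (iota n \<rho> \<zeta> u z1 v2 x)
                 + (diff_at u z1)\<^sup>2 *\<^sub>C ?D))"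
        by (rule field_limit[OF U.field_point_axioms T y xy U.cls_singular_part[OF x]])
    qed
  qed
qed

end
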